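(* Let $\Lambda$ be a finitely generated Noetherian domain and let $M,N$ be finitely generated $\Lambda$-modules with $\widehat{M} \cong \widehat{N}$. Then: (1) The annihilators of $M$ and $N$ in $\Lambda$ agree: $\operatorname{Ann}_\Lambda(M) = \operatorname{Ann}_\Lambda(N)$. (2) For any maximal ideal $\mathfrak{I} \trianglelefteq \Lambda$, the minimal numbers of generators of the localisations $M_{\mathfrak{I}}$ and $N_{\mathfrak{I}}$ as $\Lambda_{\mathfrak{I}}$-modules agree: $\mu_{\mathfrak{I}}(M) = \mu_{\mathfrak{I}}(N)$. (3) For $\nu \in \mathbb{N}$, the $\Lambda$-module $M$ is projective of rank $\nu$ if and only if the $\Lambda$-module $N$ is projective of rank $\nu$.
   Context: Rings are commutative. A commutative ring $\Lambda$ is called finitely generated if it is finitely generated as a $\mathbb{Z}$-algebra. For a $\Lambda$-module $M$, $\widehat{M}$ denotes the $\Lambda$-profinite completion of $M$, i.e. the topological $\Lambda$-module given by the inverse limit of the finite (as sets) quotient $\Lambda$-modules of $M$, each taken with the discrete topology; $\widehat{M} \cong \widehat{N}$ means isomorphism of profinite (topological) $\Lambda$-modules. For a maximal ideal $\mathfrak{I}$ of $\Lambda$, $\mu_{\mathfrak{I}}(M)$ denotes the minimal number of generators of the localisation $M_{\mathfrak{I}} = M \otimes_\Lambda \Lambda_{\mathfrak{I}}$ as a module over $\Lambda_{\mathfrak{I}}$. A finitely generated projective module $M$ has rank $\nu$ if $M_{\mathfrak{I}}$ is free of rank $\nu$ over $\Lambda_{\mathfrak{I}}$ for every maximal ideal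 $\mathfrak{I}$. *)

theory Defs
  imports
    "HOL-Analysis.Product_Topology"
    "HOL-Algebra.Free_Abelian_Groups"
    "HOL-Algebra.Generated_Rings"
    "HOL-Algebra.Ring_Divisibility"
begin

text \<open>
  The record type of modules extends the one of rings, but the locale \<^locale>\<open>Module.module\<close>
  does not constrain the fields \<^const>\<open>monoid.mult\<close> and \<^const>\<open>one\<close>. The modules constructed
  below leave these two fields undefined.
\<close>

section \<open>Finiteness conditions, homomorphisms, free and projective modules\<close>

definition finitely_generated_ring :: "('a, 'r) ring_scheme \<Rightarrow> bool" where
  "finitely_generated_ring R \<longleftrightarrow>
    (\<exists>S. finite S \<and> S \<subseteq> carrier R \<and> generate_ring R S = carrier R)"

definition module_span ::
  "('a, 'r) ring_scheme \<Rightarrow> ('a, 'm, 'k) module_scheme \<Rightarrow> 'm set \<Rightarrow> 'm set" where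
  "module_span R M S = \<Inter> {H. submodule H R M \<and> S \<subseteq> H}"

definition finitely_generated_module ::
  "('a, 'r) ring_scheme \<Rightarrow> ('a, 'm, 'k) module_scheme \<Rightarrow> bool" where
  "finitely_generated_module R M \<longleftrightarrow>
    (\<exists>S. finite S \<and> S \<subseteq> carrier M \<and> module_span R M S = carrier M)"

text \<open>Only meaningful for finitely generated modules.\<close>

definition min_generators ::
  "('a, 'r) ring_scheme \<Rightarrow> ('a, 'm, 'k) module_scheme \<Rightarrow> nat" where
  "min_generators R M =
    (LEAST n. \<exists>S. finite S \<and> card S = n \<and> S \<subseteq> carrier M \<and> module_span R M S = carrier M)"

definition annihilator ::
  "('a, 'r) ring_scheme \<Rightarrow> ('a, 'm, 'k) module_scheme \<Rightarrow> 'a set" where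
  "annihilator R M = {r \<in> carrier R. \<forall>x \<in> carrier M. r \<odot>\<^bsub>M\<^esub> x = \<zero>\<^bsub>M\<^esub>}"

definition mod_hom :: "('a, 'r) ring_scheme \<Rightarrow> ('a, 'm, 'k) module_scheme \<Rightarrow>
    ('a, 'n, 'l) module_scheme \<Rightarrow> ('m \<Rightarrow> 'n) set" where
  "mod_hom R M N = {f \<in> carrier M \<rightarrow> carrier N.
     (\<forall>x \<in> carrier M. \<forall>y \<in> carrier M. f (x \<oplus>\<^bsub>M\<^esub> y) = f x \<oplus>\<^bsub>N\<^esub> f y) \<and>
     (\<forall>r \<in> carrier R. \<forall>x \<in> carrier M. f (r \<odot>\<^bsub>M\<^esub> x) = r \<odot>\<^bsub>N\<^esub> f x)}"

definition mod_iso :: "('a, 'r) ring_scheme \<Rightarrow> ('a, 'm, 'k) module_scheme \<Rightarrow>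
    ('a, 'n, 'l) module_scheme \<Rightarrow> ('m \<Rightarrow> 'n) set" where
  "mod_iso R M N = {f \<in> mod_hom R M N. bij_betw f (carrier M) (carrier N)}"

definition free_module :: "('a, 'r) ring_scheme \<Rightarrow> 'i set \<Rightarrow> ('a, 'i \<Rightarrow> 'a) module" where
  "free_module R X =
    \<lparr>carrier = {f \<in> X \<rightarrow>\<^sub>E carrier R. finite {i \<in> X. f i \<noteq> \<zero>\<^bsub>R\<^esub>}},
     monoid.mult = undefined, one = undefined,
     zero = (\<lambda>i\<in>X. \<zero>\<^bsub>R\<^esub>),
     add = (\<lambda>f g. \<lambda>i\<in>X. f i \<oplus>\<^bsub>R\<^esub> g i),
     smult = (\<lambda>r f. \<lambda>i\<in>X. r \<otimes>\<^bsub>R\<^esub> f i)\<rparr>"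

definition free_of_rank ::
  "('a, 'r) ring_scheme \<Rightarrow> ('a, 'm, 'k) module_scheme \<Rightarrow> nat \<Rightarrow> bool" where
  "free_of_rank R M n \<longleftrightarrow> mod_iso R (free_module R {..<n}) M \<noteq> {}"

text \<open>
  A module is projective if it is isomorphic to a direct summand \<open>P\<close> of a free module. Letting
  the basis \<open>X\<close> range over sets of elements of the type of \<open>M\<close> is no restriction: if \<open>M\<close> is a
  direct summand of any free module, then the canonical surjection onto \<open>M\<close> from the free
  module on \<^term>\<open>carrier M\<close> splits.
\<close>

definition projective_module ::
  "('a, 'r) ring_scheme \<Rightarrow> ('a, 'm, 'k) module_scheme \<Rightarrow> bool" where
  "projective_module R M \<longleftrightarrow>
    (\<exists>(X :: 'm set) P Q. let F = free_module R X in
       submodule P R F \<and> submodule Q R F \<and>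
       P \<inter> Q = {\<zero>\<^bsub>F\<^esub>} \<and> P <+>\<^bsub>F\<^esub> Q = carrier F \<and>
       mod_iso R M (F\<lparr>carrier := P\<rparr>) \<noteq> {})"


section \<open>Profinite completion\<close>

definition quotient_module ::
  "('a, 'm, 'k) module_scheme \<Rightarrow> 'm set \<Rightarrow> ('a, 'm set) module" where
  "quotient_module M H =
    \<lparr>carrier = a_rcosets\<^bsub>M\<^esub> H,
     monoid.mult = undefined, one = undefined,
     zero = H,
     add = set_add M,
     smult = (\<lambda>r X. \<Union>x\<in>X. H +>\<^bsub>M\<^esub> (r \<odot>\<^bsub>M\<^esub> x))\<rparr>"

definition cofinite_submodules ::
  "('a, 'r) ring_scheme \<Rightarrow> ('a, 'm, 'k) module_scheme \<Rightarrow> 'm set set" where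
  "cofinite_submodules R M = {H. submodule H R M \<and> finite (carrier (quotient_module M H))}"

text \<open>
  For submodules \<open>H \<subseteq> K\<close>, the canonical map from the quotient by \<open>H\<close> to the quotient by \<open>K\<close>
  sends a coset \<open>X\<close> of \<open>H\<close> to the coset \<open>K + X\<close> of \<open>K\<close>.
\<close>

definition profinite_completion ::
  "('a, 'r) ring_scheme \<Rightarrow> ('a, 'm, 'k) module_scheme \<Rightarrow> ('a, 'm set \<Rightarrow> 'm set) module" where
  "profinite_completion R M =
    (let \<F> = cofinite_submodules R M in
    \<lparr>carrier = {x \<in> \<Pi>\<^sub>E H\<in>\<F>. carrier (quotient_module M H).
                 \<forall>H\<in>\<F>. \<forall>K\<in>\<F>. H \<subseteq> K \<longrightarrow> K <+>\<^bsub>M\<^esub> x H = x K},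
     monoid.mult = undefined, one = undefined,
     zero = (\<lambda>H\<in>\<F>. \<zero>\<^bsub>quotient_module M H\<^esub>),
     add = (\<lambda>x y. \<lambda>H\<in>\<F>. x H \<oplus>\<^bsub>quotient_module M H\<^esub> y H),
     smult = (\<lambda>r x. \<lambda>H\<in>\<F>. r \<odot>\<^bsub>quotient_module M H\<^esub> x H)\<rparr>)"

definition profinite_topology ::
  "('a, 'r) ring_scheme \<Rightarrow> ('a, 'm, 'k) module_scheme \<Rightarrow> ('m set \<Rightarrow> 'm set) topology" where
  "profinite_topology R M =
    subtopology
      (product_topology (\<lambda>H. discrete_topology (carrier (quotient_module M H)))
        (cofinite_submodules R M))
      (carrier (profinite_completion R M))"

definition profinite_completions_isomorphic :: "('a, 'r) ring_scheme \<Rightarrow>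
    ('a, 'm, 'k) module_scheme \<Rightarrow> ('a, 'n, 'l) module_scheme \<Rightarrow> bool" where
  "profinite_completions_isomorphic R M N \<longleftrightarrow>
    (\<exists>f \<in> mod_iso R (profinite_completion R M) (profinite_completion R N).
       homeomorphic_map (profinite_topology R M) (profinite_topology R N) f)"


section \<open>Localisation\<close>

definition fraction :: "('a, 'r) ring_scheme \<Rightarrow> 'a set \<Rightarrow> 'a \<Rightarrow> 'a \<Rightarrow> ('a \<times> 'a) set" where
  "fraction R S r s =
    {(r', s') \<in> carrier R \<times> S.
       \<exists>t\<in>S. t \<otimes>\<^bsub>R\<^esub> ((r \<otimes>\<^bsub>R\<^esub> s') \<ominus>\<^bsub>R\<^esub> (r' \<otimes>\<^bsub>R\<^esub> s)) = \<zero>\<^bsub>R\<^esub>}"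

definition fraction_ring :: "('a, 'r) ring_scheme \<Rightarrow> 'a set \<Rightarrow> ('a \<times> 'a) set ring" where
  "fraction_ring R S =
    \<lparr>carrier = {fraction R S r s | r s. r \<in> carrier R \<and> s \<in> S},
     monoid.mult = (\<lambda>X Y. \<Union>(r, s)\<in>X. \<Union>(r', s')\<in>Y. fraction R S (r \<otimes>\<^bsub>R\<^esub> r') (s \<otimes>\<^bsub>R\<^esub> s')),
     one = fraction R S \<one>\<^bsub>R\<^esub> \<one>\<^bsub>R\<^esub>,
     zero = fraction R S \<zero>\<^bsub>R\<^esub> \<one>\<^bsub>R\<^esub>,
     add = (\<lambda>X Y. \<Union>(r, s)\<in>X. \<Union>(r', s')\<in>Y.
       fraction R S ((r \<otimes>\<^bsub>R\<^esub> s') \<oplus>\<^bsub>R\<^esub> (r' \<otimes>\<^bsub>R\<^esub> s)) (s \<otimes>\<^bsub>R\<^esub> s'))\<rparr>"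

definition local_ring_at :: "('a, 'r) ring_scheme \<Rightarrow> 'a set \<Rightarrow> ('a \<times> 'a) set ring" where
  "local_ring_at R I = fraction_ring R (carrier R - I)"

text \<open>
  For a ring homomorphism \<open>\<phi>\<close> from \<open>R\<close> to \<open>A\<close>, \<open>base_change R A \<phi> M\<close> is the \<open>A\<close>-module
  \<open>M \<otimes>\<^bsub>R\<^esub> A\<close>: the free abelian group on pairs \<open>(x, a)\<close>, standing for \<open>x \<otimes> a\<close>, modulo the
  bilinearity relations, on which \<open>b\<close> in \<open>A\<close> acts by \<open>b (x \<otimes> a) = x \<otimes> b a\<close>.
\<close>

definition tensor_relations :: "('a, 'r) ring_scheme \<Rightarrow> ('b, 's) ring_scheme \<Rightarrow> ('a \<Rightarrow> 'b) \<Rightarrow>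
    ('a, 'm, 'k) module_scheme \<Rightarrow> ('m \<times> 'b \<Rightarrow>\<^sub>0 int) set" where
  "tensor_relations R A \<phi> M =
    {frag_of (x \<oplus>\<^bsub>M\<^esub> y, a) - frag_of (x, a) - frag_of (y, a) | x y a.
       x \<in> carrier M \<and> y \<in> carrier M \<and> a \<in> carrier A} \<union>
    {frag_of (x, a \<oplus>\<^bsub>A\<^esub> b) - frag_of (x, a) - frag_of (x, b) | x a b.
       x \<in> carrier M \<and> a \<in> carrier A \<and> b \<in> carrier A} \<union>
    {frag_of (r \<odot>\<^bsub>M\<^esub> x, a) - frag_of (x, \<phi> r \<otimes>\<^bsub>A\<^esub> a) | r x a.
       r \<in> carrier R \<and> x \<in> carrier M \<and> a \<in> carrier A}"

definition base_change :: "('a, 'r) ring_scheme \<Rightarrow> ('b, 's) ring_scheme \<Rightarrow> ('a \<Rightarrow> 'b) \<Rightarrow>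
    ('a, 'm, 'k) module_scheme \<Rightarrow> ('b, ('m \<times> 'b \<Rightarrow>\<^sub>0 int) set) module" where
  "base_change R A \<phi> M =
    (let F = free_Abelian_group (carrier M \<times> carrier A);
         K = generate F (tensor_relations R A \<phi> M)
     in \<lparr>carrier = carrier (F Mod K),
         monoid.mult = undefined, one = undefined,
         zero = \<one>\<^bsub>F Mod K\<^esub>,
         add = (\<lambda>X Y. X \<otimes>\<^bsub>F Mod K\<^esub> Y),
         smult = (\<lambda>b X. \<Union>z\<in>X.
           K #>\<^bsub>F\<^esub> frag_extend (\<lambda>(x, a). frag_of (x, b \<otimes>\<^bsub>A\<^esub> a)) z)\<rparr>)"

definition localised_module :: "('a, 'r) ring_scheme \<Rightarrow> 'a set \<Rightarrow> ('a, 'm, 'k) module_scheme \<Rightarrow>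
    (('a \<times> 'a) set, ('m \<times> ('a \<times> 'a) set \<Rightarrow>\<^sub>0 int) set) module" where
  "localised_module R I M =
    base_change R (local_ring_at R I) (\<lambda>r. fraction R (carrier R - I) r \<one>\<^bsub>R\<^esub>) M"

definition local_min_generators ::
  "('a, 'r) ring_scheme \<Rightarrow> 'a set \<Rightarrow> ('a, 'm, 'k) module_scheme \<Rightarrow> nat" where
  "local_min_generators R I M = min_generators (local_ring_at R I) (localised_module R I M)"

definition projective_of_rank ::
  "('a, 'r) ring_scheme \<Rightarrow> ('a, 'm, 'k) module_scheme \<Rightarrow> nat \<Rightarrow> bool" where
  "projective_of_rank R M n \<longleftrightarrow>
    finitely_generated_module R M \<and> projective_module R M \<and>
    (\<forall>I. maximalideal I R \<longrightarrow> free_of_rank (local_ring_at R I) (localised_module R I M) n)"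

end

theory Submission
  imports Defs "HOL-Algebra.Finite_Extensions"
begin

text \<open>
  An isomorphism of the completions is only used through its effect on finite quotients. A finite
  quotient \<open>N / H\<close> is a discrete quotient of the completion of \<open>N\<close>, hence of that of \<open>M\<close>, in which \<open>M\<close>
  is dense; so \<open>M\<close> maps onto \<open>N / H\<close>, and symmetrically \<open>N\<close> maps onto every finite quotient of \<open>M\<close>
  (\<open>isomorphic_completions_finite_quotients\<close>). These surjections need not be compatible with each
  other, so all three invariants have to be visible in single finite quotients. There are enough of
  these for two reasons.

  The first is the arithmetic Nullstellensatz. A domain that is generated as a ring by finitely
  many elements, and contains some \<open>s \<noteq> 0\<close> such that every nonzero element divides a power of \<open>s\<close>, is
  finite (\<open>inverts_all_imp_finite\<close>): generators are removed one by one, each being algebraic over the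
  subring generated by the others, and the property passes to that subring until it reaches the image
  of the integers. Hence maximal ideals have finite residue fields
  (\<open>maximal_ideal_finite_index\<close>), and every \<open>r \<noteq> 0\<close> is avoided by some maximal ideal
  (\<open>exists_maximal_ideal_avoiding\<close>). The second is residual finiteness (\<open>residually_finite\<close>): a
  submodule that is maximal among those omitting a given nonzero element has finite index.

  Annihilators: an element that kills \<open>M\<close> kills every finite quotient of \<open>N\<close>, and therefore \<open>N\<close>.

  Local numbers of generators: the quotient \<open>N / I N\<close> is finite, so images of local generators of \<open>M\<close> at
  \<open>I\<close> generate it, and by Nakayama's lemma their lifts generate \<open>N\<close> locally
  (\<open>locally_generated_transfer\<close>). For this, generation and freeness of the localisation \<open>M\<^sub>I\<close> are
  restated inside \<open>M\<close>, with one denominator \<open>u \<notin> I\<close> for all of \<open>M\<close> (\<open>local_min_generators_eq\<close>,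
  \<open>free_of_rank_iff\<close>).

  Projectivity: let \<open>M\<close> be locally free of rank \<open>\<nu>\<close>. Then \<open>N\<close> has \<open>\<nu>\<close> local generators at every maximal ideal
  \<open>I\<close>. A relation between them, with some coefficient \<open>r \<noteq> 0\<close>, would make one of them superfluous at every
  maximal ideal that avoids \<open>r u\<close>. At such an ideal \<open>N\<close>, and hence \<open>M\<close>, would be generated locally by
  \<open>\<nu> - 1\<close> elements, which is less than the rank of \<open>M\<close>. So \<open>N\<close> is locally free of rank \<open>\<nu>\<close> too
  (\<open>locally_free_transfer\<close>). Finally, local bases provide sections, up to a denominator, of a
  surjection from a free module. The denominators generate the unit ideal, so that the sections can be
  combined into an actual one, and \<open>N\<close> is projective (\<open>locally_free_imp_projective\<close>).
\<close>


section \<open>Linear combinations\<close>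

text \<open>Coefficient and generator lists are truncated to the shorter one, so that no case of the
  recursion is left unspecified; all uses have lists of equal length.\<close>

fun lincomb :: "('a, 'm, 'k) module_scheme \<Rightarrow> 'a list \<Rightarrow> 'm list \<Rightarrow> 'm" where
  "lincomb M (c # cs) (p # ps) = c \<odot>\<^bsub>M\<^esub> p \<oplus>\<^bsub>M\<^esub> lincomb M cs ps"
| "lincomb M [] ps = \<zero>\<^bsub>M\<^esub>"
| "lincomb M (c # cs) [] = \<zero>\<^bsub>M\<^esub>"

definition combinations :: "('a, 'm, 'k) module_scheme \<Rightarrow> 'a set \<Rightarrow> 'm list \<Rightarrow> 'm set" where
  "combinations M J ps = {lincomb M cs ps | cs. length cs = length ps \<and> set cs \<subseteq> J}"

lemma combinations_Nil [simp]: "combinations M J [] = {\<zero>\<^bsub>M\<^esub>}"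
  by (auto simp: combinations_def)

lemma combinations_Cons:
  "combinations M J (p # ps) = {c \<odot>\<^bsub>M\<^esub> p \<oplus>\<^bsub>M\<^esub> y | c y. c \<in> J \<and> y \<in> combinations M J ps}"
proof (intro equalityI subsetI)
  fix z assume "z \<in> combinations M J (p # ps)"
  then obtain cs where cs: "z = lincomb M cs (p # ps)" "length cs = Suc (length ps)" "set cs \<subseteq> J"
    by (auto simp: combinations_def)
  then obtain c cs' where "cs = c # cs'" by (cases cs) auto
  with cs show "z \<in> {c \<odot>\<^bsub>M\<^esub> p \<oplus>\<^bsub>M\<^esub> y | c y. c \<in> J \<and> y \<in> combinations M J ps}"
    by (auto simp: combinations_def)
next
  fix z assume "z \<in> {c \<odot>\<^bsub>M\<^esub> p \<oplus>\<^bsub>M\<^esub> y | c y. c \<in> J \<and> y \<in> combinations M J ps}"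
  then obtain c cs where "z = lincomb M (c # cs) (p # ps)" "length cs = length ps" "set cs \<subseteq> J" "c \<in> J"
    by (auto simp: combinations_def)
  then show "z \<in> combinations M J (p # ps)"
    unfolding combinations_def by (intro CollectI exI[of _ "c # cs"]) auto
qed

context module
begin

lemma lincomb_closed [simp]:
  "set cs \<subseteq> carrier R \<Longrightarrow> set ps \<subseteq> carrier M \<Longrightarrow> lincomb M cs ps \<in> carrier M"
  by (induction cs ps rule: list_induct2') auto

lemma lincomb_add:
  "length cs = length ps \<Longrightarrow> length ds = length ps \<Longrightarrow>
    set cs \<subseteq> carrier R \<Longrightarrow> set ds \<subseteq> carrier R \<Longrightarrow> set ps \<subseteq> carrier M \<Longrightarrow>
    lincomb M (map2 (\<oplus>) cs ds) ps = lincomb M cs ps \<oplus>\<^bsub>M\<^esub> lincomb M ds ps"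
proof (induction ps arbitrary: cs ds)
  case (Cons p ps)
  then obtain c cs' d ds' where "cs = c # cs'" "ds = d # ds'"
    by (metis length_Suc_conv)
  with Cons show ?case by (simp add: smult_l_distr M.a_ac)
qed auto

lemma lincomb_smult:
  "a \<in> carrier R \<Longrightarrow> set cs \<subseteq> carrier R \<Longrightarrow> set ps \<subseteq> carrier M \<Longrightarrow>
    lincomb M (map ((\<otimes>) a) cs) ps = a \<odot>\<^bsub>M\<^esub> lincomb M cs ps"
  by (induction cs ps rule: list_induct2') (auto simp: smult_r_distr smult_assoc1)

lemma combinations_closed:
  "J \<subseteq> carrier R \<Longrightarrow> set ps \<subseteq> carrier M \<Longrightarrow> combinations M J ps \<subseteq> carrier M"
  unfolding combinations_def by auto

lemma zero_in_combinations:
  "\<zero> \<in> J \<Longrightarrow> set ps \<subseteq> carrier M \<Longrightarrow> \<zero>\<^bsub>M\<^esub> \<in> combinations M J ps"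
  by (induction ps) (auto simp: combinations_Cons, metis M.r_zero M.zero_closed smult_l_null)

lemma combinations_submodule:
  assumes "ideal J R" and ps: "set ps \<subseteq> carrier M"
  shows "submodule (combinations M J ps) R M"
proof -
  interpret J: ideal J R by fact
  have sub: "J \<subseteq> carrier R" by (rule J.a_subset)
  have smult: "a \<odot>\<^bsub>M\<^esub> x \<in> combinations M J ps"
    if "a \<in> carrier R" "x \<in> combinations M J ps" for a x
  proof -
    from that obtain cs where cs: "x = lincomb M cs ps" "length cs = length ps" "set cs \<subseteq> J"
      unfolding combinations_def by auto
    then have "a \<odot>\<^bsub>M\<^esub> x = lincomb M (map ((\<otimes>) a) cs) ps"
      using lincomb_smult that ps sub by auto
    then show ?thesis
      unfolding combinations_def using cs J.I_l_closed that(1)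
      by (intro CollectI exI[of _ "map ((\<otimes>) a) cs"]) auto
  qed
  show ?thesis
  proof (rule submoduleI)
    show "combinations M J ps \<subseteq> carrier M" by (rule combinations_closed[OF sub ps])
    show "\<zero>\<^bsub>M\<^esub> \<in> combinations M J ps" by (rule zero_in_combinations) (auto simp: ps)
    show "a \<odot>\<^bsub>M\<^esub> x \<in> combinations M J ps"
      if "a \<in> carrier R" "x \<in> combinations M J ps" for a x using smult that .
    show "\<ominus>\<^bsub>M\<^esub> x \<in> combinations M J ps" if "x \<in> combinations M J ps" for x
      using smult[of "\<ominus> \<one>", OF _ that] that combinations_closed[OF sub ps]
      by (auto simp: smult_l_minus)
    show "x \<oplus>\<^bsub>M\<^esub> y \<in> combinations M J ps"
      if "x \<in> combinations M J ps" "y \<in> combinations M J ps" for x y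
    proof -
      from that obtain cs ds where *: "x = lincomb M cs ps" "length cs = length ps" "set cs \<subseteq> J"
        "y = lincomb M ds ps" "length ds = length ps" "set ds \<subseteq> J"
        unfolding combinations_def by auto
      then have "x \<oplus>\<^bsub>M\<^esub> y = lincomb M (map2 (\<oplus>) cs ds) ps"
        using lincomb_add[of cs ps ds] ps sub by auto
      moreover have "set (map2 (\<oplus>) cs ds) \<subseteq> J"
        using *(3,6) by (force dest: set_zip_leftD set_zip_rightD)
      ultimately show ?thesis
        unfolding combinations_def using *
        by (intro CollectI exI[of _ "map2 (\<oplus>) cs ds"]) auto
    qed
  qed
qed

lemma submodule_lincomb:
  assumes "submodule H R M"
  shows "set cs \<subseteq> carrier R \<Longrightarrow> set ps \<subseteq> H \<Longrightarrow> lincomb M cs ps \<in> H"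
  using submoduleE[OF assms] subgroup.one_closed[OF submodule.axioms(1)[OF assms]]
  by (induction cs ps rule: list_induct2') auto

lemma generators_in_combinations:
  "set ps \<subseteq> carrier M \<Longrightarrow> set ps \<subseteq> combinations M (carrier R) ps"
proof (induction ps)
  case (Cons p ps)
  have "p \<in> combinations M (carrier R) (p # ps)"
    unfolding combinations_Cons using zero_in_combinations[of "carrier R" ps] Cons.prems
    by (intro CollectI exI[of _ \<one>] exI[of _ "\<zero>\<^bsub>M\<^esub>"]) auto
  moreover have "x \<in> combinations M (carrier R) (p # ps)" if "x \<in> set ps" for x
    unfolding combinations_Cons using that Cons
    by (intro CollectI exI[of _ \<zero>] exI[of _ x]) auto
  ultimately show ?case by auto
qed auto

lemma span_eq_combinations:
  assumes "set ps \<subseteq> carrier M"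
  shows "module_span R M (set ps) = combinations M (carrier R) ps"
  using combinations_submodule[OF oneideal assms] generators_in_combinations[OF assms]
    submodule_lincomb
  unfolding module_span_def by (auto simp: combinations_def)

lemma finitely_generated_iff:
  "finitely_generated_module R M \<longleftrightarrow>
    (\<exists>ps. set ps \<subseteq> carrier M \<and> carrier M = combinations M (carrier R) ps)"
  unfolding finitely_generated_module_def
  by (metis finite_list List.finite_set span_eq_combinations)

lemma smult_in_combinations:
  assumes "ideal J R" "a \<in> J" "x \<in> combinations M (carrier R) ps" "set ps \<subseteq> carrier M"
  shows "a \<odot>\<^bsub>M\<^esub> x \<in> combinations M J ps"
proof -
  interpret J: ideal J R by fact
  obtain cs where cs: "x = lincomb M cs ps" "length cs = length ps" "set cs \<subseteq> carrier R"
    using assms(3) unfolding combinations_def by auto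
  then have "a \<odot>\<^bsub>M\<^esub> x = lincomb M (map ((\<otimes>) a) cs) ps"
    using lincomb_smult assms J.a_subset by auto
  then show ?thesis
    unfolding combinations_def using cs J.I_r_closed assms(2)
    by (intro CollectI exI[of _ "map ((\<otimes>) a) cs"]) auto
qed


section \<open>Nakayama's lemma\<close>

text \<open>The determinant trick without determinants: the relation for a generator \<open>p\<close> lets one
  eliminate \<open>p\<close> from all relations, at the price of squaring the multiplier modulo \<open>J\<close>.\<close>

lemma nakayama_aux:
  assumes J: "ideal J R" and H: "submodule H R M" and Y: "Y \<subseteq> carrier M" and e: "e \<in> carrier R"
  shows "set ps \<subseteq> Y \<Longrightarrow> u \<in> carrier R \<Longrightarrow> u \<ominus> e [^] (m::nat) \<in> J \<Longrightarrow>
    (\<And>x. x \<in> Y \<Longrightarrow> \<exists>h\<in>H. \<exists>y\<in>combinations M J ps. u \<odot>\<^bsub>M\<^esub> x = h \<oplus>\<^bsub>M\<^esub> y) \<Longrightarrow>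
    \<exists>v\<in>carrier R. \<exists>k::nat. v \<ominus> e [^] k \<in> J \<and> (\<forall>x\<in>Y. v \<odot>\<^bsub>M\<^esub> x \<in> H)"
proof (induction ps arbitrary: u m)
  case Nil
  then have "u \<odot>\<^bsub>M\<^esub> x \<in> H" if "x \<in> Y" for x
    using that submoduleE(1)[OF H] by fastforce
  then show ?case using Nil by blast
next
  case (Cons p ps)
  interpret J: ideal J R by fact
  note Jc = J.a_subset
  note Hc = submoduleE[OF H]
  have psM: "set ps \<subseteq> carrier M" and pM: "p \<in> carrier M" and pX: "p \<in> Y"
    using Cons.prems(1) Y by auto
  define C where "C = combinations M J ps"
  have Csub: "submodule C R M" unfolding C_def by (rule combinations_submodule[OF J psM])
  note Cc = submoduleE[OF Csub]
  obtain h j y where hy: "h \<in> H" "j \<in> J" "y \<in> C"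
      "u \<odot>\<^bsub>M\<^esub> p = h \<oplus>\<^bsub>M\<^esub> (j \<odot>\<^bsub>M\<^esub> p \<oplus>\<^bsub>M\<^esub> y)"
    using Cons.prems(4)[OF pX] unfolding combinations_Cons C_def by blast
  have carr: "h \<in> carrier M" "j \<in> carrier R" "y \<in> carrier M" "u \<in> carrier R"
    using hy Hc(1) Cc(1) Jc Cons.prems by auto
  define w where "w = u \<ominus> j"
  have w: "w \<in> carrier R" unfolding w_def using carr by auto
  have wp: "w \<odot>\<^bsub>M\<^esub> p = h \<oplus>\<^bsub>M\<^esub> y"
  proof -
    have "w \<odot>\<^bsub>M\<^esub> p = u \<odot>\<^bsub>M\<^esub> p \<oplus>\<^bsub>M\<^esub> \<ominus>\<^bsub>M\<^esub> (j \<odot>\<^bsub>M\<^esub> p)"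
      unfolding w_def a_minus_def using carr pM by (simp add: smult_l_distr smult_l_minus)
    also have "\<dots> = (h \<oplus>\<^bsub>M\<^esub> y) \<oplus>\<^bsub>M\<^esub> (j \<odot>\<^bsub>M\<^esub> p \<oplus>\<^bsub>M\<^esub> \<ominus>\<^bsub>M\<^esub> (j \<odot>\<^bsub>M\<^esub> p))"
      unfolding hy(4) using carr pM by (simp add: M.a_ac)
    also have "\<dots> = h \<oplus>\<^bsub>M\<^esub> y" using carr pM by (simp add: M.r_neg)
    finally show ?thesis .
  qed
  have step: "\<exists>h\<in>H. \<exists>y\<in>C. (w \<otimes> u) \<odot>\<^bsub>M\<^esub> x = h \<oplus>\<^bsub>M\<^esub> y" if x: "x \<in> Y" for x
  proof -
    obtain h' j' y' where hy': "h' \<in> H" "j' \<in> J" "y' \<in> C"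
        "u \<odot>\<^bsub>M\<^esub> x = h' \<oplus>\<^bsub>M\<^esub> (j' \<odot>\<^bsub>M\<^esub> p \<oplus>\<^bsub>M\<^esub> y')"
      using Cons.prems(4)[OF x] unfolding combinations_Cons C_def by blast
    have carr': "h' \<in> carrier M" "j' \<in> carrier R" "y' \<in> carrier M" "x \<in> carrier M"
      using hy' Hc(1) Cc(1) Jc x Y by auto
    have "(w \<otimes> u) \<odot>\<^bsub>M\<^esub> x = w \<odot>\<^bsub>M\<^esub> h' \<oplus>\<^bsub>M\<^esub> (w \<odot>\<^bsub>M\<^esub> (j' \<odot>\<^bsub>M\<^esub> p) \<oplus>\<^bsub>M\<^esub> w \<odot>\<^bsub>M\<^esub> y')"
      using carr carr' w pM by (simp add: smult_assoc1 hy'(4) smult_r_distr)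
    also have "w \<odot>\<^bsub>M\<^esub> (j' \<odot>\<^bsub>M\<^esub> p) = j' \<odot>\<^bsub>M\<^esub> h \<oplus>\<^bsub>M\<^esub> j' \<odot>\<^bsub>M\<^esub> y"
      using carr carr' w pM by (metis R.m_comm smult_assoc1 smult_r_distr wp)
    also have "w \<odot>\<^bsub>M\<^esub> h' \<oplus>\<^bsub>M\<^esub> ((j' \<odot>\<^bsub>M\<^esub> h \<oplus>\<^bsub>M\<^esub> j' \<odot>\<^bsub>M\<^esub> y) \<oplus>\<^bsub>M\<^esub> w \<odot>\<^bsub>M\<^esub> y') =
        (w \<odot>\<^bsub>M\<^esub> h' \<oplus>\<^bsub>M\<^esub> j' \<odot>\<^bsub>M\<^esub> h) \<oplus>\<^bsub>M\<^esub> (j' \<odot>\<^bsub>M\<^esub> y \<oplus>\<^bsub>M\<^esub> w \<odot>\<^bsub>M\<^esub> y')"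
      using carr carr' w by (simp add: M.a_ac)
    finally show ?thesis
      using Hc(4,5) Cc(4,5) hy(1,3) hy'(1,3) w carr(2) carr'(2)
      by (intro bexI[of _ "w \<odot>\<^bsub>M\<^esub> h' \<oplus>\<^bsub>M\<^esub> j' \<odot>\<^bsub>M\<^esub> h"] bexI[of _ "j' \<odot>\<^bsub>M\<^esub> y \<oplus>\<^bsub>M\<^esub> w \<odot>\<^bsub>M\<^esub> y'"]) auto
  qed
  have "(w \<otimes> u) \<ominus> e [^] (m + m) = (u \<ominus> e [^] m) \<otimes> (u \<oplus> e [^] m) \<ominus> j \<otimes> u"
  proof -
    define f where "f = e [^] m"
    have f: "f \<in> carrier R" using e f_def by auto
    have "e [^] (m + m) = f \<otimes> f" unfolding f_def using e by (simp add: nat_pow_mult)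
    moreover have "((u \<ominus> j) \<otimes> u) \<ominus> f \<otimes> f = (u \<ominus> f) \<otimes> (u \<oplus> f) \<ominus> j \<otimes> u"
      using f carr by algebra
    ultimately show ?thesis unfolding w_def f_def by simp
  qed
  also have "\<dots> \<in> J"
    using Cons.prems(3) hy(2) carr e unfolding a_minus_def[of _ "(u \<ominus> e [^] m) \<otimes> _"]
    by (intro J.a_closed J.a_inv_closed J.I_r_closed) auto
  finally show ?case
    using Cons.IH[of "w \<otimes> u" "m + m"] Cons.prems(1) step w carr unfolding C_def by auto
qed

text \<open>The multiplier \<open>e\<close> is kept general: \<open>e = \<one>\<close> is the classical statement; for \<open>H = {\<zero>}\<close> and
  \<open>Y\<close> containing an element with zero annihilator one obtains that \<open>J\<close> contains a power of \<open>e\<close>.\<close>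

lemma nakayama:
  assumes "ideal J R" "submodule H R M" "Y \<subseteq> carrier M" "set ps \<subseteq> Y" "e \<in> carrier R"
    and "\<And>x. x \<in> Y \<Longrightarrow> \<exists>h\<in>H. \<exists>y\<in>combinations M J ps. e \<odot>\<^bsub>M\<^esub> x = h \<oplus>\<^bsub>M\<^esub> y"
  obtains v k where "v \<in> carrier R" "v \<ominus> e [^] (k::nat) \<in> J" "\<And>x. x \<in> Y \<Longrightarrow> v \<odot>\<^bsub>M\<^esub> x \<in> H"
proof -
  have "e \<ominus> e [^] (1::nat) \<in> J"
    using assms(1,5) by (simp add: R.minus_eq R.r_neg ideal.axioms(1) additive_subgroup.zero_closed)
  with nakayama_aux[OF assms(1-3,5,4,5) this assms(6)] that show ?thesis by blast
qed

end


section \<open>Submodules of finite index\<close>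

text \<open>Module records extend ring records, so this covers ideals as well as submodules. Representatives
  are easier to combine along extensions than sets of cosets.\<close>

definition finite_index :: "('a, 'r) ring_scheme \<Rightarrow> 'a set \<Rightarrow> bool" where
  "finite_index G H \<longleftrightarrow>
    (\<exists>T. finite T \<and> T \<subseteq> carrier G \<and> (\<forall>x\<in>carrier G. \<exists>t\<in>T. x \<ominus>\<^bsub>G\<^esub> t \<in> H))"

lemma finite_indexI:
  "finite T \<Longrightarrow> T \<subseteq> carrier G \<Longrightarrow> (\<And>x. x \<in> carrier G \<Longrightarrow> \<exists>t\<in>T. x \<ominus>\<^bsub>G\<^esub> t \<in> H) \<Longrightarrow> finite_index G H"
  unfolding finite_index_def by (intro exI[of _ T]) simp

lemma finite_indexE:
  assumes "finite_index G H"
  obtains T where "finite T" "T \<subseteq> carrier G" "\<forall>x\<in>carrier G. \<exists>t\<in>T. x \<ominus>\<^bsub>G\<^esub> t \<in> H"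
  using assms unfolding finite_index_def by (elim exE conjE) (rule that)

lemma finite_index_mono: "finite_index G H \<Longrightarrow> H \<subseteq> K \<Longrightarrow> finite_index G K"
  unfolding finite_index_def by (meson subsetD)

lemma (in abelian_group) coset_eq_iff:
  assumes "subgroup H (add_monoid G)" "x \<in> carrier G" "y \<in> carrier G"
  shows "H +> x = H +> y \<longleftrightarrow> x \<ominus> y \<in> H"
proof -
  interpret abelian_subgroup H G
    by (rule abelian_subgroupI2[OF a_comm_group assms(1)])
  show ?thesis
  proof
    assume "H +> x = H +> y"
    then have "x \<in> H +> y" using a_rcos_self[OF assms(2)] by simp
    then obtain h where "h \<in> H" "x = h \<oplus> y" unfolding a_r_coset_def' by auto
    moreover have "h \<in> carrier G" using calculation a_subset by auto
    ultimately show "x \<ominus> y \<in> H" using assms(3) by (simp add: minus_eq a_assoc r_neg)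
  next
    assume "x \<ominus> y \<in> H"
    moreover have "x = (x \<ominus> y) \<oplus> y" using assms by (simp add: minus_eq a_assoc l_neg)
    ultimately have "x \<in> H +> y" unfolding a_r_coset_def' by blast
    then show "H +> x = H +> y" using a_repr_independence assms by blast
  qed
qed

lemma (in abelian_group) finite_index_iff:
  assumes H: "subgroup H (add_monoid G)"
  shows "finite_index G H \<longleftrightarrow> finite (a_rcosets H)"
proof
  assume "finite_index G H"
  then obtain T where T: "finite T" "T \<subseteq> carrier G" "\<forall>x\<in>carrier G. \<exists>t\<in>T. x \<ominus> t \<in> H"
    unfolding finite_index_def by blast
  then have "a_rcosets H \<subseteq> (\<lambda>t. H +> t) ` T"
    using coset_eq_iff[OF H] unfolding A_RCOSETS_def' by (fastforce simp: subset_iff)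
  with T(1) show "finite (a_rcosets H)" by (meson finite_imageI finite_subset)
next
  assume "finite (a_rcosets H)"
  moreover have "a_rcosets H = (\<lambda>x. H +> x) ` carrier G" unfolding A_RCOSETS_def' by auto
  ultimately obtain T where T: "finite T" "T \<subseteq> carrier G" "a_rcosets H = (\<lambda>x. H +> x) ` T"
    by (metis finite_subset_image order_refl)
  have "\<exists>t\<in>T. x \<ominus> t \<in> H" if x: "x \<in> carrier G" for x
  proof -
    have "H +> x \<in> a_rcosets H" using x unfolding A_RCOSETS_def' by auto
    then obtain t where "t \<in> T" "H +> x = H +> t" using T(3) by auto
    then show ?thesis using coset_eq_iff[OF H] x T(2) by blast
  qed
  with T(1,2) show "finite_index G H" unfolding finite_index_def by (intro exI[of _ T]) simp
qed

context module
begin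

lemma colon_ideal:
  assumes H: "submodule H R M" and p: "p \<in> carrier M"
  shows "ideal {a \<in> carrier R. a \<odot>\<^bsub>M\<^esub> p \<in> H} R"
proof (rule idealI[OF R.ring_axioms])
  note Hc = submoduleE[OF H]
  have z: "\<zero>\<^bsub>M\<^esub> \<in> H" using subgroup.one_closed[OF submodule.axioms(1)[OF H]] by simp
  show "subgroup {a \<in> carrier R. a \<odot>\<^bsub>M\<^esub> p \<in> H} (add_monoid R)"
    by (rule R.add.subgroupI) (use Hc p z in \<open>auto simp: smult_l_distr smult_l_minus intro!: exI[of _ \<zero>]\<close>)
  show "x \<otimes> a \<in> {a \<in> carrier R. a \<odot>\<^bsub>M\<^esub> p \<in> H}" if "a \<in> {a \<in> carrier R. a \<odot>\<^bsub>M\<^esub> p \<in> H}" "x \<in> carrier R" for a x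
    using that Hc p by (auto simp: smult_assoc1)
  then show "a \<otimes> x \<in> {a \<in> carrier R. a \<odot>\<^bsub>M\<^esub> p \<in> H}" if "a \<in> {a \<in> carrier R. a \<odot>\<^bsub>M\<^esub> p \<in> H}" "x \<in> carrier R" for a x
    using that R.m_comm by auto
qed

text \<open>The quotient \<open>M / H\<close> is a quotient of the finite direct sum of the cyclic modules \<open>R / (H : p)\<close>.\<close>

lemma finite_index_by_generators:
  assumes H: "submodule H R M" and ps: "set ps \<subseteq> carrier M" "carrier M = combinations M (carrier R) ps"
    and "\<And>p. p \<in> set ps \<Longrightarrow> finite_index R {a \<in> carrier R. a \<odot>\<^bsub>M\<^esub> p \<in> H}"
  shows "finite_index M H"
proof -
  note Hc = submoduleE[OF H]
  have "\<exists>T. finite T \<and> T \<subseteq> carrier M \<and> (\<forall>x\<in>combinations M (carrier R) qs. \<exists>t\<in>T. x \<ominus>\<^bsub>M\<^esub> t \<in> H)"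
    if "set qs \<subseteq> set ps" for qs
    using that
  proof (induction qs)
    case Nil
    have "\<zero>\<^bsub>M\<^esub> \<in> H" using subgroup.one_closed[OF submodule.axioms(1)[OF H]] by simp
    then show ?case by (intro exI[of _ "{\<zero>\<^bsub>M\<^esub>}"]) (auto simp: M.minus_eq M.r_neg)
  next
    case (Cons p qs)
    then obtain T where T: "finite T" "T \<subseteq> carrier M"
        "\<forall>x\<in>combinations M (carrier R) qs. \<exists>t\<in>T. x \<ominus>\<^bsub>M\<^esub> t \<in> H" by auto
    have "finite_index R {a \<in> carrier R. a \<odot>\<^bsub>M\<^esub> p \<in> H}" using assms(4)[of p] Cons.prems by simp
    then obtain A where A: "finite A" "A \<subseteq> carrier R"
        "\<forall>x\<in>carrier R. \<exists>t\<in>A. x \<ominus> t \<in> {a \<in> carrier R. a \<odot>\<^bsub>M\<^esub> p \<in> H}"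
      by (rule finite_indexE)
    have p: "p \<in> carrier M" and qs: "set qs \<subseteq> carrier M" using Cons.prems ps by auto
    let ?T = "(\<lambda>(a, t). a \<odot>\<^bsub>M\<^esub> p \<oplus>\<^bsub>M\<^esub> t) ` (A \<times> T)"
    have "\<exists>t\<in>?T. x \<ominus>\<^bsub>M\<^esub> t \<in> H" if x_in: "x \<in> combinations M (carrier R) (p # qs)" for x
    proof -
      obtain c y where x: "x = c \<odot>\<^bsub>M\<^esub> p \<oplus>\<^bsub>M\<^esub> y" "c \<in> carrier R" "y \<in> combinations M (carrier R) qs"
        using x_in unfolding combinations_Cons by auto
      obtain a t where at: "a \<in> A" "(c \<ominus> a) \<odot>\<^bsub>M\<^esub> p \<in> H" "t \<in> T" "y \<ominus>\<^bsub>M\<^esub> t \<in> H"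
        using bspec[OF A(3) x(2)] T(3) x by blast
      have y: "y \<in> carrier M" "a \<in> carrier R" "t \<in> carrier M"
        using x combinations_closed[OF _ qs] at A T by auto
      have "x \<ominus>\<^bsub>M\<^esub> (a \<odot>\<^bsub>M\<^esub> p \<oplus>\<^bsub>M\<^esub> t) = (c \<ominus> a) \<odot>\<^bsub>M\<^esub> p \<oplus>\<^bsub>M\<^esub> (y \<ominus>\<^bsub>M\<^esub> t)"
        using x y p by (simp add: M.minus_eq R.minus_eq smult_l_distr smult_l_minus M.minus_add M.a_ac)
      then have "x \<ominus>\<^bsub>M\<^esub> (a \<odot>\<^bsub>M\<^esub> p \<oplus>\<^bsub>M\<^esub> t) \<in> H" using Hc(5) at by auto
      then show ?thesis using at by auto
    qed
    moreover have "?T \<subseteq> carrier M" using p subsetD[OF A(2)] subsetD[OF T(2)] by auto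
    ultimately show ?case using A(1) T(1) by (intro exI[of _ ?T]) simp
  qed
  from this[of ps] show ?thesis unfolding finite_index_def using ps(2) by auto
qed

end


section \<open>Linear dependence over a domain\<close>

lemma (in module) lincomb_append:
  "length cs = length ps \<Longrightarrow> set cs \<subseteq> carrier R \<Longrightarrow> set ds \<subseteq> carrier R \<Longrightarrow>
    set ps \<subseteq> carrier M \<Longrightarrow> set qs \<subseteq> carrier M \<Longrightarrow>
    lincomb M (cs @ ds) (ps @ qs) = lincomb M cs ps \<oplus>\<^bsub>M\<^esub> lincomb M ds qs"
  by (induction cs ps rule: list_induct2) (auto simp: M.a_assoc)

lemma (in module) lincomb_eliminate:
  assumes "b \<in> carrier R" "y \<in> carrier M"
  shows "length ds = length zs \<Longrightarrow> length cs = length zs \<Longrightarrow>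
    set ds \<subseteq> carrier R \<Longrightarrow> set cs \<subseteq> carrier R \<Longrightarrow> set zs \<subseteq> carrier M \<Longrightarrow>
    \<exists>e\<in>carrier R. lincomb M ds (map2 (\<lambda>c z. b \<odot>\<^bsub>M\<^esub> z \<ominus>\<^bsub>M\<^esub> c \<odot>\<^bsub>M\<^esub> y) cs zs) =
      lincomb M (map ((\<otimes>) b) ds) zs \<oplus>\<^bsub>M\<^esub> e \<odot>\<^bsub>M\<^esub> y"
proof (induction ds zs arbitrary: cs rule: list_induct2)
  case Nil
  then show ?case using assms by (intro bexI[of _ \<zero>]) auto
next
  case (Cons d ds z zs)
  then obtain c cs' where cs: "cs = c # cs'" by (cases cs) auto
  have "\<exists>e\<in>carrier R. lincomb M ds (map2 (\<lambda>c z. b \<odot>\<^bsub>M\<^esub> z \<ominus>\<^bsub>M\<^esub> c \<odot>\<^bsub>M\<^esub> y) cs' zs) =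
      lincomb M (map ((\<otimes>) b) ds) zs \<oplus>\<^bsub>M\<^esub> e \<odot>\<^bsub>M\<^esub> y"
    by (rule Cons.IH) (use Cons.prems cs in auto)
  then obtain e where e: "e \<in> carrier R"
    "lincomb M ds (map2 (\<lambda>c z. b \<odot>\<^bsub>M\<^esub> z \<ominus>\<^bsub>M\<^esub> c \<odot>\<^bsub>M\<^esub> y) cs' zs) =
      lincomb M (map ((\<otimes>) b) ds) zs \<oplus>\<^bsub>M\<^esub> e \<odot>\<^bsub>M\<^esub> y" by blast
  have carr: "c \<in> carrier R" "d \<in> carrier R" "z \<in> carrier M"
      "lincomb M (map ((\<otimes>) b) ds) zs \<in> carrier M"
    using Cons cs assms by (auto intro!: lincomb_closed R.m_closed)
  have "d \<odot>\<^bsub>M\<^esub> (b \<odot>\<^bsub>M\<^esub> z \<ominus>\<^bsub>M\<^esub> c \<odot>\<^bsub>M\<^esub> y) = (b \<otimes> d) \<odot>\<^bsub>M\<^esub> z \<oplus>\<^bsub>M\<^esub> (\<ominus> (d \<otimes> c)) \<odot>\<^bsub>M\<^esub> y"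
    using carr assms
    by (simp add: M.minus_eq smult_r_distr smult_r_minus smult_l_minus smult_assoc1[symmetric] R.m_comm)
  then have "lincomb M (d # ds) (map2 (\<lambda>c z. b \<odot>\<^bsub>M\<^esub> z \<ominus>\<^bsub>M\<^esub> c \<odot>\<^bsub>M\<^esub> y) cs (z # zs)) =
      lincomb M (map ((\<otimes>) b) (d # ds)) (z # zs) \<oplus>\<^bsub>M\<^esub> (\<ominus> (d \<otimes> c) \<oplus> e) \<odot>\<^bsub>M\<^esub> y"
    using carr assms e cs by (simp add: smult_l_distr M.a_ac)
  then show ?case using carr e by (intro bexI[of _ "\<ominus> (d \<otimes> c) \<oplus> e"]) auto
qed

text \<open>Gaussian elimination without division: the pivot row is subtracted from suitable multiples of
  the other rows.\<close>

lemma (in module) linearly_dependent: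
  assumes "domain R"
  shows "set ps \<subseteq> carrier M \<Longrightarrow> set ys \<subseteq> combinations M (carrier R) ps \<Longrightarrow> length ps < length ys \<Longrightarrow>
    \<exists>cs. length cs = length ys \<and> set cs \<subseteq> carrier R \<and> \<not> set cs \<subseteq> {\<zero>} \<and> lincomb M cs ys = \<zero>\<^bsub>M\<^esub>"
proof (induction ps arbitrary: ys)
  case Nil
  then obtain y ys' where "ys = y # ys'" by (cases ys) auto
  moreover have "lincomb M (replicate (length zs) \<zero>) zs = \<zero>\<^bsub>M\<^esub>" if "set zs \<subseteq> carrier M" for zs
    using that by (induction zs) auto
  moreover have "set ys' \<subseteq> carrier M" using Nil(2) \<open>ys = y # ys'\<close> by auto
  ultimately show ?case using Nil domain.one_not_zero[OF assms]
    by (intro exI[of _ "\<one> # replicate (length ys') \<zero>"]) (auto simp: set_replicate_conv_if)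
next
  case (Cons p ps)
  interpret D: domain R by fact
  have p: "p \<in> carrier M" and ps: "set ps \<subseteq> carrier M" using Cons.prems by auto
  have combM: "combinations M (carrier R) ps \<subseteq> carrier M"
    using combinations_closed[OF _ ps] by auto
  note sub = submoduleE[OF combinations_submodule[OF R.oneideal ps]]
  have ysM: "set ys \<subseteq> carrier M"
    using Cons.prems combinations_closed[of "carrier R" "p # ps"] by auto
  show ?case
  proof (cases "set ys \<subseteq> combinations M (carrier R) ps")
    case True
    then show ?thesis using Cons.IH[OF ps] Cons.prems(3) by simp
  next
    case False
    then obtain y where y: "y \<in> set ys" "y \<notin> combinations M (carrier R) ps" by auto
    then obtain us vs where ys: "ys = us @ y # vs" by (meson split_list)
    define zs where "zs = us @ vs"
    have yM: "y \<in> carrier M" using y ysM by auto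
    have zsM: "set zs \<subseteq> carrier M" using ysM ys zs_def by auto
    obtain b y' where b: "b \<in> carrier R" "y' \<in> combinations M (carrier R) ps" "y = b \<odot>\<^bsub>M\<^esub> p \<oplus>\<^bsub>M\<^esub> y'"
      using y(1) Cons.prems(2) unfolding combinations_Cons by auto
    have "b \<noteq> \<zero>" using b y(2) p combM by auto
    have "\<exists>c z'. c \<in> carrier R \<and> z' \<in> combinations M (carrier R) ps \<and> z = c \<odot>\<^bsub>M\<^esub> p \<oplus>\<^bsub>M\<^esub> z'"
      if "z \<in> set zs" for z
      using that Cons.prems(2) ys unfolding zs_def combinations_Cons by auto
    then obtain cf zf where cf: "\<And>z. z \<in> set zs \<Longrightarrow> cf z \<in> carrier R \<and>
        zf z \<in> combinations M (carrier R) ps \<and> z = cf z \<odot>\<^bsub>M\<^esub> p \<oplus>\<^bsub>M\<^esub> zf z" by metis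
    define cs where "cs = map cf zs"
    define ws where "ws = map2 (\<lambda>c z. b \<odot>\<^bsub>M\<^esub> z \<ominus>\<^bsub>M\<^esub> c \<odot>\<^bsub>M\<^esub> y) cs zs"
    have ws_eq: "ws = map (\<lambda>z. b \<odot>\<^bsub>M\<^esub> z \<ominus>\<^bsub>M\<^esub> cf z \<odot>\<^bsub>M\<^esub> y) zs"
      unfolding ws_def cs_def by (simp add: zip_map1 zip_same_conv_map comp_def)
    have "b \<odot>\<^bsub>M\<^esub> z \<ominus>\<^bsub>M\<^esub> cf z \<odot>\<^bsub>M\<^esub> y \<in> combinations M (carrier R) ps" if z: "z \<in> set zs" for z
    proof -
      have zfM: "zf z \<in> carrier M" "y' \<in> carrier M" using cf[OF z] b combM by auto
      define q where "q = (b \<otimes> cf z) \<odot>\<^bsub>M\<^esub> p"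
      have qM: "q \<in> carrier M" unfolding q_def using b cf[OF z] p by auto
      have "b \<odot>\<^bsub>M\<^esub> z = q \<oplus>\<^bsub>M\<^esub> b \<odot>\<^bsub>M\<^esub> zf z"
        using cf[OF z] b p zfM unfolding q_def by (metis smult_assoc1 smult_closed smult_r_distr)
      moreover have "cf z \<odot>\<^bsub>M\<^esub> y = q \<oplus>\<^bsub>M\<^esub> cf z \<odot>\<^bsub>M\<^esub> y'"
        using cf[OF z] b p zfM unfolding q_def by (metis R.m_comm smult_assoc1 smult_closed smult_r_distr)
      ultimately have "b \<odot>\<^bsub>M\<^esub> z \<ominus>\<^bsub>M\<^esub> cf z \<odot>\<^bsub>M\<^esub> y =
          b \<odot>\<^bsub>M\<^esub> zf z \<oplus>\<^bsub>M\<^esub> \<ominus>\<^bsub>M\<^esub> (cf z \<odot>\<^bsub>M\<^esub> y') \<oplus>\<^bsub>M\<^esub> (q \<oplus>\<^bsub>M\<^esub> \<ominus>\<^bsub>M\<^esub> q)"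
        using cf[OF z] b p zfM qM by (simp add: M.minus_eq M.minus_add M.a_ac)
      then have "b \<odot>\<^bsub>M\<^esub> z \<ominus>\<^bsub>M\<^esub> cf z \<odot>\<^bsub>M\<^esub> y = b \<odot>\<^bsub>M\<^esub> zf z \<oplus>\<^bsub>M\<^esub> \<ominus>\<^bsub>M\<^esub> (cf z \<odot>\<^bsub>M\<^esub> y')"
        using cf[OF z] b zfM qM by (simp add: M.r_neg)
      then show ?thesis using sub(3-5) cf[OF z] b by auto
    qed
    then have "set ws \<subseteq> combinations M (carrier R) ps" unfolding ws_eq by auto
    moreover have "length ws = length zs" unfolding ws_eq by simp
    ultimately obtain ds where ds: "length ds = length zs" "set ds \<subseteq> carrier R" "\<not> set ds \<subseteq> {\<zero>}"
        "lincomb M ds ws = \<zero>\<^bsub>M\<^esub>"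
      using Cons.IH[OF ps, of ws] Cons.prems(3) unfolding ys zs_def by auto
    have "length cs = length zs" "set cs \<subseteq> carrier R" using cf unfolding cs_def by auto
    from lincomb_eliminate[OF b(1) yM ds(1) this(1) ds(2) this(2) zsM] ds(4)
    obtain e where e: "e \<in> carrier R"
        "lincomb M (map ((\<otimes>) b) ds) zs \<oplus>\<^bsub>M\<^esub> e \<odot>\<^bsub>M\<^esub> y = \<zero>\<^bsub>M\<^esub>"
      unfolding ws_def[symmetric] by auto
    define fs where "fs = map ((\<otimes>) b) ds"
    define f1 f2 where "f1 = take (length us) fs" and "f2 = drop (length us) fs"
    have f12: "fs = f1 @ f2" "length f1 = length us" "length f2 = length vs"
      unfolding f1_def f2_def using ds(1) unfolding fs_def zs_def by auto
    have fsR: "set fs \<subseteq> carrier R" unfolding fs_def using ds(2) b(1) by auto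
    obtain d where "d \<in> set ds" "d \<noteq> \<zero>" using ds(3) by auto
    then have "b \<otimes> d \<in> set fs" "b \<otimes> d \<noteq> \<zero>"
      using \<open>b \<noteq> \<zero>\<close> b(1) ds(2) D.integral unfolding fs_def by auto
    then have nz: "\<not> set fs \<subseteq> {\<zero>}" by auto
    have M: "set us \<subseteq> carrier M" "set vs \<subseteq> carrier M" and R: "set f1 \<subseteq> carrier R" "set f2 \<subseteq> carrier R"
      using zsM zs_def fsR f12 by auto
    have "lincomb M (f1 @ e # f2) ys = lincomb M f1 us \<oplus>\<^bsub>M\<^esub> (e \<odot>\<^bsub>M\<^esub> y \<oplus>\<^bsub>M\<^esub> lincomb M f2 vs)"
      unfolding ys using lincomb_append[of f1 us "e # f2" "y # vs"] f12 R M e yM by auto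
    also have "\<dots> = lincomb M fs zs \<oplus>\<^bsub>M\<^esub> e \<odot>\<^bsub>M\<^esub> y"
      unfolding f12(1) zs_def using lincomb_append[of f1 us f2 vs] f12 R M e(1) yM
      by (simp add: M.a_ac)
    also have "\<dots> = \<zero>\<^bsub>M\<^esub>" using e(2) unfolding fs_def .
    finally show ?thesis
      using f12 nz fsR e(1) by (intro exI[of _ "f1 @ e # f2"]) (auto simp: ys)
  qed
qed


section \<open>Domains with an element divisible by all others up to powers\<close>

text \<open>For a subring \<open>A\<close> of a domain this says that the localisation \<open>A[1/s]\<close> is a field.\<close>

definition (in ring) inverts_all :: "'a set \<Rightarrow> 'a \<Rightarrow> bool" where
  "inverts_all A s \<longleftrightarrow> s \<in> A \<and> s \<noteq> \<zero> \<and> (\<forall>a\<in>A - {\<zero>}. \<exists>(n::nat). \<exists>q\<in>A. s [^] n = a \<otimes> q)"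

lemma (in ring) inverts_allE:
  assumes "inverts_all A s" "a \<in> A" "a \<noteq> \<zero>"
  obtains n q where "q \<in> A" "s [^] (n::nat) = a \<otimes> q"
  using assms unfolding inverts_all_def by blast

text \<open>If \<open>x\<close> is transcendental and \<open>s = p(x)\<close>, then \<open>1 + xs\<close> divides a power of \<open>s\<close>, to which it
  is coprime. So \<open>1 + X p\<close> is a unit in the polynomial ring, although its degree is positive.\<close>

lemma (in domain) inverts_all_imp_algebraic:
  assumes A: "subring A R" and x: "x \<in> carrier R" and s: "inverts_all (simple_extension A x) s"
  shows "(algebraic over A) x"
proof (rule ccontr)
  assume "\<not> (algebraic over A) x"
  then have tr: "(transcendental over A) x" unfolding over_def by simp
  interpret UP: domain "A[X]" by (rule univ_poly_is_domain[OF A])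
  interpret ev: ring_hom_ring "A[X]" R "\<lambda>p. eval p x" by (rule eval_ring_hom[OF A x])
  have B: "simple_extension A x = (\<lambda>p. eval p x) ` carrier (A[X])"
    by (rule simple_extension_as_eval_img[OF subringE(1)[OF A] x])
  have inj: "inj_on (\<lambda>p. eval p x) (carrier (A[X]))"
    using tr unfolding over_def transcendental_def .
  obtain p where p: "p \<in> carrier (A[X])" "s = eval p x"
    using s B unfolding inverts_all_def by auto
  have pnz: "p \<noteq> []" using s p unfolding inverts_all_def by auto
  have Xc: "X \<in> carrier (A[X])" by (rule var_closed(1)[OF A])
  define z where "z = X \<otimes>\<^bsub>A[X]\<^esub> p"
  define f where "f = \<one>\<^bsub>A[X]\<^esub> \<oplus>\<^bsub>A[X]\<^esub> z"
  have zc: "z \<in> carrier (A[X])" and fc: "f \<in> carrier (A[X])"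
    unfolding z_def f_def using Xc p by auto
  have degz: "degree z = Suc (degree p)"
    using poly_mult_degree_eq[OF A, of X p] Xc p pnz
    unfolding z_def univ_poly_mult univ_poly_carrier[symmetric] by (auto simp: var_def)
  have "degree f = Suc (degree p)"
    using poly_add_degree_eq[OF A, of "\<one>\<^bsub>A[X]\<^esub>" z] degz zc UP.one_closed
    unfolding f_def univ_poly_add univ_poly_carrier[symmetric] by (simp add: univ_poly_one)
  then have degf: "degree f > 0" by simp
  then have fnz: "f \<noteq> []" by auto
  then have "eval f x \<noteq> \<zero>" using eval_transcendental[OF tr fc] by auto
  moreover have "eval f x \<in> simple_extension A x" using B fc by auto
  ultimately obtain n b where b: "b \<in> simple_extension A x" "s [^] (n::nat) = eval f x \<otimes> b"
    using inverts_allE[OF s] by blast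
  then obtain q where q: "q \<in> carrier (A[X])" "b = eval q x" using B by auto
  have "eval (p [^]\<^bsub>A[X]\<^esub> n) x = eval (f \<otimes>\<^bsub>A[X]\<^esub> q) x"
    using b(2) p q fc by (simp add: ev.hom_nat_pow)
  then have pn: "p [^]\<^bsub>A[X]\<^esub> n = f \<otimes>\<^bsub>A[X]\<^esub> q"
    using inj p q fc unfolding inj_on_def by auto
  have "\<exists>c\<in>carrier (A[X]). \<exists>e\<in>Units (A[X]). z [^]\<^bsub>A[X]\<^esub> m = f \<otimes>\<^bsub>A[X]\<^esub> c \<oplus>\<^bsub>A[X]\<^esub> e" for m :: nat
  proof (induction m)
    case 0
    then show ?case using fc by (intro bexI[of _ "\<zero>\<^bsub>A[X]\<^esub>"] bexI[of _ "\<one>\<^bsub>A[X]\<^esub>"]) auto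
  next
    case (Suc m)
    then obtain c e where ce: "c \<in> carrier (A[X])" "e \<in> Units (A[X])"
        "z [^]\<^bsub>A[X]\<^esub> m = f \<otimes>\<^bsub>A[X]\<^esub> c \<oplus>\<^bsub>A[X]\<^esub> e" by auto
    have ec: "e \<in> carrier (A[X])" using ce by auto
    have "z = f \<ominus>\<^bsub>A[X]\<^esub> \<one>\<^bsub>A[X]\<^esub>" unfolding f_def using zc UP.one_closed by algebra
    then have "z [^]\<^bsub>A[X]\<^esub> (Suc m) = (f \<otimes>\<^bsub>A[X]\<^esub> c \<oplus>\<^bsub>A[X]\<^esub> e) \<otimes>\<^bsub>A[X]\<^esub> (f \<ominus>\<^bsub>A[X]\<^esub> \<one>\<^bsub>A[X]\<^esub>)"
      using ce zc by simp
    also have "\<dots> = f \<otimes>\<^bsub>A[X]\<^esub> (f \<otimes>\<^bsub>A[X]\<^esub> c \<oplus>\<^bsub>A[X]\<^esub> e \<ominus>\<^bsub>A[X]\<^esub> c) \<oplus>\<^bsub>A[X]\<^esub> (\<ominus>\<^bsub>A[X]\<^esub> e)"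
      using fc ce(1) ec UP.one_closed by algebra
    finally have eq: "z [^]\<^bsub>A[X]\<^esub> (Suc m) =
        f \<otimes>\<^bsub>A[X]\<^esub> (f \<otimes>\<^bsub>A[X]\<^esub> c \<oplus>\<^bsub>A[X]\<^esub> e \<ominus>\<^bsub>A[X]\<^esub> c) \<oplus>\<^bsub>A[X]\<^esub> (\<ominus>\<^bsub>A[X]\<^esub> e)" .
    have "(\<ominus>\<^bsub>A[X]\<^esub> \<one>\<^bsub>A[X]\<^esub>) \<otimes>\<^bsub>A[X]\<^esub> e \<in> Units (A[X])"
      using UP.Units_m_closed[OF UP.Units_minus_one_closed ce(2)] .
    then have "\<ominus>\<^bsub>A[X]\<^esub> e \<in> Units (A[X])" using ec by (simp add: UP.l_minus)
    with eq show ?case using fc ce(1) ec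
      by (intro bexI[of _ "f \<otimes>\<^bsub>A[X]\<^esub> c \<oplus>\<^bsub>A[X]\<^esub> e \<ominus>\<^bsub>A[X]\<^esub> c"] bexI[of _ "\<ominus>\<^bsub>A[X]\<^esub> e"])
         auto
  qed
  then obtain c e where ce: "c \<in> carrier (A[X])" "e \<in> Units (A[X])"
      "z [^]\<^bsub>A[X]\<^esub> n = f \<otimes>\<^bsub>A[X]\<^esub> c \<oplus>\<^bsub>A[X]\<^esub> e" by blast
  have ec: "e \<in> carrier (A[X])" using ce by auto
  define w where "w = X [^]\<^bsub>A[X]\<^esub> n"
  have wc: "w \<in> carrier (A[X])" unfolding w_def using Xc by auto
  have "z [^]\<^bsub>A[X]\<^esub> n = w \<otimes>\<^bsub>A[X]\<^esub> (f \<otimes>\<^bsub>A[X]\<^esub> q)"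
    unfolding z_def w_def pn[symmetric] using Xc p by (simp add: UP.nat_pow_distrib)
  then have "w \<otimes>\<^bsub>A[X]\<^esub> (f \<otimes>\<^bsub>A[X]\<^esub> q) = f \<otimes>\<^bsub>A[X]\<^esub> c \<oplus>\<^bsub>A[X]\<^esub> e" using ce by simp
  then have "e = w \<otimes>\<^bsub>A[X]\<^esub> (f \<otimes>\<^bsub>A[X]\<^esub> q) \<ominus>\<^bsub>A[X]\<^esub> f \<otimes>\<^bsub>A[X]\<^esub> c"
    using wc fc q ce ec by (simp add: UP.minus_eq UP.a_ac UP.r_neg)
  also have "\<dots> = f \<otimes>\<^bsub>A[X]\<^esub> (w \<otimes>\<^bsub>A[X]\<^esub> q \<ominus>\<^bsub>A[X]\<^esub> c)" using wc fc q(1) ce(1) by algebra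
  finally have "f \<in> Units (A[X])"
    using UP.prod_unit_l ce(2) fc q ce(1) wc UP.unit_factor by (metis UP.m_closed UP.minus_closed)
  then obtain k where "f = [k]" using univ_poly_units_incl[OF A] by auto
  with degf show False by simp
qed

text \<open>The ring \<open>R\<close> as a module over itself. Over the ring record of \<open>R\<close> with its carrier replaced by a subring
  \<open>A\<close>, it is also \<open>R\<close> as an \<open>A\<close>-module.\<close>

definition self_module :: "('a, 'r) ring_scheme \<Rightarrow> ('a, 'a) module" where
  "self_module R = \<lparr>carrier = carrier R, monoid.mult = monoid.mult R, one = one R, zero = zero R,
     add = add R, smult = monoid.mult R\<rparr>"

lemma self_module_simps [simp]:
  "carrier (self_module R) = carrier R" "zero (self_module R) = zero R"
  "add (self_module R) = add R" "smult (self_module R) = monoid.mult R"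
  by (simp_all add: self_module_def)

lemma self_module_a_inv [simp]: "a_inv (self_module R) = a_inv R"
  by (rule ext) (simp add: a_inv_def m_inv_def self_module_def)

lemma (in cring) self_module_is_module:
  assumes "subring A R"
  shows "module (R\<lparr>carrier := A\<rparr>) (self_module R)"
proof -
  have "abelian_group (self_module R)"
    by (rule abelian_groupI) (auto simp: a_ac intro!: bexI[of _ "\<ominus> x" for x] l_neg)
  moreover have "cring (R\<lparr>carrier := A\<rparr>)"
    using subcring_iff[OF subringE(1)[OF assms]] subcringI'[OF assms] by simp
  ultimately show ?thesis
    using subringE(1)[OF assms] by (intro moduleI) (auto simp: l_distr r_distr m_assoc subset_iff)
qed

text \<open>The order is descending because polynomials are lists of coefficients with the leading one first.\<close>

primrec (in ring) powers :: "'a \<Rightarrow> nat \<Rightarrow> 'a list" where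
  "powers x 0 = []"
| "powers x (Suc d) = x [^] d # powers x d"

lemma (in ring) length_powers [simp]: "length (powers x d) = d"
  by (induction d) auto

lemma (in ring) set_powers: "set (powers x d) = (\<lambda>i. x [^] i) ` {..<d}"
  by (induction d) (auto simp: lessThan_Suc)

lemma (in ring) lincomb_powers:
  "length cs = d \<Longrightarrow> lincomb (self_module R) cs (powers x d) = eval cs x"
proof (induction cs arbitrary: d)
  case (Cons c cs)
  then show ?case by (cases d) auto
qed auto

lemma (in ring) eval_in_subring:
  assumes "subring B R" "set cs \<subseteq> B" "x \<in> B"
  shows "eval cs x \<in> B"
  using ring.eval_in_carrier[OF subring_is_ring[OF assms(1)], of cs x] assms
  by (simp add: eval_consistent)

lemma (in module) lincomb_map_smult:
  "a \<in> carrier R \<Longrightarrow> set cs \<subseteq> carrier R \<Longrightarrow> set ps \<subseteq> carrier M \<Longrightarrow>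
    lincomb M cs (map ((\<odot>\<^bsub>M\<^esub>) a) ps) = a \<odot>\<^bsub>M\<^esub> lincomb M cs ps"
  by (induction cs ps rule: list_induct2')
     (auto simp: smult_r_distr smult_assoc1[symmetric] R.m_comm)

text \<open>An equation \<open>a x\<^sup>d + \<dots> = 0\<close> makes the extension finite after inverting the leading
  coefficient \<open>a\<close>. The condition \<open>d > 0\<close> puts \<open>\<one>\<close> among the powers.\<close>

lemma (in domain) algebraic_extension_bounded:
  assumes A: "subring A R" and x: "x \<in> carrier R" and alg: "(algebraic over A) x"
  obtains a d where "a \<in> A" "a \<noteq> \<zero>" "d > 0"
    "\<And>y. y \<in> simple_extension A x \<Longrightarrow>
      \<exists>k::nat. a [^] k \<otimes> y \<in> combinations (self_module R) A (powers x d)"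
proof -
  let ?A = "R\<lparr>carrier := A\<rparr>" and ?D = "self_module R"
  interpret D: module ?A ?D by (rule self_module_is_module[OF A])
  note Ac = subringE[OF A]
  obtain p where p: "p \<in> carrier (A[X])" "p \<noteq> []" "eval p x = \<zero>"
    using algebraicE[OF A x alg] .
  then obtain a ps where p_eq: "p = a # ps" by (cases p) auto
  have a: "a \<in> A" "a \<noteq> \<zero>" "set ps \<subseteq> A"
    using p(1) unfolding p_eq univ_poly_carrier[symmetric] polynomial_def by auto
  then have aR: "a \<in> carrier R" "set ps \<subseteq> carrier R" using Ac(1) by auto
  define d where "d = length ps"
  have eq: "a \<otimes> x [^] d \<oplus> eval ps x = \<zero>" using p(3) unfolding p_eq d_def by simp
  have "d > 0" using eq a(2) aR x unfolding d_def by (cases ps) auto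
  define P where "P = combinations ?D A (powers x d)"
  have pow: "set (powers x d) \<subseteq> carrier R" using x by (auto simp: set_powers)
  have Psub: "submodule P ?A ?D"
    unfolding P_def using D.combinations_submodule[OF D.R.oneideal, of "powers x d"] pow by simp
  note Pc = D.submoduleE[OF Psub, simplified]
  have Pz: "\<zero> \<in> P" using subgroup.one_closed[OF submodule.axioms(1)[OF Psub]] by simp
  have Pneg: "\<ominus> y \<in> P" if "y \<in> P" for y
    using D.submoduleE(3)[OF Psub that] by simp
  have gen: "x [^] i \<in> P" if "i < d" for i
    using D.generators_in_combinations[of "powers x d"] pow that unfolding P_def set_powers by auto
  have evP: "eval ps x \<in> P"
    unfolding P_def combinations_def using lincomb_powers[of ps d x] a(3) d_def by force
  have top: "a \<otimes> x [^] d \<in> P"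
  proof -
    have "a \<otimes> x [^] d = \<ominus> eval ps x"
      using eq aR x eval_in_carrier[OF aR(2) x] by (metis m_closed minus_equality nat_pow_closed)
    then show ?thesis using Pneg[OF evP] by simp
  qed
  define Q where "Q = {y \<in> carrier R. a \<otimes> (y \<otimes> x) \<in> P}"
  have "submodule Q ?A ?D"
  proof (rule D.submoduleI)
    show "\<ominus>\<^bsub>?D\<^esub> y \<in> Q" if "y \<in> Q" for y
      using that Pneg[of "a \<otimes> (y \<otimes> x)"] aR x unfolding Q_def by (auto simp: l_minus r_minus)
    show "b \<odot>\<^bsub>?D\<^esub> y \<in> Q" if "b \<in> carrier ?A" "y \<in> Q" for b y
    proof -
      have "b \<in> carrier R" using that Ac(1) by auto
      then have "a \<otimes> (b \<otimes> y \<otimes> x) = b \<otimes> (a \<otimes> (y \<otimes> x))"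
        using that aR x unfolding Q_def by (auto simp: m_ac)
      then show ?thesis using that Pc(4) \<open>b \<in> carrier R\<close> unfolding Q_def by auto
    qed
  qed (use aR x Pz Pc(5) in \<open>auto simp: Q_def l_distr r_distr\<close>)
  moreover have "set (powers x d) \<subseteq> Q"
  proof -
    have "a \<otimes> (x [^] i \<otimes> x) \<in> P" if "i < d" for i
    proof (cases "Suc i = d")
      case True
      then show ?thesis using top by auto
    next
      case False
      then show ?thesis using gen[of "Suc i"] that Pc(4)[OF a(1)] by auto
    qed
    then show ?thesis unfolding set_powers Q_def using x by auto
  qed
  ultimately have PQ: "P \<subseteq> Q"
    using D.submodule_lincomb[of Q] unfolding P_def combinations_def by auto
  have "\<exists>k::nat. a [^] k \<otimes> y \<in> P" if "y \<in> simple_extension A x" for y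
    using that
  proof (induction rule: simple_extension.induct)
    case zero
    show ?case using Pz aR by (intro exI[of _ 0]) auto
  next
    case (lin y b)
    then obtain k :: nat where k: "a [^] k \<otimes> y \<in> P" by auto
    have yR: "y \<in> carrier R" "b \<in> carrier R"
      using lin simple_extension_in_carrier[OF Ac(1) x] Ac(1) by auto
    have "b \<in> P" using gen[OF \<open>d > 0\<close>] Pc(4)[OF lin(2), of \<one>] yR by simp
    moreover have "a [^] n \<in> A" for n :: nat
      using a(1) Ac(3,6) by (induction n) auto
    ultimately have "a [^] Suc k \<otimes> b \<in> P" using Pc(4) by blast
    moreover have "a [^] Suc k \<otimes> (y \<otimes> x) \<in> P"
    proof -
      have "a [^] Suc k \<otimes> (y \<otimes> x) = a \<otimes> ((a [^] k \<otimes> y) \<otimes> x)" using aR yR x by (simp add: m_ac)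
      then show ?thesis using k PQ unfolding Q_def by auto
    qed
    ultimately have "a [^] Suc k \<otimes> (y \<otimes> x) \<oplus> a [^] Suc k \<otimes> b \<in> P" by (rule Pc(5)[rotated])
    then show ?case using aR yR x by (intro exI[of _ "Suc k"]) (simp add: r_distr)
  qed
  with a \<open>d > 0\<close> that show thesis unfolding P_def by blast
qed

text \<open>Vanishing trailing coefficients are dropped, which divides the equation by a power of \<open>s\<close>. Then
  the constant coefficient is a multiple of \<open>s\<close>.\<close>

lemma (in domain) root_divides_constant:
  assumes "subring B R" "A \<subseteq> B" "s \<in> B" "s \<noteq> \<zero>"
  shows "set cs \<subseteq> A \<Longrightarrow> \<not> set cs \<subseteq> {\<zero>} \<Longrightarrow> eval cs s = \<zero> \<Longrightarrow> \<exists>c\<in>A - {\<zero>}. \<exists>z\<in>B. s \<otimes> z = c"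
proof (induction cs rule: rev_induct)
  case (snoc c cs)
  note Bc = subringE[OF assms(1)]
  have csB: "eval cs s \<in> B" using eval_in_subring[OF assms(1) _ assms(3), of cs] snoc assms(2) by auto
  have R: "s \<in> carrier R" "c \<in> carrier R" "eval cs s \<in> carrier R" "set cs \<subseteq> carrier R"
    using csB Bc(1) assms snoc by auto
  have eq: "eval cs s \<otimes> s \<oplus> c = \<zero>" using eval_append_aux[OF R(4,2,1)] snoc.prems(3) by simp
  show ?case
  proof (cases "c = \<zero>")
    case True
    then have "eval cs s = \<zero>" using eq R integral[of "eval cs s" s] assms(4) by auto
    then show ?thesis using snoc True by auto
  next
    case False
    have "s \<otimes> (\<ominus> eval cs s) = c" using eq R by (metis m_comm m_closed minus_equality minus_minus r_minus a_comm)
    then show ?thesis using Bc(5)[OF csB] snoc.prems(1) False by auto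
  qed
qed auto

lemma common_exponent:
  assumes "finite Y" "\<And>y. y \<in> Y \<Longrightarrow> \<exists>k::nat. Q k y" "\<And>y k. y \<in> Y \<Longrightarrow> Q k y \<Longrightarrow> Q (Suc k) y"
  shows "\<exists>k. \<forall>y\<in>Y. Q k y"
proof -
  from assms(2) obtain f where f: "\<And>y. y \<in> Y \<Longrightarrow> Q (f y) y" by metis
  have step: "Q (k + n) y" if "y \<in> Y" "Q k y" for k n y
    using that assms(3) by (induction n) auto
  have "Q (Max (f ` Y)) y" if "y \<in> Y" for y
    using step[OF that f[OF that], of "Max (f ` Y) - f y"] Max_ge[of "f ` Y" "f y"] assms(1) that by simp
  then show ?thesis by blast
qed

text \<open>A nonzero \<open>s\<close> in an algebraic extension divides a nonzero constant: too many powers of \<open>s\<close>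
  lie in a module with a bounded number of generators, so \<open>s\<close> is a root of a polynomial over \<open>A\<close>.\<close>

lemma (in domain) algebraic_divides_constant:
  assumes A: "subring A R" and x: "x \<in> carrier R" and alg: "(algebraic over A) x"
    and s: "s \<in> simple_extension A x" "s \<noteq> \<zero>"
  shows "\<exists>c\<in>A - {\<zero>}. \<exists>z\<in>simple_extension A x. s \<otimes> z = c"
proof -
  let ?A = "R\<lparr>carrier := A\<rparr>" and ?D = "self_module R"
  interpret D: module ?A ?D by (rule self_module_is_module[OF A])
  note Ac = subringE[OF A]
  have B: "subring (simple_extension A x) R" by (rule simple_extension_is_subring[OF A x])
  note Bc = subringE[OF B]
  obtain a d where a: "a \<in> A" "a \<noteq> \<zero>" "d > 0"
    "\<And>y. y \<in> simple_extension A x \<Longrightarrow> \<exists>k::nat. a [^] k \<otimes> y \<in> combinations ?D A (powers x d)"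
    using algebraic_extension_bounded[OF A x alg] by blast
  define P where "P = combinations ?D A (powers x d)"
  have pow: "set (powers x d) \<subseteq> carrier R" using x by (auto simp: set_powers)
  have Psub: "submodule P ?A ?D"
    unfolding P_def using D.combinations_submodule[OF D.R.oneideal, of "powers x d"] pow by simp
  note Pc = D.submoduleE[OF Psub, simplified]
  have aR: "a \<in> carrier R" and sR: "s \<in> carrier R" using a Ac(1) s Bc(1) by auto
  have sn: "s [^] n \<in> simple_extension A x" for n :: nat
    using s Bc(3,6) by (induction n) auto
  have "\<exists>k. \<forall>y\<in>set (powers s (Suc d)). a [^] (k::nat) \<otimes> y \<in> P"
  proof (rule common_exponent)
    show "\<exists>k::nat. a [^] k \<otimes> y \<in> P" if "y \<in> set (powers s (Suc d))" for y
      using that a(4) sn unfolding P_def set_powers by blast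
    show "a [^] Suc k \<otimes> y \<in> P" if "y \<in> set (powers s (Suc d))" "a [^] k \<otimes> y \<in> P" for y and k :: nat
    proof -
      have "y \<in> carrier R" using that sR by (auto simp: set_powers)
      then have "a [^] Suc k \<otimes> y = a \<otimes> (a [^] k \<otimes> y)" using aR by (simp add: m_ac)
      then show ?thesis using Pc(4)[OF a(1) that(2)] by simp
    qed
  qed auto
  then obtain k :: nat where k: "\<forall>y\<in>set (powers s (Suc d)). a [^] k \<otimes> y \<in> P" by blast
  have akA: "a [^] k \<in> A" using a(1) Ac(3,6) by (induction k) auto
  define ys where "ys = map ((\<odot>\<^bsub>?D\<^esub>) (a [^] k)) (powers s (Suc d))"
  have ys: "set ys \<subseteq> combinations ?D A (powers x d)" "length (powers x d) < length ys"
    using k unfolding ys_def P_def by auto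
  have "domain ?A" by (rule subring_is_domain[OF A])
  from D.linearly_dependent[OF this, of "powers x d" ys] pow ys
  obtain cs where cs: "length cs = length ys" "set cs \<subseteq> A" "\<not> set cs \<subseteq> {\<zero>}" "lincomb ?D cs ys = \<zero>"
    by auto
  have "lincomb ?D cs ys = a [^] k \<odot>\<^bsub>?D\<^esub> lincomb ?D cs (powers s (Suc d))"
    unfolding ys_def by (rule D.lincomb_map_smult) (use akA cs sR in \<open>auto simp: set_powers simp del: powers.simps\<close>)
  also have "lincomb ?D cs (powers s (Suc d)) = eval cs s"
    by (rule lincomb_powers) (use cs(1) in \<open>simp add: ys_def\<close>)
  finally have "a [^] k \<otimes> eval cs s = \<zero>" using cs(4) by simp
  moreover have "a [^] k \<noteq> \<zero>"
    using a(2) aR by (induction k) (auto simp: integral_iff)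
  moreover have "eval cs s \<in> carrier R" using eval_in_carrier[of cs s] cs(2) Ac(1) sR by auto
  ultimately have "eval cs s = \<zero>" using aR integral by blast
  then show ?thesis
    using root_divides_constant[OF B simple_extension_incl[OF Ac(1) x] s cs(2,3)] by blast
qed

lemma (in ring) uminus_zero_minus: "x \<in> carrier R \<Longrightarrow> \<ominus> (\<zero> \<ominus> x) = x"
  by (simp add: minus_eq)

text \<open>If \<open>a q = s\<^sup>n\<close> in the extension and \<open>s z = c\<close>, then \<open>c\<^sup>n\<close> maps the extension into its
  multiples by \<open>a\<close>. Nakayama's lemma moves this divisibility into the base ring.\<close>

lemma (in domain) inverts_all_descends:
  assumes A: "subring A R" and x: "x \<in> carrier R" and alg: "(algebraic over A) x"
    and s: "inverts_all (simple_extension A x) s"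
  shows "\<exists>s'. inverts_all A s'"
proof -
  let ?A = "R\<lparr>carrier := A\<rparr>" and ?D = "self_module R" and ?B = "simple_extension A x"
  interpret D: module ?A ?D by (rule self_module_is_module[OF A])
  note Ac = subringE[OF A]
  have B: "subring ?B R" by (rule simple_extension_is_subring[OF A x])
  note Bc = subringE[OF B]
  obtain a0 d where a0: "a0 \<in> A" "a0 \<noteq> \<zero>" "d > 0"
    "\<And>y. y \<in> ?B \<Longrightarrow> \<exists>k::nat. a0 [^] k \<otimes> y \<in> combinations ?D A (powers x d)"
    using algebraic_extension_bounded[OF A x alg] by blast
  define P where "P = combinations ?D A (powers x d)"
  have pow: "set (powers x d) \<subseteq> carrier R" using x by (auto simp: set_powers)
  have Psub: "submodule P ?A ?D"
    unfolding P_def using D.combinations_submodule[OF D.R.oneideal, of "powers x d"] pow by simp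
  note Pc = D.submoduleE[OF Psub, simplified]
  have sB: "s \<in> ?B" "s \<noteq> \<zero>" using s unfolding inverts_all_def by auto
  obtain c z where c: "c \<in> A" "c \<noteq> \<zero>" "z \<in> ?B" "s \<otimes> z = c"
    using algebraic_divides_constant[OF A x alg sB] by blast
  have carr: "a0 \<in> carrier R" "c \<in> carrier R" "s \<in> carrier R" "z \<in> carrier R"
    using a0 c Ac(1) Bc(1) sB by auto
  have powA: "b [^] n \<in> A" if "b \<in> A" for b and n :: nat
    using that Ac(3,6) by (induction n) auto
  have powB: "b [^] n \<in> ?B" if "b \<in> ?B" for b and n :: nat
    using that Bc(3,6) by (induction n) auto
  have "\<exists>(n::nat). \<exists>q\<in>A. (c \<otimes> a0) [^] n = a \<otimes> q" if a: "a \<in> A - {\<zero>}" for a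
  proof -
    have aR: "a \<in> carrier R" using a Ac(1) by auto
    have "a \<in> ?B" using a simple_extension_incl[OF Ac(1) x] by auto
    then obtain n q where q: "q \<in> ?B" "s [^] (n::nat) = a \<otimes> q" using inverts_allE[OF s] a by blast
    have qR: "q \<in> carrier R" using q Bc(1) by auto
    define q' where "q' = q \<otimes> z [^] n"
    have q': "q' \<in> ?B" unfolding q'_def using q powB[OF c(3)] Bc(6) by auto
    have q'R: "q' \<in> carrier R" using q' Bc(1) by auto
    have cn: "c [^] n = a \<otimes> q'"
      unfolding c(4)[symmetric] q'_def using carr qR aR q(2) by (simp add: nat_pow_distrib m_assoc)
    have "\<exists>k. \<forall>y\<in>set (powers x d). a0 [^] (k::nat) \<otimes> (q' \<otimes> y) \<in> P"
    proof (rule common_exponent)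
      show "\<exists>k::nat. a0 [^] k \<otimes> (q' \<otimes> y) \<in> P" if "y \<in> set (powers x d)" for y
      proof -
        have "y \<in> ?B" using that powB[OF simple_extension_mem[OF A x]] unfolding set_powers by auto
        then show ?thesis using a0(4) Bc(6)[OF q'] unfolding P_def by blast
      qed
      show "a0 [^] Suc k \<otimes> (q' \<otimes> y) \<in> P"
        if "y \<in> set (powers x d)" "a0 [^] k \<otimes> (q' \<otimes> y) \<in> P" for y and k :: nat
      proof -
        have "y \<in> carrier R" using that pow by auto
        then have "a0 [^] Suc k \<otimes> (q' \<otimes> y) = a0 \<otimes> (a0 [^] k \<otimes> (q' \<otimes> y))"
          using carr q'R by (simp add: m_ac)
        then show ?thesis using Pc(4)[OF a0(1) that(2)] by simp
      qed
    qed auto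
    then obtain k :: nat where k: "\<forall>y\<in>set (powers x d). a0 [^] k \<otimes> (q' \<otimes> y) \<in> P" by blast
    define e where "e = c [^] n \<otimes> a0 [^] k"
    have eA: "e \<in> A" unfolding e_def using powA a0(1) c(1) Ac(6) by auto
    have eR: "e \<in> carrier R" using eA Ac(1) by auto
    define J where "J = PIdl\<^bsub>?A\<^esub> a"
    have J: "ideal J ?A" unfolding J_def using D.R.cgenideal_ideal[of a] a by simp
    have aJ: "a \<in> J" unfolding J_def using D.R.cgenideal_self[of a] a by simp
    have zero: "submodule {\<zero>} ?A ?D"
      by (rule D.submoduleI) (use Ac(1) in auto)
    have "\<exists>h\<in>{\<zero>}. \<exists>y\<in>combinations ?D J (powers x d). e \<odot>\<^bsub>?D\<^esub> p = h \<oplus>\<^bsub>?D\<^esub> y"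
      if p: "p \<in> set (powers x d)" for p
    proof -
      have pR: "p \<in> carrier R" using p pow by auto
      have "a \<odot>\<^bsub>?D\<^esub> (a0 [^] k \<otimes> (q' \<otimes> p)) \<in> combinations ?D J (powers x d)"
        by (rule D.smult_in_combinations[OF J aJ]) (use p k P_def pow in auto)
      moreover have "e \<otimes> p = a \<otimes> (a0 [^] k \<otimes> (q' \<otimes> p))"
        unfolding e_def cn using carr q'R pR aR by (simp add: m_ac)
      ultimately have "e \<otimes> p \<in> combinations ?D J (powers x d)" by simp
      moreover have "e \<odot>\<^bsub>?D\<^esub> p = \<zero> \<oplus>\<^bsub>?D\<^esub> (e \<otimes> p)" using eR pR by simp
      ultimately show ?thesis by blast
    qed
    then obtain v m where v: "v \<in> A" "v \<ominus>\<^bsub>?A\<^esub> e [^]\<^bsub>?A\<^esub> (m::nat) \<in> J"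
        "\<And>y. y \<in> set (powers x d) \<Longrightarrow> v \<otimes> y \<in> {\<zero>}"
      using D.nakayama[OF J zero _ order_refl, of "powers x d" e] pow eA by auto
    \<comment> \<open>As \<open>v\<close> kills the power \<open>\<one>\<close> of \<open>x\<close>, it vanishes, and its congruence says that \<open>a\<close> divides a power of \<open>e\<close>.\<close>
    have "\<one> \<in> set (powers x d)" unfolding set_powers using a0(3) by (auto intro!: image_eqI[of _ _ 0])
    then have "v = \<zero>" using v(3) v(1) Ac(1) by fastforce
    moreover have em: "e [^]\<^bsub>?A\<^esub> m = e [^] m" using nat_pow_consistent by metis
    moreover have emA: "e [^] m \<in> A" using powA[OF eA] .
    ultimately have "\<zero>\<^bsub>?A\<^esub> \<ominus>\<^bsub>?A\<^esub> e [^] m \<in> J" using v(2) by simp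
    then have "\<ominus>\<^bsub>?A\<^esub> (\<zero>\<^bsub>?A\<^esub> \<ominus>\<^bsub>?A\<^esub> e [^] m) \<in> J"
      using additive_subgroup.a_inv_closed[OF ideal.axioms(1)[OF J]] by blast
    then have "e [^] m \<in> J" using D.R.uminus_zero_minus[of "e [^] m"] emA by simp
    then obtain r where r: "r \<in> A" "e [^] m = r \<otimes> a" unfolding J_def cgenideal_def by auto
    have "(c \<otimes> a0) [^] ((n + k) * m) = (c [^] k \<otimes> a0 [^] n) [^] m \<otimes> e [^] m"
    proof -
      have "(c \<otimes> a0) [^] (n + k) = (c [^] k \<otimes> a0 [^] n) \<otimes> e"
        unfolding e_def using carr by (simp add: nat_pow_distrib nat_pow_mult[symmetric] m_ac)
      then show ?thesis using carr eR by (simp add: nat_pow_pow[symmetric] nat_pow_distrib)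
    qed
    also have "\<dots> = a \<otimes> ((c [^] k \<otimes> a0 [^] n) [^] m \<otimes> r)"
      using r carr aR Ac(1) by (simp add: subset_iff m_ac)
    finally show ?thesis using r powA a0(1) c(1) Ac(6) by blast
  qed
  moreover have "c \<otimes> a0 \<in> A" using a0(1) c(1) Ac(6) by auto
  moreover have "c \<otimes> a0 \<noteq> \<zero>" using a0(2) c(2) carr(1,2) by (simp add: integral_iff)
  ultimately show ?thesis unfolding inverts_all_def by blast
qed

lemma (in ring) int_multiples_subring: "subring (range (\<lambda>n::int. [n] \<cdot> \<one>)) R"
proof (rule subringI)
  show "\<one> \<in> range (\<lambda>n::int. [n] \<cdot> \<one>)" by (rule image_eqI[of _ _ 1]) auto
  show "\<ominus> h \<in> range (\<lambda>n::int. [n] \<cdot> \<one>)" if "h \<in> range (\<lambda>n::int. [n] \<cdot> \<one>)" for h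
    using that by (auto simp: add.int_pow_neg[symmetric] a_inv_def[symmetric])
  show "h1 \<otimes> h2 \<in> range (\<lambda>n::int. [n] \<cdot> \<one>)"
    if "h1 \<in> range (\<lambda>n::int. [n] \<cdot> \<one>)" "h2 \<in> range (\<lambda>n::int. [n] \<cdot> \<one>)" for h1 h2
    using that by (auto simp: add_pow_ldistr_int add.int_pow_pow)
  show "h1 \<oplus> h2 \<in> range (\<lambda>n::int. [n] \<cdot> \<one>)"
    if "h1 \<in> range (\<lambda>n::int. [n] \<cdot> \<one>)" "h2 \<in> range (\<lambda>n::int. [n] \<cdot> \<one>)" for h1 h2
    using that by (auto simp: add.int_pow_mult[symmetric])
qed auto

text \<open>In characteristic zero some \<open>m \<noteq> 0\<close> would have a power divisible by the coprime integer \<open>\<bar>m\<bar> + 1\<close>.\<close>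

lemma (in domain) inverts_all_int_multiples_finite:
  assumes s: "inverts_all A s" and A: "A = range (\<lambda>n::int. [n] \<cdot> \<one>)"
  shows "finite A"
proof -
  define i where "i = (\<lambda>n::int. [n] \<cdot> \<one>)"
  have i_add: "i (m + n) = i m \<oplus> i n" for m n
    unfolding i_def by (simp add: add.int_pow_mult)
  have i_mult: "i (m * n) = i m \<otimes> i n" for m n
    unfolding i_def by (simp add: add_pow_ldistr_int add.int_pow_pow mult.commute)
  have i_closed: "i n \<in> carrier R" for n unfolding i_def by simp
  have i_pow: "i m [^] n = i (m ^ n)" for m and n :: nat
    by (induction n) (simp add: i_def, simp add: i_mult power_Suc2 del: power_Suc)
  have "\<exists>k. k \<noteq> 0 \<and> i k = \<zero>"
  proof (rule ccontr)
    assume nz: "\<not> (\<exists>k. k \<noteq> 0 \<and> i k = \<zero>)"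
    obtain m where m: "s = i m" "s \<noteq> \<zero>" using s A unfolding inverts_all_def i_def by auto
    have "i 0 = \<zero>" unfolding i_def by (simp add: add_pow_int_ge)
    then have "m \<noteq> 0" using m by auto
    define a where "a = \<bar>m\<bar> + 1"
    have "a \<noteq> 0" unfolding a_def by simp
    then have "i a \<noteq> \<zero>" using nz by blast
    moreover have "i a \<in> A" using A unfolding i_def by auto
    ultimately obtain n q where "q \<in> A" "s [^] (n::nat) = i a \<otimes> q" using inverts_allE[OF s] by blast
    then obtain z where "i (m ^ n) = i (a * z)" using A m i_pow i_mult unfolding i_def by auto
    then have "i (m ^ n - a * z) = \<zero>"
      using i_add[of "m ^ n - a * z" "a * z"] add.r_cancel_one'[OF i_closed i_closed] by simp
    then have "m ^ n = a * z" using nz by (metis eq_iff_diff_eq_0)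
    moreover have "coprime a (m ^ n)"
    proof -
      have "coprime a \<bar>m\<bar>" unfolding a_def by (simp add: coprime_iff_gcd_eq_1 gcd.commute)
      then show ?thesis by simp
    qed
    ultimately have "a dvd 1" by (metis coprime_common_divisor dvd_refl dvd_triv_left)
    then show False using \<open>m \<noteq> 0\<close> unfolding a_def by (auto simp: zdvd1_eq)
  qed
  then obtain k where k: "k \<noteq> 0" "i k = \<zero>" by blast
  have "i n \<in> i ` {-\<bar>k\<bar>..\<bar>k\<bar>}" for n
  proof -
    have "i n = i (k * (n div k)) \<oplus> i (n mod k)" by (simp add: i_add[symmetric])
    also have "\<dots> = i (n mod k)" using k i_closed by (simp add: i_mult)
    finally have "i n = i (n mod k)" .
    moreover have "n mod k \<in> {-\<bar>k\<bar>..\<bar>k\<bar>}"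
      using abs_mod_less[OF k(1), of n] by (simp add: abs_if split: if_splits)
    ultimately show ?thesis by blast
  qed
  then have "A \<subseteq> i ` {-\<bar>k\<bar>..\<bar>k\<bar>}" unfolding A i_def by auto
  then show ?thesis using finite_subset by blast
qed

lemma (in domain) finite_subring_inverse:
  assumes "subring A R" "finite A" "a \<in> A" "a \<noteq> \<zero>"
  shows "\<exists>b\<in>A. b \<otimes> a = \<one>"
proof -
  note Ac = subringE[OF assms(1)]
  have "inj_on (\<lambda>b. b \<otimes> a) A"
    using assms(3,4) Ac(1) by (intro inj_onI) (simp add: m_rcancel subset_iff)
  moreover have "(\<lambda>b. b \<otimes> a) ` A \<subseteq> A" using Ac(6) assms(3) by auto
  ultimately have "(\<lambda>b. b \<otimes> a) ` A = A" using assms(2) by (simp add: endo_inj_surj)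
  then have "\<one> \<in> (\<lambda>b. b \<otimes> a) ` A" using Ac(3) by simp
  then show ?thesis by auto
qed

text \<open>The leading coefficient of an equation for \<open>x\<close> is a unit of the finite domain \<open>A\<close>, so finitely many
  powers of \<open>x\<close> span the extension.\<close>

lemma (in domain) algebraic_over_finite:
  assumes A: "subring A R" "finite A" and x: "x \<in> carrier R" "(algebraic over A) x"
  shows "finite (simple_extension A x)"
proof -
  obtain a d where a: "a \<in> A" "a \<noteq> \<zero>"
    "\<And>y. y \<in> simple_extension A x \<Longrightarrow> \<exists>k::nat. a [^] k \<otimes> y \<in> combinations (self_module R) A (powers x d)"
    using algebraic_extension_bounded[OF A(1) x] by metis
  obtain b where b: "b \<in> A" "b \<otimes> a = \<one>" using finite_subring_inverse[OF A a(1,2)] by blast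
  let ?A = "R\<lparr>carrier := A\<rparr>" and ?D = "self_module R"
  interpret D: module ?A ?D by (rule self_module_is_module[OF A(1)])
  note Ac = subringE[OF A(1)]
  define P where "P = combinations ?D A (powers x d)"
  have pow: "set (powers x d) \<subseteq> carrier R" using x by (auto simp: set_powers)
  have Psub: "submodule P ?A ?D"
    unfolding P_def using D.combinations_submodule[OF D.R.oneideal, of "powers x d"] pow by simp
  note Pc = D.submoduleE[OF Psub, simplified]
  have R: "a \<in> carrier R" "b \<in> carrier R" using a b Ac(1) by auto
  have "y \<in> P" if y: "y \<in> simple_extension A x" for y
  proof -
    have yR: "y \<in> carrier R" using y simple_extension_in_carrier[OF Ac(1) x(1)] by auto
    obtain k :: nat where k: "a [^] k \<otimes> y \<in> P" using a(3)[OF y] unfolding P_def by blast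
    have "b [^] k \<in> A" using b(1) Ac(3,6) by (induction k) auto
    then have "b [^] k \<otimes> (a [^] k \<otimes> y) \<in> P" using Pc(4)[OF _ k] by blast
    moreover have "b [^] k \<otimes> (a [^] k \<otimes> y) = (b \<otimes> a) [^] k \<otimes> y"
      using R yR by (simp add: nat_pow_distrib m_assoc)
    ultimately show ?thesis using b(2) yR by simp
  qed
  moreover have "finite P"
  proof -
    have "P = (\<lambda>cs. lincomb ?D cs (powers x d)) ` {cs. set cs \<subseteq> A \<and> length cs = d}"
      unfolding P_def combinations_def by auto
    then show ?thesis using finite_lists_length_eq[OF A(2)] by simp
  qed
  ultimately show ?thesis by (meson finite_subset subsetI)
qed

lemma (in domain) generate_ring_insert:
  assumes "S \<subseteq> carrier R" "x \<in> carrier R"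
  shows "generate_ring R (insert x S) = simple_extension (generate_ring R S) x"
proof
  have A: "subring (generate_ring R S) R" by (rule generate_ring_is_subring[OF assms(1)])
  have "S \<subseteq> simple_extension (generate_ring R S) x"
    using generate_ring.incl[of _ S R] simple_extension_incl[OF subringE(1)[OF A] assms(2)] by blast
  then show "generate_ring R (insert x S) \<subseteq> simple_extension (generate_ring R S) x"
    using simple_extension_is_subring[OF A assms(2)] simple_extension_mem[OF A assms(2)] assms
    by (intro generate_ring_min_subring1) auto
  show "simple_extension (generate_ring R S) x \<subseteq> generate_ring R (insert x S)"
    using generate_ring_is_subring[of "insert x S"] assms mono_generate_ring[of S "insert x S"]
      generate_ring.incl[of x "insert x S" R]
    by (intro simple_extension_subring_incl) auto
qed

text \<open>Zariski's lemma in arithmetic form: finitely generated rings that become a field after inverting one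
  element are finite. The last generator is algebraic over the ring generated by the others, to which
  the hypothesis descends.\<close>

theorem (in domain) inverts_all_imp_finite:
  assumes "finite S" "S \<subseteq> carrier R" "inverts_all (generate_ring R S) s"
  shows "finite (generate_ring R S)"
  using assms
proof (induction S arbitrary: s rule: finite_induct)
  case empty
  have "generate_ring R {} = range (\<lambda>n::int. [n] \<cdot> \<one>)"
  proof
    show "generate_ring R {} \<subseteq> range (\<lambda>n::int. [n] \<cdot> \<one>)"
      by (rule generate_ring_min_subring1) (auto simp: int_multiples_subring)
    have A: "subring (generate_ring R {}) R" by (rule generate_ring_is_subring) simp
    have nat: "[n] \<cdot> \<one> \<in> generate_ring R {}" for n :: nat
      by (induction n) (use subringE[OF A] in \<open>auto simp: add.nat_pow_Suc\<close>)
    have "[n] \<cdot> \<one> \<in> generate_ring R {}" for n :: int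
    proof (cases "n \<ge> 0")
      case True
      then show ?thesis using nat[of "nat n"] by (simp add: add_pow_int_ge)
    next
      case False
      then show ?thesis using nat[of "nat (- n)"] subringE(5)[OF A]
        by (simp add: add_pow_int_lt)
    qed
    then show "range (\<lambda>n::int. [n] \<cdot> \<one>) \<subseteq> generate_ring R {}" by auto
  qed
  then show ?case using inverts_all_int_multiples_finite empty by blast
next
  case (insert x S)
  define A where "A = generate_ring R S"
  have A: "subring A R" unfolding A_def using insert by (intro generate_ring_is_subring) auto
  have x: "x \<in> carrier R" using insert by auto
  have B: "generate_ring R (insert x S) = simple_extension A x"
    unfolding A_def using generate_ring_insert insert by auto
  have s: "inverts_all (simple_extension A x) s" using insert.prems B by simp
  have alg: "(algebraic over A) x" by (rule inverts_all_imp_algebraic[OF A x s])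
  obtain s' where "inverts_all A s'" using inverts_all_descends[OF A x alg s] by blast
  then have "finite A" using insert unfolding A_def by auto
  then show ?case unfolding B using algebraic_over_finite[OF A _ x alg] by simp
qed


section \<open>Maximal ideals of finitely generated rings\<close>

lemma (in cring) add_principal_ideal:
  assumes J: "ideal J R" and a: "a \<in> carrier R"
  defines "K \<equiv> {j \<oplus> b \<otimes> a | j b. j \<in> J \<and> b \<in> carrier R}"
  shows "ideal K R" "J \<subseteq> K" "a \<in> K"
proof -
  interpret J: ideal J R by fact
  have "K = J <+> PIdl a" unfolding K_def set_add_def' cgenideal_def by auto
  then show "ideal K R" using add_ideals[OF J cgenideal_ideal[OF a]] by simp
  show "J \<subseteq> K"
  proof
    fix j assume j: "j \<in> J"
    then have "j = j \<oplus> \<zero> \<otimes> a" using a J.a_subset by auto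
    then show "j \<in> K" unfolding K_def using j by blast
  qed
  have "a = \<zero> \<oplus> \<one> \<otimes> a" using a by simp
  then show "a \<in> K" unfolding K_def using J.zero_closed by blast
qed

lemma (in noetherian_ring) ideal_maximal_element:
  assumes "\<J> \<noteq> {}" "\<And>J. J \<in> \<J> \<Longrightarrow> ideal J R"
  obtains J where "J \<in> \<J>" "\<And>K. K \<in> \<J> \<Longrightarrow> J \<subseteq> K \<Longrightarrow> K = J"
proof -
  have "\<exists>J\<in>\<J>. \<forall>K\<in>\<J>. J \<subseteq> K \<longrightarrow> K = J"
  proof (rule subset_Zorn_nonempty[OF assms(1)])
    fix \<C> assume C: "\<C> \<noteq> {}" "subset.chain \<J> \<C>"
    then have "subset.chain {I. ideal I R} \<C>" using assms(2) unfolding pred_on.chain_def by auto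
    then have "\<Union>\<C> \<in> \<C>" by (rule ideal_chain_is_trivial[OF C(1)])
    then show "\<Union>\<C> \<in> \<J>" using C(2) unfolding pred_on.chain_def by auto
  qed
  with that show thesis by blast
qed

text \<open>If \<open>a\<close> and \<open>b\<close> lie outside \<open>J\<close>, then \<open>J + a R\<close> and \<open>J + b R\<close> contain powers of \<open>r\<close>, whose product lies in
  \<open>J + a b R\<close>.\<close>

lemma (in cring) prime_of_avoiding_powers:
  assumes J: "ideal J R" and r: "r \<in> carrier R" "\<And>n::nat. r [^] n \<notin> J"
    and above: "\<And>K. ideal K R \<Longrightarrow> J \<subseteq> K \<Longrightarrow> K \<noteq> J \<Longrightarrow> \<exists>n::nat. r [^] n \<in> K"
  shows "primeideal J R"
proof (rule primeidealI[OF J is_cring])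
  interpret J: ideal J R by fact
  show "carrier R \<noteq> J" using r(2)[of 0] by auto
  fix a b assume ab: "a \<in> carrier R" "b \<in> carrier R" "a \<otimes> b \<in> J"
  have key: "\<exists>(n::nat) j c. j \<in> J \<and> c \<in> carrier R \<and> r [^] n = j \<oplus> c \<otimes> x"
    if "x \<in> carrier R" "x \<notin> J" for x
    using above[OF add_principal_ideal(1,2)[OF J that(1)]] add_principal_ideal(3)[OF J that(1)] that(2)
    by blast
  show "a \<in> J \<or> b \<in> J"
  proof (rule ccontr)
    assume "\<not> (a \<in> J \<or> b \<in> J)"
    then obtain n m :: nat and j c j' c' where *: "j \<in> J" "c \<in> carrier R" "r [^] n = j \<oplus> c \<otimes> a"
        "j' \<in> J" "c' \<in> carrier R" "r [^] m = j' \<oplus> c' \<otimes> b"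
      using key[OF ab(1)] key[OF ab(2)] by blast
    have R: "j \<in> carrier R" "j' \<in> carrier R" using * J.a_subset by auto
    have "r [^] (n + m) = (j \<oplus> c \<otimes> a) \<otimes> (j' \<oplus> c' \<otimes> b)"
      using * r(1) by (simp add: nat_pow_mult[symmetric])
    also have "\<dots> = (j' \<oplus> c' \<otimes> b) \<otimes> j \<oplus> ((c \<otimes> a) \<otimes> j' \<oplus> (c \<otimes> c') \<otimes> (a \<otimes> b))"
      using R * ab by algebra
    also have "\<dots> \<in> J"
      using * ab R by (intro J.a_closed J.I_l_closed[OF *(1)] J.I_l_closed[OF *(4)] J.I_l_closed[OF ab(3)]) auto
    finally show False using r(2) by blast
  qed
qed

text \<open>In the domain \<open>R / J\<close> every nonzero element divides a power of the image of \<open>r\<close>. So \<open>R / J\<close> is finite,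
  and a finite domain is a field.\<close>

lemma (in cring) finite_index_of_avoiding_powers:
  assumes fg: "finitely_generated_ring R"
    and J: "ideal J R" and r: "r \<in> carrier R" "\<And>n::nat. r [^] n \<notin> J"
    and above: "\<And>K. ideal K R \<Longrightarrow> J \<subseteq> K \<Longrightarrow> K \<noteq> J \<Longrightarrow> \<exists>n::nat. r [^] n \<in> K"
  shows "maximalideal J R \<and> finite_index R J"
proof -
  interpret primeideal J R by (rule prime_of_avoiding_powers[OF J r above])
  let ?D = "R Quot J" and ?p = "\<lambda>a. J +> a"
  have zero: "\<zero>\<^bsub>?D\<^esub> = J" by (simp add: FactRing_def)
  have car0: "carrier ?D = a_rcosets J" by (simp add: FactRing_def)
  then have car: "carrier ?D = ?p ` carrier R" unfolding A_RCOSETS_def' by (simp add: UNION_singleton_eq_range)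
  interpret D: domain ?D by (rule quotient_is_domain)
  interpret p: ring_hom_ring R ?D ?p by (rule rcos_ring_hom_ring)
  have sub: "subgroup J (add_monoid R)" by (rule a_subgroup)
  have pz: "?p a = \<zero>\<^bsub>?D\<^esub> \<longleftrightarrow> a \<in> J" if "a \<in> carrier R" for a
  proof
    assume "?p a = \<zero>\<^bsub>?D\<^esub>"
    then show "a \<in> J" using a_rcos_self[OF that] zero by (simp only:)
  next
    assume "a \<in> J"
    then show "?p a = \<zero>\<^bsub>?D\<^esub>" using a_rcos_const[of a] zero by (simp only:)
  qed
  obtain S where S: "finite S" "S \<subseteq> carrier R" "generate_ring R S = carrier R"
    using fg unfolding finitely_generated_ring_def by blast
  have gen: "generate_ring ?D (?p ` S) = carrier ?D"
  proof
    have pS: "?p ` S \<subseteq> carrier ?D" using S(2) p.hom_closed by auto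
    show "generate_ring ?D (?p ` S) \<subseteq> carrier ?D" by (rule D.generate_ring_incl[OF pS])
    have "?p a \<in> generate_ring ?D (?p ` S)" if "a \<in> generate_ring R S" for a
      using that
    proof (induction rule: generate_ring.induct)
      case one
      then show ?case using generate_ring.one[of ?D] p.hom_one by metis
    next
      case (incl h)
      then show ?case by (auto intro: generate_ring.incl)
    next
      case (a_inv h)
      then show ?case using generate_ring.a_inv[of "?p h" ?D] S(3) by simp
    next
      case (eng_add h1 h2)
      then show ?case using generate_ring.eng_add[of "?p h1" ?D _ "?p h2"] S(3) p.hom_add by metis
    next
      case (eng_mult h1 h2)
      then show ?case using generate_ring.eng_mult[of "?p h1" ?D _ "?p h2"] S(3) p.hom_mult by metis
    qed
    then show "carrier ?D \<subseteq> generate_ring ?D (?p ` S)" using S(3) car by auto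
  qed
  have "D.inverts_all (carrier ?D) (?p r)"
    unfolding D.inverts_all_def
  proof (intro conjI ballI)
    show "?p r \<in> carrier ?D" using r(1) by simp
    show "?p r \<noteq> \<zero>\<^bsub>?D\<^esub>" using pz[OF r(1)] r(2)[of 1] r(1) by simp
    fix a assume a: "a \<in> carrier ?D - {\<zero>\<^bsub>?D\<^esub>}"
    then obtain b where b: "b \<in> carrier R" "a = ?p b" using car by blast
    then have bJ: "b \<notin> J" using a pz[OF b(1)] by blast
    define K where "K = {j \<oplus> c \<otimes> b | j c. j \<in> J \<and> c \<in> carrier R}"
    have "\<exists>n::nat. r [^] n \<in> K"
      using above add_principal_ideal[OF J b(1)] bJ unfolding K_def by blast
    then obtain n :: nat and j c where c: "j \<in> J" "c \<in> carrier R" "r [^] n = j \<oplus> c \<otimes> b"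
      unfolding K_def by blast
    have jR: "j \<in> carrier R" using c(1) a_subset by blast
    have "?p r [^]\<^bsub>?D\<^esub> n = ?p (r [^] n)" using p.hom_nat_pow[OF r(1)] by (simp only:)
    also have "\<dots> = ?p j \<oplus>\<^bsub>?D\<^esub> ?p c \<otimes>\<^bsub>?D\<^esub> ?p b"
      unfolding c(3) using p.hom_add[OF jR m_closed[OF c(2) b(1)]] p.hom_mult[OF c(2) b(1)]
      by (simp only:)
    also have "?p j = \<zero>\<^bsub>?D\<^esub>" using pz[OF jR] c(1) by (simp only:)
    also have "\<zero>\<^bsub>?D\<^esub> \<oplus>\<^bsub>?D\<^esub> ?p c \<otimes>\<^bsub>?D\<^esub> ?p b = ?p b \<otimes>\<^bsub>?D\<^esub> ?p c"
      using c(2) b(1) p.hom_closed by (simp only: D.l_zero D.m_closed D.m_comm)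
    finally have "?p r [^]\<^bsub>?D\<^esub> n = ?p b \<otimes>\<^bsub>?D\<^esub> ?p c" .
    then show "\<exists>n::nat. \<exists>q\<in>carrier ?D. ?p r [^]\<^bsub>?D\<^esub> n = a \<otimes>\<^bsub>?D\<^esub> q"
      unfolding b(2) by (intro exI bexI[OF _ p.hom_closed[OF c(2)]])
  qed
  moreover have "?p ` S \<subseteq> carrier ?D" using S(2) car by blast
  ultimately have "finite (generate_ring ?D (?p ` S))"
    using D.inverts_all_imp_finite[of "?p ` S" "?p r"] S(1) gen by (simp only: finite_imageI)
  then have fin: "finite (carrier ?D)" using gen by (simp only:)
  then have "finite (a_rcosets J)" using car0 by (simp only:)
  then have fi: "finite_index R J" using finite_index_iff[OF sub] by (simp only:)
  have "maximalideal J R"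
  proof (rule maximalidealI[OF J])
    show "carrier R \<noteq> J" by (rule I_notcarr)
    fix K assume K: "ideal K R" "J \<subseteq> K" "K \<subseteq> carrier R"
    show "K = J \<or> K = carrier R"
    proof (rule ccontr)
      assume neg: "\<not> (K = J \<or> K = carrier R)"
      then obtain b where b: "b \<in> K" "b \<notin> J" using K by auto
      then have bR: "b \<in> carrier R" using K by auto
      have "?p b \<noteq> \<zero>\<^bsub>?D\<^esub>" using pz[OF bR] b(2) by (simp only: simp_thms)
      then obtain c where c: "c \<in> carrier ?D" "c \<otimes>\<^bsub>?D\<^esub> ?p b = \<one>\<^bsub>?D\<^esub>"
        using D.finite_subring_inverse[OF D.carrier_is_subring fin p.hom_closed[OF bR]] by blast
      obtain a where a: "a \<in> carrier R" "c = ?p a" using c(1) car by blast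
      have "?p (a \<otimes> b) = ?p \<one>"
        using c(2) p.hom_mult[OF a(1) bR] p.hom_one unfolding a(2) by (simp only:)
      then have "a \<otimes> b \<ominus> \<one> \<in> K" using coset_eq_iff[OF sub m_closed[OF a(1) bR] one_closed] K(2) by blast
      moreover have "a \<otimes> b \<in> K" using ideal.I_l_closed[OF K(1) b(1) a(1)] .
      ultimately have "a \<otimes> b \<oplus> \<ominus> (a \<otimes> b \<ominus> \<one>) \<in> K"
        using additive_subgroup.a_closed additive_subgroup.a_inv_closed ideal.axioms(1)[OF K(1)] by metis
      moreover have "a \<otimes> b \<oplus> \<ominus> (a \<otimes> b \<ominus> \<one>) = \<one>" using a(1) bR by algebra
      ultimately show False using ideal.one_imp_carrier[OF K(1)] neg by simp
    qed
  qed
  with fi show ?thesis by simp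
qed

text \<open>A maximal ideal is maximal among the ideals that contain no power of \<open>\<one>\<close>.\<close>

lemma (in cring) maximal_ideal_finite_index:
  assumes "finitely_generated_ring R" and I: "maximalideal I R"
  shows "finite_index R I"
proof -
  interpret I: maximalideal I R by fact
  have "\<one> \<notin> I" using I.one_imp_carrier I.I_notcarr by auto
  moreover have "\<exists>n::nat. \<one> [^] n \<in> K" if "ideal K R" "I \<subseteq> K" "K \<noteq> I" for K
    using I.I_maximal[OF that(1,2)] that ideal.axioms(1)[OF that(1)]
    by (auto dest: additive_subgroup.a_subset)
  ultimately show ?thesis
    using finite_index_of_avoiding_powers[OF assms(1) I.is_ideal, of \<one>] by simp
qed

text \<open>The zero ideal contains no power of \<open>r\<close>, and the ideal sought is maximal with this property.\<close>

theorem (in noetherian_domain) exists_maximal_ideal_avoiding: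
  assumes "finitely_generated_ring R" and r: "r \<in> carrier R" "r \<noteq> \<zero>"
  obtains I where "maximalideal I R" "r \<notin> I"
proof -
  let ?J = "{J. ideal J R \<and> (\<forall>n::nat. r [^] n \<notin> J)}"
  have "r [^] n \<noteq> \<zero>" for n :: nat using r by (induction n) (auto simp: integral_iff)
  then have "{\<zero>} \<in> ?J" using zeroideal by auto
  then have "?J \<noteq> {}" by blast
  then obtain J where J: "J \<in> ?J" "\<And>K. K \<in> ?J \<Longrightarrow> J \<subseteq> K \<Longrightarrow> K = J"
    using ideal_maximal_element[of ?J] by blast
  then have "maximalideal J R"
    using finite_index_of_avoiding_powers[OF assms(1) _ r(1), of J] by blast
  moreover have "r \<notin> J" using J(1) r(1) by (metis (mono_tags, lifting) mem_Collect_eq nat_pow_eone)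
  ultimately show thesis by (rule that)
qed


section \<open>Residual finiteness\<close>

lemma (in module) submodule_finite_index_iff:
  "submodule H R M \<Longrightarrow> finite_index M H \<longleftrightarrow> finite (a_rcosets\<^bsub>M\<^esub> H)"
  by (rule M.finite_index_iff[OF submodule.axioms(1)])

text \<open>Noetherian induction: if \<open>r \<notin> J\<close> but \<open>r\<^sup>2 \<in> J\<close>, then \<open>R / J\<close> is an extension of \<open>R / (J + r R)\<close>
  by \<open>R / (J : r)\<close>.\<close>

lemma finite_index_radical:
  assumes "noetherian_ring R" "cring R" and I: "ideal I R" "finite_index R I"
    and J: "ideal J R" "\<And>r. r \<in> I \<Longrightarrow> \<exists>n::nat. r [^]\<^bsub>R\<^esub> n \<in> J"
  shows "finite_index R J"
proof (rule ccontr)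
  interpret noetherian_ring R by fact
  interpret cring R by fact
  assume "\<not> finite_index R J"
  let ?J = "{J. ideal J R \<and> (\<forall>r\<in>I. \<exists>n::nat. r [^]\<^bsub>R\<^esub> n \<in> J) \<and> \<not> finite_index R J}"
  have "J \<in> ?J" using J \<open>\<not> finite_index R J\<close> by auto
  then have "?J \<noteq> {}" by blast
  then obtain L where L: "L \<in> ?J" "\<And>K. K \<in> ?J \<Longrightarrow> L \<subseteq> K \<Longrightarrow> K = L"
    using ideal_maximal_element[of ?J] by blast
  have Lid: "ideal L R" and Lrad: "\<And>r. r \<in> I \<Longrightarrow> \<exists>n::nat. r [^]\<^bsub>R\<^esub> n \<in> L" and Lfin: "\<not> finite_index R L"
    using L by auto
  interpret L: ideal L R by fact
  interpret I: ideal I R by fact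
  have above: "finite_index R K" if "ideal K R" "L \<subseteq> K" "K \<noteq> L" for K
    using L(2)[of K] that Lrad by blast
  obtain r0 where r0: "r0 \<in> I" "r0 \<notin> L" using I(2) Lfin finite_index_mono by blast
  define n where "n = (LEAST n::nat. r0 [^]\<^bsub>R\<^esub> n \<in> L)"
  have n: "r0 [^]\<^bsub>R\<^esub> n \<in> L" unfolding n_def using Lrad[OF r0(1)] by (rule LeastI_ex)
  have below: "r0 [^]\<^bsub>R\<^esub> m \<notin> L" if "m < n" for m using not_less_Least that unfolding n_def by blast
  have r0R: "r0 \<in> carrier R" using r0 I.a_subset by auto
  have "n \<noteq> 0" using n L.one_imp_carrier r0 r0R by (metis nat_pow_0)
  moreover have "n \<noteq> 1" using n r0 r0R by auto
  ultimately have n2: "n \<ge> 2" by simp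
  define r where "r = r0 [^]\<^bsub>R\<^esub> (n - 1)"
  have rR: "r \<in> carrier R" and rL: "r \<notin> L" unfolding r_def using r0R below[of "n - 1"] n2 by auto
  have rr: "r \<otimes>\<^bsub>R\<^esub> r \<in> L"
  proof -
    have "r \<otimes>\<^bsub>R\<^esub> r = r0 [^]\<^bsub>R\<^esub> (n - 2) \<otimes>\<^bsub>R\<^esub> r0 [^]\<^bsub>R\<^esub> n"
      unfolding r_def using r0R n2 by (simp add: nat_pow_mult numeral_2_eq_2)
    then show ?thesis using L.I_l_closed[OF n] r0R by simp
  qed
  define K where "K = {j \<oplus>\<^bsub>R\<^esub> b \<otimes>\<^bsub>R\<^esub> r | j b. j \<in> L \<and> b \<in> carrier R}"
  define C where "C = {a \<in> carrier R. r \<otimes>\<^bsub>R\<^esub> a \<in> L}"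
  have "finite_index R K"
    using above[of K] add_principal_ideal[OF Lid rR] rL unfolding K_def by blast
  then obtain S where S: "finite S" "S \<subseteq> carrier R" "\<forall>x\<in>carrier R. \<exists>t\<in>S. x \<ominus>\<^bsub>R\<^esub> t \<in> K"
    by (rule finite_indexE)
  have "ideal C R" unfolding C_def by (rule L.helper_max_prime[OF is_cring rR])
  moreover have "L \<subseteq> C" unfolding C_def using L.I_l_closed[OF _ rR] L.a_subset by auto
  moreover have "C \<noteq> L" using rr rL rR unfolding C_def by auto
  ultimately have "finite_index R C" by (rule above)
  then obtain T where T: "finite T" "T \<subseteq> carrier R" "\<forall>x\<in>carrier R. \<exists>t\<in>T. x \<ominus>\<^bsub>R\<^esub> t \<in> C"
    by (rule finite_indexE)
  have "finite_index R L"
  proof (rule finite_indexI)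
    let ?U = "(\<lambda>(s, t). s \<oplus>\<^bsub>R\<^esub> t \<otimes>\<^bsub>R\<^esub> r) ` (S \<times> T)"
    show "finite ?U" using S T by simp
    show "?U \<subseteq> carrier R" using S(2) T(2) rR by auto
    fix x assume x: "x \<in> carrier R"
    obtain s where s: "s \<in> S" "x \<ominus>\<^bsub>R\<^esub> s \<in> K" using S(3) x by blast
    then obtain j b where jb: "j \<in> L" "b \<in> carrier R" "x \<ominus>\<^bsub>R\<^esub> s = j \<oplus>\<^bsub>R\<^esub> b \<otimes>\<^bsub>R\<^esub> r"
      unfolding K_def by blast
    obtain t where t: "t \<in> T" "b \<ominus>\<^bsub>R\<^esub> t \<in> C" using T(3) jb by blast
    have R: "s \<in> carrier R" "t \<in> carrier R" "j \<in> carrier R" using s t jb S(2) T(2) L.a_subset by auto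
    have "x \<ominus>\<^bsub>R\<^esub> (s \<oplus>\<^bsub>R\<^esub> t \<otimes>\<^bsub>R\<^esub> r) = (x \<ominus>\<^bsub>R\<^esub> s) \<ominus>\<^bsub>R\<^esub> t \<otimes>\<^bsub>R\<^esub> r" using R x rR by algebra
    also have "\<dots> = j \<oplus>\<^bsub>R\<^esub> r \<otimes>\<^bsub>R\<^esub> (b \<ominus>\<^bsub>R\<^esub> t)" unfolding jb(3) using R jb(2) rR by algebra
    also have "\<dots> \<in> L" using jb(1) t(2) unfolding C_def by auto
    finally show "\<exists>u\<in>?U. x \<ominus>\<^bsub>R\<^esub> u \<in> L" using s(1) t(1) by auto
  qed
  with Lfin show False by simp
qed

context module
begin

lemma submodule_add_cyclic:
  assumes H: "submodule H R M" and y: "y \<in> carrier M"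
  defines "K \<equiv> {h \<oplus>\<^bsub>M\<^esub> b \<odot>\<^bsub>M\<^esub> y | h b. h \<in> H \<and> b \<in> carrier R}"
  shows "submodule K R M" "H \<subseteq> K" "y \<in> K"
proof -
  note Hc = submoduleE[OF H]
  have z: "\<zero>\<^bsub>M\<^esub> \<in> H" using subgroup.one_closed[OF submodule.axioms(1)[OF H]] by simp
  show sub: "H \<subseteq> K"
  proof
    fix h assume h: "h \<in> H"
    then have "h = h \<oplus>\<^bsub>M\<^esub> \<zero> \<odot>\<^bsub>M\<^esub> y" using y Hc(1) by auto
    then show "h \<in> K" unfolding K_def using h by blast
  qed
  have "y = \<zero>\<^bsub>M\<^esub> \<oplus>\<^bsub>M\<^esub> \<one> \<odot>\<^bsub>M\<^esub> y" using y by simp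
  then show "y \<in> K" unfolding K_def using z by blast
  show "submodule K R M"
  proof (rule submoduleI)
    show "K \<subseteq> carrier M" unfolding K_def using Hc(1) y by auto
    show "\<zero>\<^bsub>M\<^esub> \<in> K" using z sub by auto
    show "\<ominus>\<^bsub>M\<^esub> a \<in> K" if aK: "a \<in> K" for a
    proof -
      obtain h b where hb: "h \<in> H" "b \<in> carrier R" "a = h \<oplus>\<^bsub>M\<^esub> b \<odot>\<^bsub>M\<^esub> y" using aK unfolding K_def by blast
      have "\<ominus>\<^bsub>M\<^esub> a = \<ominus>\<^bsub>M\<^esub> h \<oplus>\<^bsub>M\<^esub> (\<ominus> b) \<odot>\<^bsub>M\<^esub> y"
        using hb y Hc(1) by (auto simp: smult_l_minus M.minus_add)
      then show ?thesis unfolding K_def using hb Hc(3) by blast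
    qed
    show "a \<oplus>\<^bsub>M\<^esub> a' \<in> K" if aK: "a \<in> K" "a' \<in> K" for a a'
    proof -
      obtain h b where hb: "h \<in> H" "b \<in> carrier R" "a = h \<oplus>\<^bsub>M\<^esub> b \<odot>\<^bsub>M\<^esub> y" using aK unfolding K_def by blast
      obtain h' b' where hb': "h' \<in> H" "b' \<in> carrier R" "a' = h' \<oplus>\<^bsub>M\<^esub> b' \<odot>\<^bsub>M\<^esub> y" using aK unfolding K_def by blast
      have "h \<in> carrier M" "h' \<in> carrier M" using hb hb' Hc(1) by auto
      then have "a \<oplus>\<^bsub>M\<^esub> a' = (h \<oplus>\<^bsub>M\<^esub> h') \<oplus>\<^bsub>M\<^esub> (b \<oplus> b') \<odot>\<^bsub>M\<^esub> y"
        using hb hb' y by (simp add: smult_l_distr M.a_ac)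
      then show ?thesis unfolding K_def using hb hb' Hc(5) by blast
    qed
    show "c \<odot>\<^bsub>M\<^esub> a \<in> K" if cR: "c \<in> carrier R" and aK: "a \<in> K" for c a
    proof -
      obtain h b where hb: "h \<in> H" "b \<in> carrier R" "a = h \<oplus>\<^bsub>M\<^esub> b \<odot>\<^bsub>M\<^esub> y" using aK unfolding K_def by blast
      have "h \<in> carrier M" using hb Hc(1) by auto
      then have "c \<odot>\<^bsub>M\<^esub> a = c \<odot>\<^bsub>M\<^esub> h \<oplus>\<^bsub>M\<^esub> (c \<otimes> b) \<odot>\<^bsub>M\<^esub> y"
        using hb cR y by (simp add: smult_r_distr smult_assoc1)
      then show ?thesis unfolding K_def using hb cR Hc(4) by blast
    qed
  qed
qed

text \<open>Let \<open>H\<close> be maximal among the submodules that do not contain \<open>x\<close>, so that every larger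
  submodule contains \<open>x\<close>. Then \<open>I = (H : x)\<close> is a maximal ideal, and for each \<open>y\<close> every \<open>r \<in> I\<close> has a
  power in \<open>(H : y)\<close>: otherwise \<open>x\<close> would be a combination of elements \<open>r\<^sup>n y\<close> for arbitrarily large \<open>n\<close>,
  and the chain of ideals \<open>(H : r\<^sup>n y)\<close> would not become stationary.\<close>

theorem residually_finite:
  assumes R: "noetherian_ring R" "finitely_generated_ring R" and fg: "finitely_generated_module R M"
    and x: "x \<in> carrier M" "x \<noteq> \<zero>\<^bsub>M\<^esub>"
  obtains H where "submodule H R M" "finite_index M H" "x \<notin> H"
proof -
  interpret noetherian_ring R by fact
  obtain ps where ps: "set ps \<subseteq> carrier M" "carrier M = combinations M (carrier R) ps"
    using fg finitely_generated_iff by blast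
  let ?F = "{H. submodule H R M \<and> x \<notin> H}"
  have "\<exists>H\<in>?F. \<forall>K\<in>?F. H \<subseteq> K \<longrightarrow> K = H"
  proof (rule subset_Zorn_nonempty)
    have "submodule {\<zero>\<^bsub>M\<^esub>} R M" by (rule submoduleI) auto
    then show "?F \<noteq> {}" using x by blast
    fix \<C> assume C: "\<C> \<noteq> {}" "subset.chain ?F \<C>"
    have Csub: "submodule H R M" if "H \<in> \<C>" for H using C(2) that unfolding pred_on.chain_def by auto
    note Cc = submoduleE[OF Csub]
    have two: "\<exists>H\<in>\<C>. a \<in> H \<and> b \<in> H" if ab: "a \<in> \<Union>\<C>" "b \<in> \<Union>\<C>" for a b
    proof -
      obtain H K where HK: "H \<in> \<C>" "a \<in> H" "K \<in> \<C>" "b \<in> K" using ab by blast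
      then have "H \<subseteq> K \<or> K \<subseteq> H" using C(2) unfolding pred_on.chain_def by auto
      then show ?thesis using HK by blast
    qed
    have "submodule (\<Union>\<C>) R M"
    proof (rule submoduleI)
      show "\<Union>\<C> \<subseteq> carrier M" using Cc(1) by blast
      obtain H where "H \<in> \<C>" using C(1) by blast
      then show "\<zero>\<^bsub>M\<^esub> \<in> \<Union>\<C>" using subgroup.one_closed[OF submodule.axioms(1)[OF Csub]] by auto
      show "a \<oplus>\<^bsub>M\<^esub> b \<in> \<Union>\<C>" if "a \<in> \<Union>\<C>" "b \<in> \<Union>\<C>" for a b
        using two[OF that] Cc(5) by blast
    qed (use Cc(3,4) in blast)+
    then show "\<Union>\<C> \<in> ?F" using C(2) unfolding pred_on.chain_def by auto
  qed
  then obtain H where H: "submodule H R M" "x \<notin> H"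
    and max: "\<And>K. submodule K R M \<Longrightarrow> H \<subseteq> K \<Longrightarrow> K \<noteq> H \<Longrightarrow> x \<in> K" by blast
  note Hc = submoduleE[OF H(1)]
  have z: "\<zero>\<^bsub>M\<^esub> \<in> H" using subgroup.one_closed[OF submodule.axioms(1)[OF H(1)]] by simp
  have reach: "\<exists>h\<in>H. \<exists>b\<in>carrier R. x = h \<oplus>\<^bsub>M\<^esub> b \<odot>\<^bsub>M\<^esub> y" if "y \<in> carrier M" "y \<notin> H" for y
    using max[OF submodule_add_cyclic(1,2)[OF H(1) that(1)]] submodule_add_cyclic(3)[OF H(1) that(1)] that(2)
    by blast
  define I where "I = {a \<in> carrier R. a \<odot>\<^bsub>M\<^esub> x \<in> H}"
  have Iid: "ideal I R" unfolding I_def by (rule colon_ideal[OF H(1) x(1)])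
  have "maximalideal I R"
  proof (rule maximalidealI[OF Iid])
    have "\<one> \<notin> I" using H(2) x(1) unfolding I_def by simp
    then show "carrier R \<noteq> I" by auto
    fix K assume K: "ideal K R" "I \<subseteq> K" "K \<subseteq> carrier R"
    show "K = I \<or> K = carrier R"
    proof (rule ccontr)
      assume neg: "\<not> (K = I \<or> K = carrier R)"
      then obtain a where a: "a \<in> K" "a \<notin> I" using K by auto
      then have aR: "a \<in> carrier R" using K by auto
      then have "a \<odot>\<^bsub>M\<^esub> x \<notin> H" using a unfolding I_def by auto
      then obtain h b where hb: "h \<in> H" "b \<in> carrier R" "x = h \<oplus>\<^bsub>M\<^esub> b \<odot>\<^bsub>M\<^esub> (a \<odot>\<^bsub>M\<^esub> x)"
        using reach aR x(1) by blast
      have hM: "h \<in> carrier M" using hb Hc(1) by auto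
      define w where "w = b \<odot>\<^bsub>M\<^esub> (a \<odot>\<^bsub>M\<^esub> x)"
      have wM: "w \<in> carrier M" unfolding w_def using hb aR x by auto
      have "(\<one> \<ominus> b \<otimes> a) \<odot>\<^bsub>M\<^esub> x = x \<ominus>\<^bsub>M\<^esub> w"
        unfolding w_def using hb(2) aR x(1)
        by (simp add: R.minus_eq M.minus_eq smult_l_distr smult_l_minus smult_assoc1)
      also have "\<dots> = h" using hb(3) hM wM unfolding w_def[symmetric]
        by (metis M.add.inv_solve_right M.minus_eq x(1))
      finally have "\<one> \<ominus> b \<otimes> a \<in> K" using hb(1,2) aR K(2) unfolding I_def by auto
      moreover have "b \<otimes> a \<in> K" using ideal.I_l_closed[OF K(1) a(1) hb(2)] .
      ultimately have "(\<one> \<ominus> b \<otimes> a) \<oplus> b \<otimes> a \<in> K"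
        using additive_subgroup.a_closed ideal.axioms(1)[OF K(1)] by metis
      moreover have "(\<one> \<ominus> b \<otimes> a) \<oplus> b \<otimes> a = \<one>" using hb(2) aR by algebra
      ultimately show False using ideal.one_imp_carrier[OF K(1)] neg by simp
    qed
  qed
  then have Ifin: "finite_index R I" by (rule R.maximal_ideal_finite_index[OF assms(2)])
  have pow: "\<exists>n::nat. r [^] n \<in> {a \<in> carrier R. a \<odot>\<^bsub>M\<^esub> y \<in> H}" if r: "r \<in> I" and y: "y \<in> carrier M" for r y
  proof -
    have rR: "r \<in> carrier R" using r unfolding I_def by simp
    define L where "L = (\<lambda>n::nat. {a \<in> carrier R. a \<odot>\<^bsub>M\<^esub> (r [^] n \<odot>\<^bsub>M\<^esub> y) \<in> H})"
    have Lid: "ideal (L n) R" for n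
      unfolding L_def by (rule colon_ideal[OF H(1)]) (use rR y in auto)
    have step: "L n \<subseteq> L (Suc n)" for n
    proof
      fix a assume a: "a \<in> L n"
      then have aR: "a \<in> carrier R" unfolding L_def by simp
      have "a \<odot>\<^bsub>M\<^esub> (r [^] Suc n \<odot>\<^bsub>M\<^esub> y) = r \<odot>\<^bsub>M\<^esub> (a \<odot>\<^bsub>M\<^esub> (r [^] n \<odot>\<^bsub>M\<^esub> y))"
        using aR rR y by (simp add: smult_assoc1[symmetric] R.m_ac)
      then show "a \<in> L (Suc n)" using a Hc(4)[OF rR] unfolding L_def by auto
    qed
    have "range L \<noteq> {}" by simp
    moreover have "subset.chain {I. ideal I R} (range L)"
      unfolding pred_on.chain_def using Lid lift_Suc_mono_le[of L, OF step] nat_le_linear by blast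
    ultimately have "\<Union>(range L) \<in> range L" by (rule ideal_chain_is_trivial)
    then obtain n where n: "\<Union>(range L) = L n" by auto
    have "r [^] n \<odot>\<^bsub>M\<^esub> y \<in> H"
    proof (rule ccontr)
      define y' where "y' = r [^] n \<odot>\<^bsub>M\<^esub> y"
      have y': "y' \<in> carrier M" unfolding y'_def using rR y by auto
      assume "r [^] n \<odot>\<^bsub>M\<^esub> y \<notin> H"
      then obtain h b where hb: "h \<in> H" "b \<in> carrier R" "x = h \<oplus>\<^bsub>M\<^esub> b \<odot>\<^bsub>M\<^esub> y'"
        using reach[OF y'] unfolding y'_def by blast
      have hM: "h \<in> carrier M" using hb Hc(1) by auto
      have "r \<odot>\<^bsub>M\<^esub> x = r \<odot>\<^bsub>M\<^esub> h \<oplus>\<^bsub>M\<^esub> r \<odot>\<^bsub>M\<^esub> (b \<odot>\<^bsub>M\<^esub> y')"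
        unfolding hb(3) using rR hM hb(2) y' by (simp add: smult_r_distr)
      then have "r \<odot>\<^bsub>M\<^esub> (b \<odot>\<^bsub>M\<^esub> y') = \<ominus>\<^bsub>M\<^esub> (r \<odot>\<^bsub>M\<^esub> h) \<oplus>\<^bsub>M\<^esub> r \<odot>\<^bsub>M\<^esub> x"
        using rR hM hb(2) y' x(1) by (simp add: M.r_neg1)
      also have "\<dots> \<in> H" using Hc(3,4,5) r rR hb(1) unfolding I_def by auto
      also have "r \<odot>\<^bsub>M\<^esub> (b \<odot>\<^bsub>M\<^esub> y') = b \<odot>\<^bsub>M\<^esub> (r [^] Suc n \<odot>\<^bsub>M\<^esub> y)"
        unfolding y'_def using rR hb(2) y by (simp add: smult_assoc1[symmetric] R.m_ac)
      finally have "b \<in> L (Suc n)" unfolding L_def using hb(2) by simp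
      then have "b \<in> L n" using n by auto
      then have "b \<odot>\<^bsub>M\<^esub> y' \<in> H" unfolding L_def y'_def by simp
      then have "x \<in> H" unfolding hb(3) using Hc(5)[OF hb(1)] by simp
      with H(2) show False by simp
    qed
    then show ?thesis using rR by auto
  qed
  have "finite_index M H"
    using finite_index_radical[OF R(1) R.is_cring Iid Ifin colon_ideal[OF H(1)] pow] ps(1)
    by (intro finite_index_by_generators[OF H(1) ps]) blast
  with H that show thesis by blast
qed

end


section \<open>Quotients of a profinite completion\<close>

context module
begin

lemma subgroup_of_submodule: "submodule H R M \<Longrightarrow> subgroup H (add_monoid M)"
  by (rule submodule.axioms(1))

lemma zero_in_submodule: "submodule H R M \<Longrightarrow> \<zero>\<^bsub>M\<^esub> \<in> H"
  using subgroup.one_closed[OF subgroup_of_submodule] by simp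

lemma quotient_carrier: "carrier (quotient_module M H) = (\<lambda>x. H +>\<^bsub>M\<^esub> x) ` carrier M"
  by (auto simp: quotient_module_def A_RCOSETS_def')

lemma quotient_eq_iff:
  "submodule H R M \<Longrightarrow> x \<in> carrier M \<Longrightarrow> y \<in> carrier M \<Longrightarrow>
    H +>\<^bsub>M\<^esub> x = H +>\<^bsub>M\<^esub> y \<longleftrightarrow> x \<ominus>\<^bsub>M\<^esub> y \<in> H"
  by (rule M.coset_eq_iff[OF subgroup_of_submodule])

lemma quotient_zero_iff:
  assumes "submodule H R M" "x \<in> carrier M"
  shows "H +>\<^bsub>M\<^esub> x = H \<longleftrightarrow> x \<in> H"
proof -
  have "\<ominus>\<^bsub>M\<^esub> \<zero>\<^bsub>M\<^esub> = \<zero>\<^bsub>M\<^esub>" by (metis M.minus_equality M.r_zero M.zero_closed)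
  then have "x \<ominus>\<^bsub>M\<^esub> \<zero>\<^bsub>M\<^esub> = x" using assms(2) by (metis M.minus_eq M.r_zero)
  moreover have "H +>\<^bsub>M\<^esub> \<zero>\<^bsub>M\<^esub> = H" using submoduleE(1)[OF assms(1)] by simp
  ultimately show ?thesis using quotient_eq_iff[OF assms M.zero_closed] by (simp only:)
qed

lemma set_add_coset:
  assumes "submodule H R M" "submodule K R M" "H \<subseteq> K" "x \<in> carrier M"
  shows "K <+>\<^bsub>M\<^esub> (H +>\<^bsub>M\<^esub> x) = K +>\<^bsub>M\<^esub> x"
proof (intro equalityI subsetI)
  note Kc = submoduleE[OF assms(2)]
  fix z assume "z \<in> K <+>\<^bsub>M\<^esub> (H +>\<^bsub>M\<^esub> x)"
  then obtain k h where kh: "k \<in> K" "h \<in> H" "z = k \<oplus>\<^bsub>M\<^esub> (h \<oplus>\<^bsub>M\<^esub> x)"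
    unfolding set_add_def' a_r_coset_def' by auto
  then have "z = (k \<oplus>\<^bsub>M\<^esub> h) \<oplus>\<^bsub>M\<^esub> x" using Kc(1) assms(3,4) by (simp add: M.a_assoc subset_iff)
  moreover have "k \<oplus>\<^bsub>M\<^esub> h \<in> K" using Kc(5) kh assms(3) by auto
  ultimately show "z \<in> K +>\<^bsub>M\<^esub> x" unfolding a_r_coset_def' by auto
next
  note Kc = submoduleE[OF assms(2)]
  fix z assume "z \<in> K +>\<^bsub>M\<^esub> x"
  then obtain k where k: "k \<in> K" "z = k \<oplus>\<^bsub>M\<^esub> x" unfolding a_r_coset_def' by auto
  then have "z = k \<oplus>\<^bsub>M\<^esub> (\<zero>\<^bsub>M\<^esub> \<oplus>\<^bsub>M\<^esub> x)" using assms(4) by simp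
  then show "z \<in> K <+>\<^bsub>M\<^esub> (H +>\<^bsub>M\<^esub> x)"
    unfolding set_add_def' a_r_coset_def' using k zero_in_submodule[OF assms(1)] by auto
qed

lemma coset_add:
  assumes "submodule H R M" "x \<in> carrier M" "y \<in> carrier M"
  shows "(H +>\<^bsub>M\<^esub> x) <+>\<^bsub>M\<^esub> (H +>\<^bsub>M\<^esub> y) = H +>\<^bsub>M\<^esub> (x \<oplus>\<^bsub>M\<^esub> y)"
proof -
  interpret H: abelian_subgroup H M
    by (rule abelian_subgroupI2[OF M.a_comm_group subgroup_of_submodule[OF assms(1)]])
  show ?thesis
    using normal.rcos_sum[OF H.a_normal, of x y] assms(2,3) by (simp add: set_add_def a_r_coset_def)
qed

lemma quotient_add:
  "submodule H R M \<Longrightarrow> x \<in> carrier M \<Longrightarrow> y \<in> carrier M \<Longrightarrow>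
    (H +>\<^bsub>M\<^esub> x) \<oplus>\<^bsub>quotient_module M H\<^esub> (H +>\<^bsub>M\<^esub> y) = H +>\<^bsub>M\<^esub> (x \<oplus>\<^bsub>M\<^esub> y)"
  by (simp add: quotient_module_def coset_add)

lemma quotient_smult:
  assumes H: "submodule H R M" and r: "r \<in> carrier R" and x: "x \<in> carrier M"
  shows "r \<odot>\<^bsub>quotient_module M H\<^esub> (H +>\<^bsub>M\<^esub> x) = H +>\<^bsub>M\<^esub> (r \<odot>\<^bsub>M\<^esub> x)"
proof -
  note Hc = submoduleE[OF H]
  have eq: "H +>\<^bsub>M\<^esub> (r \<odot>\<^bsub>M\<^esub> y) = H +>\<^bsub>M\<^esub> (r \<odot>\<^bsub>M\<^esub> x)" if y: "y \<in> H +>\<^bsub>M\<^esub> x" for y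
  proof -
    obtain h where h: "h \<in> H" "y = h \<oplus>\<^bsub>M\<^esub> x" using y unfolding a_r_coset_def' by auto
    have hM: "h \<in> carrier M" using h Hc(1) by auto
    have "r \<odot>\<^bsub>M\<^esub> y \<ominus>\<^bsub>M\<^esub> r \<odot>\<^bsub>M\<^esub> x = r \<odot>\<^bsub>M\<^esub> h"
      using h hM r x by (simp add: smult_r_distr M.minus_eq M.a_assoc M.r_neg)
    then show ?thesis using quotient_eq_iff[OF H] Hc(4)[OF r h(1)] h hM r x by simp
  qed
  have "x \<in> H +>\<^bsub>M\<^esub> x"
    unfolding a_r_coset_def' using zero_in_submodule[OF H] x by (auto intro!: bexI[of _ "\<zero>\<^bsub>M\<^esub>"])
  then have "(\<Union>y\<in>H +>\<^bsub>M\<^esub> x. H +>\<^bsub>M\<^esub> (r \<odot>\<^bsub>M\<^esub> y)) = H +>\<^bsub>M\<^esub> (r \<odot>\<^bsub>M\<^esub> x)" using eq by blast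
  then show ?thesis by (simp add: quotient_module_def)
qed

lemma cofinite_iff: "H \<in> cofinite_submodules R M \<longleftrightarrow> submodule H R M \<and> finite_index M H"
  using submodule_finite_index_iff unfolding cofinite_submodules_def by (auto simp: quotient_module_def)

lemma submodule_Int:
  assumes "submodule H R M" "submodule K R M"
  shows "submodule (H \<inter> K) R M"
  using submoduleE[OF assms(1)] submoduleE[OF assms(2)] zero_in_submodule assms
  by (intro submoduleI) auto

lemma cofinite_Int:
  assumes "H \<in> cofinite_submodules R M" "K \<in> cofinite_submodules R M"
  shows "H \<inter> K \<in> cofinite_submodules R M"
proof -
  have sub: "submodule H R M" "submodule K R M" "submodule (H \<inter> K) R M"
    using assms submodule_Int cofinite_iff by auto
  have fin: "finite_index M H" "finite_index M K" using assms cofinite_iff by auto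
  obtain S where S: "finite S" "S \<subseteq> carrier M" "\<forall>x\<in>carrier M. \<exists>t\<in>S. x \<ominus>\<^bsub>M\<^esub> t \<in> H"
    by (rule finite_indexE[OF fin(1)])
  obtain T where T: "finite T" "T \<subseteq> carrier M" "\<forall>x\<in>carrier M. \<exists>t\<in>T. x \<ominus>\<^bsub>M\<^esub> t \<in> K"
    by (rule finite_indexE[OF fin(2)])
  define Q where "Q = (\<lambda>s t x. x \<in> carrier M \<and> x \<ominus>\<^bsub>M\<^esub> s \<in> H \<and> x \<ominus>\<^bsub>M\<^esub> t \<in> K)"
  define c where "c = (\<lambda>s t. if \<exists>x. Q s t x then SOME x. Q s t x else \<zero>\<^bsub>M\<^esub>)"
  have c: "Q s t (c s t)" if "Q s t x" for s t x
    unfolding c_def using that by (auto intro: someI)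
  have diff: "x \<ominus>\<^bsub>M\<^esub> y \<in> L" if "submodule L R M" "x \<ominus>\<^bsub>M\<^esub> u \<in> L" "y \<ominus>\<^bsub>M\<^esub> u \<in> L"
      "x \<in> carrier M" "y \<in> carrier M" "u \<in> carrier M" for x y u L
    using quotient_eq_iff[OF that(1,4,6)] quotient_eq_iff[OF that(1,5,6)]
      quotient_eq_iff[OF that(1,4,5)] that(2,3) by simp
  have "finite_index M (H \<inter> K)"
  proof (rule finite_indexI)
    let ?U = "(\<lambda>(s, t). c s t) ` (S \<times> T)"
    show "finite ?U" using S T by simp
    have "c s t \<in> carrier M" for s t
    proof (cases "\<exists>x. Q s t x")
      case True
      then show ?thesis using c unfolding Q_def by blast
    next
      case False
      then show ?thesis unfolding c_def by (simp only: if_False M.zero_closed)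
    qed
    then show "?U \<subseteq> carrier M" by auto
    fix x assume x: "x \<in> carrier M"
    obtain s t where st: "s \<in> S" "t \<in> T" "Q s t x" using S(3) T(3) x unfolding Q_def by blast
    have M: "s \<in> carrier M" "t \<in> carrier M" using st S(2) T(2) by auto
    have Qx: "x \<ominus>\<^bsub>M\<^esub> s \<in> H" "x \<ominus>\<^bsub>M\<^esub> t \<in> K" using st(3) unfolding Q_def by auto
    have Qc: "c s t \<in> carrier M" "c s t \<ominus>\<^bsub>M\<^esub> s \<in> H" "c s t \<ominus>\<^bsub>M\<^esub> t \<in> K"
      using c[OF st(3)] unfolding Q_def by auto
    have "x \<ominus>\<^bsub>M\<^esub> c s t \<in> H \<inter> K"
      using diff[OF sub(1) Qx(1) Qc(2) x Qc(1) M(1)] diff[OF sub(2) Qx(2) Qc(3) x Qc(1) M(2)] by blast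
    moreover have "c s t \<in> ?U" using st(1,2) by auto
    ultimately show "\<exists>u\<in>?U. x \<ominus>\<^bsub>M\<^esub> u \<in> H \<inter> K" by blast
  qed
  then show ?thesis using sub cofinite_iff by auto
qed

lemma carrier_cofinite: "carrier M \<in> cofinite_submodules R M"
proof -
  have "finite_index M (carrier M)" by (rule finite_indexI[of "{\<zero>\<^bsub>M\<^esub>}"]) auto
  then show ?thesis using carrier_is_submodule cofinite_iff by auto
qed

lemma cofinite_Inter:
  assumes "finite E" "E \<subseteq> cofinite_submodules R M"
  shows "carrier M \<inter> \<Inter>E \<in> cofinite_submodules R M"
  using assms
proof (induction E rule: finite_induct)
  case empty
  then show ?case using carrier_cofinite by simp
next
  case (insert K E)
  then have "K \<inter> (carrier M \<inter> \<Inter>E) \<in> cofinite_submodules R M" using cofinite_Int by auto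
  then show ?case by (simp add: Int_left_commute Int_ac)
qed

definition completion_embedding :: "'c \<Rightarrow> 'c set \<Rightarrow> 'c set" where
  "completion_embedding x = (\<lambda>H\<in>cofinite_submodules R M. H +>\<^bsub>M\<^esub> x)"

lemma completion_carrier_iff:
  "x \<in> carrier (profinite_completion R M) \<longleftrightarrow>
    x \<in> (\<Pi>\<^sub>E H\<in>cofinite_submodules R M. carrier (quotient_module M H)) \<and>
    (\<forall>H\<in>cofinite_submodules R M. \<forall>K\<in>cofinite_submodules R M. H \<subseteq> K \<longrightarrow> K <+>\<^bsub>M\<^esub> x H = x K)"
  by (simp add: profinite_completion_def Let_def)

lemma completion_add:
  "x \<oplus>\<^bsub>profinite_completion R M\<^esub> y =
    (\<lambda>H\<in>cofinite_submodules R M. x H \<oplus>\<^bsub>quotient_module M H\<^esub> y H)"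
  by (simp add: profinite_completion_def Let_def)

lemma completion_smult:
  "r \<odot>\<^bsub>profinite_completion R M\<^esub> x =
    (\<lambda>H\<in>cofinite_submodules R M. r \<odot>\<^bsub>quotient_module M H\<^esub> x H)"
  by (simp add: profinite_completion_def Let_def)

lemma completion_embedding_closed:
  "x \<in> carrier M \<Longrightarrow> completion_embedding x \<in> carrier (profinite_completion R M)"
  unfolding completion_carrier_iff completion_embedding_def
  using set_add_coset cofinite_iff by (auto simp: quotient_carrier)

lemma completion_embedding_add:
  "x \<in> carrier M \<Longrightarrow> y \<in> carrier M \<Longrightarrow> completion_embedding (x \<oplus>\<^bsub>M\<^esub> y) =
    completion_embedding x \<oplus>\<^bsub>profinite_completion R M\<^esub> completion_embedding y"
  unfolding completion_add completion_embedding_def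
  using quotient_add cofinite_iff by (auto simp: restrict_def fun_eq_iff)

lemma completion_embedding_smult:
  "r \<in> carrier R \<Longrightarrow> x \<in> carrier M \<Longrightarrow> completion_embedding (r \<odot>\<^bsub>M\<^esub> x) =
    r \<odot>\<^bsub>profinite_completion R M\<^esub> completion_embedding x"
  unfolding completion_smult completion_embedding_def
  using quotient_smult cofinite_iff by (auto simp: restrict_def fun_eq_iff)

text \<open>Locally, at a given submodule, a point of the completion looks like an element of \<open>M\<close>.\<close>

lemma completion_representative:
  assumes "x \<in> carrier (profinite_completion R M)" "H \<in> cofinite_submodules R M"
  obtains a where "a \<in> carrier M"
    "\<forall>K\<in>cofinite_submodules R M. H \<subseteq> K \<longrightarrow> x K = K +>\<^bsub>M\<^esub> a"
proof -
  have "x H \<in> carrier (quotient_module M H)" using assms completion_carrier_iff by auto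
  then obtain a where a: "a \<in> carrier M" "x H = H +>\<^bsub>M\<^esub> a" using quotient_carrier by auto
  have "x K = K +>\<^bsub>M\<^esub> a" if "K \<in> cofinite_submodules R M" "H \<subseteq> K" for K
  proof -
    have "x K = K <+>\<^bsub>M\<^esub> x H" using assms that completion_carrier_iff by auto
    then show ?thesis using set_add_coset[of H K a] a assms(2) that cofinite_iff by simp
  qed
  with a that show thesis by blast
qed

lemma completion_add_closed:
  assumes x: "x \<in> carrier (profinite_completion R M)" and y: "y \<in> carrier (profinite_completion R M)"
  shows "x \<oplus>\<^bsub>profinite_completion R M\<^esub> y \<in> carrier (profinite_completion R M)"
  unfolding completion_carrier_iff completion_add
proof (intro conjI ballI impI)
  have at: "\<exists>c\<in>carrier M. \<forall>K\<in>cofinite_submodules R M. H \<subseteq> K \<longrightarrow>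
      x K \<oplus>\<^bsub>quotient_module M K\<^esub> y K = K +>\<^bsub>M\<^esub> c"
    if H: "H \<in> cofinite_submodules R M" for H
  proof -
    obtain a where a: "a \<in> carrier M" "\<forall>K\<in>cofinite_submodules R M. H \<subseteq> K \<longrightarrow> x K = K +>\<^bsub>M\<^esub> a"
      using completion_representative[OF x H] .
    obtain b where b: "b \<in> carrier M" "\<forall>K\<in>cofinite_submodules R M. H \<subseteq> K \<longrightarrow> y K = K +>\<^bsub>M\<^esub> b"
      using completion_representative[OF y H] .
    show ?thesis using a b quotient_add cofinite_iff by (intro bexI[of _ "a \<oplus>\<^bsub>M\<^esub> b"]) auto
  qed
  show "(\<lambda>H\<in>cofinite_submodules R M. x H \<oplus>\<^bsub>quotient_module M H\<^esub> y H) \<in>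
      (\<Pi>\<^sub>E H\<in>cofinite_submodules R M. carrier (quotient_module M H))"
    using at by (fastforce simp: quotient_carrier)
  fix H K assume HK: "H \<in> cofinite_submodules R M" "K \<in> cofinite_submodules R M" "H \<subseteq> K"
  then obtain c where c: "c \<in> carrier M" "x H \<oplus>\<^bsub>quotient_module M H\<^esub> y H = H +>\<^bsub>M\<^esub> c"
      "x K \<oplus>\<^bsub>quotient_module M K\<^esub> y K = K +>\<^bsub>M\<^esub> c" using at[OF HK(1)] by blast
  then show "K <+>\<^bsub>M\<^esub> (\<lambda>H\<in>cofinite_submodules R M. x H \<oplus>\<^bsub>quotient_module M H\<^esub> y H) H =
      (\<lambda>H\<in>cofinite_submodules R M. x H \<oplus>\<^bsub>quotient_module M H\<^esub> y H) K"
    using HK set_add_coset[of H K c] cofinite_iff by simp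
qed

lemma completion_smult_closed:
  assumes r: "r \<in> carrier R" and x: "x \<in> carrier (profinite_completion R M)"
  shows "r \<odot>\<^bsub>profinite_completion R M\<^esub> x \<in> carrier (profinite_completion R M)"
  unfolding completion_carrier_iff completion_smult
proof (intro conjI ballI impI)
  have at: "\<exists>c\<in>carrier M. \<forall>K\<in>cofinite_submodules R M. H \<subseteq> K \<longrightarrow>
      r \<odot>\<^bsub>quotient_module M K\<^esub> x K = K +>\<^bsub>M\<^esub> c"
    if H: "H \<in> cofinite_submodules R M" for H
  proof -
    obtain a where a: "a \<in> carrier M" "\<forall>K\<in>cofinite_submodules R M. H \<subseteq> K \<longrightarrow> x K = K +>\<^bsub>M\<^esub> a"
      using completion_representative[OF x H] .
    show ?thesis using a r quotient_smult cofinite_iff by (intro bexI[of _ "r \<odot>\<^bsub>M\<^esub> a"]) auto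
  qed
  show "(\<lambda>H\<in>cofinite_submodules R M. r \<odot>\<^bsub>quotient_module M H\<^esub> x H) \<in>
      (\<Pi>\<^sub>E H\<in>cofinite_submodules R M. carrier (quotient_module M H))"
    using at by (fastforce simp: quotient_carrier)
  fix H K assume HK: "H \<in> cofinite_submodules R M" "K \<in> cofinite_submodules R M" "H \<subseteq> K"
  then obtain c where c: "c \<in> carrier M" "r \<odot>\<^bsub>quotient_module M H\<^esub> x H = H +>\<^bsub>M\<^esub> c"
      "r \<odot>\<^bsub>quotient_module M K\<^esub> x K = K +>\<^bsub>M\<^esub> c" using at[OF HK(1)] by blast
  then show "K <+>\<^bsub>M\<^esub> (\<lambda>H\<in>cofinite_submodules R M. r \<odot>\<^bsub>quotient_module M H\<^esub> x H) H =
      (\<lambda>H\<in>cofinite_submodules R M. r \<odot>\<^bsub>quotient_module M H\<^esub> x H) K"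
    using HK set_add_coset[of H K c] cofinite_iff by simp
qed

lemma topspace_profinite: "topspace (profinite_topology R M) = carrier (profinite_completion R M)"
proof -
  have "carrier (profinite_completion R M) \<subseteq>
      (\<Pi>\<^sub>E H\<in>cofinite_submodules R M. carrier (quotient_module M H))"
    using completion_carrier_iff by (intro subsetI) (simp only:)
  then show ?thesis
    unfolding profinite_topology_def topspace_subtopology topspace_product_topology o_def
      topspace_discrete_topology by (rule Int_absorb1)
qed

lemma completion_embedding_dense:
  assumes V: "openin (profinite_topology R M) V" and x: "x \<in> V"
  obtains a where "a \<in> carrier M" "completion_embedding a \<in> V"
proof -
  let ?F = "cofinite_submodules R M"
  let ?T = "\<lambda>H. discrete_topology (carrier (quotient_module M H))"
  have xc: "x \<in> carrier (profinite_completion R M)"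
    using openin_subset[OF V] x topspace_profinite by auto
  obtain W where W: "openin (product_topology ?T ?F) W" "V = W \<inter> carrier (profinite_completion R M)"
    using V unfolding profinite_topology_def openin_subtopology by blast
  have "x \<in> W" using x W(2) by simp
  then have "\<exists>U. finite {K \<in> ?F. U K \<noteq> topspace (?T K)} \<and> (\<forall>K\<in>?F. openin (?T K) (U K)) \<and>
      x \<in> Pi\<^sub>E ?F U \<and> Pi\<^sub>E ?F U \<subseteq> W"
    by (rule bspec[OF W(1)[unfolded openin_product_topology_alt]])
  then obtain U where U: "finite {K \<in> ?F. U K \<noteq> topspace (?T K)}" "x \<in> Pi\<^sub>E ?F U" "Pi\<^sub>E ?F U \<subseteq> W"
    by (elim exE conjE)
  define E where "E = {K \<in> ?F. U K \<noteq> topspace (?T K)}"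
  define H where "H = carrier M \<inter> \<Inter>E"
  have E: "finite E" "E \<subseteq> ?F" using U(1) unfolding E_def by auto
  have H: "H \<in> ?F" unfolding H_def by (rule cofinite_Inter[OF E])
  obtain a where a: "a \<in> carrier M" "\<forall>K\<in>?F. H \<subseteq> K \<longrightarrow> x K = K +>\<^bsub>M\<^esub> a"
    using completion_representative[OF xc H] .
  have "completion_embedding a \<in> Pi\<^sub>E ?F U"
  proof (rule PiE_I)
    fix K assume K: "K \<in> ?F"
    show "completion_embedding a K \<in> U K"
    proof (cases "K \<in> E")
      case True
      then have "H \<subseteq> K" unfolding H_def by auto
      then have "completion_embedding a K = x K" using a(2) K unfolding completion_embedding_def by simp
      then show ?thesis using U(2) K by auto
    next
      case False
      then have "U K = carrier (quotient_module M K)" using K unfolding E_def by simp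
      then show ?thesis using K a(1) quotient_carrier unfolding completion_embedding_def by auto
    qed
  qed (simp add: completion_embedding_def)
  then show thesis using that[OF a(1)] U(3) W(2) completion_embedding_closed[OF a(1)] by auto
qed

end

text \<open>A finite quotient \<open>N / H\<close> is a continuous quotient of the completion of \<open>N\<close>, in which the image
  of \<open>M\<close> is dense; as \<open>N / H\<close> is discrete, \<open>M\<close> maps onto it.\<close>

lemma finite_quotient_of_completion:
  assumes "module R M" "module R N"
    and f: "f \<in> mod_hom R (profinite_completion R M) (profinite_completion R N)"
    and surj: "f ` carrier (profinite_completion R M) = carrier (profinite_completion R N)"
    and cont: "continuous_map (profinite_topology R M) (profinite_topology R N) f"
    and H: "H \<in> cofinite_submodules R N"
  obtains g where "g \<in> mod_hom R M (quotient_module N H)"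
    "g ` carrier M = carrier (quotient_module N H)"
proof -
  interpret M: module R M by fact
  interpret N: module R N by fact
  let ?M = "profinite_completion R M" and ?N = "profinite_completion R N"
  define g where "g = (\<lambda>m. f (M.completion_embedding m) H)"
  have fc: "f x \<in> carrier ?N" if "x \<in> carrier ?M" for x using f that unfolding mod_hom_def by auto
  have at: "z H \<in> carrier (quotient_module N H)" if "z \<in> carrier ?N" for z
    using that H N.completion_carrier_iff by auto
  have "g \<in> mod_hom R M (quotient_module N H)"
    unfolding mod_hom_def
  proof (intro CollectI conjI ballI)
    show "g \<in> carrier M \<rightarrow> carrier (quotient_module N H)"
      unfolding g_def using at fc M.completion_embedding_closed by blast
    show "g (x \<oplus>\<^bsub>M\<^esub> y) = g x \<oplus>\<^bsub>quotient_module N H\<^esub> g y"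
      if "x \<in> carrier M" "y \<in> carrier M" for x y
      using f that M.completion_embedding_closed M.completion_embedding_add H
      unfolding g_def mod_hom_def by (simp add: N.completion_add)
    show "g (r \<odot>\<^bsub>M\<^esub> x) = r \<odot>\<^bsub>quotient_module N H\<^esub> g x"
      if "r \<in> carrier R" "x \<in> carrier M" for r x
      using f that M.completion_embedding_closed M.completion_embedding_smult H
      unfolding g_def mod_hom_def by (simp add: N.completion_smult)
  qed
  moreover have "c \<in> g ` carrier M" if c: "c \<in> carrier (quotient_module N H)" for c
  proof -
    obtain n where n: "n \<in> carrier N" "c = H +>\<^bsub>N\<^esub> n" using c N.quotient_carrier by auto
    define U where "U = {z \<in> carrier ?N. z H = c}"
    let ?T = "\<lambda>H. discrete_topology (carrier (quotient_module N H))"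
    have "continuous_map (product_topology ?T (cofinite_submodules R N)) (?T H) (\<lambda>z. z H)"
      using H by (rule continuous_map_product_projection)
    then have "openin (product_topology ?T (cofinite_submodules R N))
        {z \<in> topspace (product_topology ?T (cofinite_submodules R N)). z H \<in> {c}}"
      by (rule openin_continuous_map_preimage) (use c in simp)
    then have "openin (profinite_topology R N) U"
      unfolding profinite_topology_def openin_subtopology U_def
      by (intro exI conjI, assumption) (auto simp: N.completion_carrier_iff)
    then have V: "openin (profinite_topology R M) {x \<in> topspace (profinite_topology R M). f x \<in> U}"
      by (rule openin_continuous_map_preimage[OF cont])
    have "N.completion_embedding n \<in> U"
      unfolding U_def using N.completion_embedding_closed[OF n(1)] n(2) H
      by (simp add: N.completion_embedding_def)
    moreover obtain x where x: "x \<in> carrier ?M" "f x = N.completion_embedding n"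
      using surj N.completion_embedding_closed[OF n(1)] by (metis imageE)
    ultimately have "x \<in> {x \<in> topspace (profinite_topology R M). f x \<in> U}"
      by (simp add: M.topspace_profinite)
    then obtain a where "a \<in> carrier M" "f (M.completion_embedding a) \<in> U"
      using M.completion_embedding_dense[OF V] by blast
    then show ?thesis unfolding U_def g_def by auto
  qed
  ultimately show thesis using that[of g] unfolding mod_hom_def by blast
qed

text \<open>The hypothesis is symmetric because the inverse of the isomorphism is again continuous and linear.\<close>

theorem isomorphic_completions_finite_quotients:
  assumes M: "module R M" and N: "module R N" and iso: "profinite_completions_isomorphic R M N"
  shows "H \<in> cofinite_submodules R N \<Longrightarrow>
      \<exists>g\<in>mod_hom R M (quotient_module N H). g ` carrier M = carrier (quotient_module N H)"
    and "H' \<in> cofinite_submodules R M \<Longrightarrow>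
      \<exists>g\<in>mod_hom R N (quotient_module M H'). g ` carrier N = carrier (quotient_module M H')"
proof -
  interpret M: module R M by fact
  interpret N: module R N by fact
  let ?M = "profinite_completion R M" and ?N = "profinite_completion R N"
  obtain f where f: "f \<in> mod_hom R ?M ?N" "bij_betw f (carrier ?M) (carrier ?N)"
    and hom: "homeomorphic_map (profinite_topology R M) (profinite_topology R N) f"
    using iso unfolding profinite_completions_isomorphic_def mod_iso_def by auto
  obtain g where g: "homeomorphic_maps (profinite_topology R M) (profinite_topology R N) f g"
    using hom homeomorphic_map_maps by blast
  then have cont: "continuous_map (profinite_topology R M) (profinite_topology R N) f"
      "continuous_map (profinite_topology R N) (profinite_topology R M) g"
    and gf: "\<And>x. x \<in> carrier ?M \<Longrightarrow> g (f x) = x" and fg: "\<And>y. y \<in> carrier ?N \<Longrightarrow> f (g y) = y"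
    unfolding homeomorphic_maps_def by (auto simp: M.topspace_profinite N.topspace_profinite)
  have gc: "g y \<in> carrier ?M" if "y \<in> carrier ?N" for y
    using continuous_map_image_subset_topspace[OF cont(2)] that
    by (auto simp: M.topspace_profinite N.topspace_profinite)
  have fc: "f x \<in> carrier ?N" if "x \<in> carrier ?M" for x
    using f that unfolding mod_hom_def by auto
  have ghom: "g \<in> mod_hom R ?N ?M"
    unfolding mod_hom_def
  proof (intro CollectI conjI ballI)
    show "g \<in> carrier ?N \<rightarrow> carrier ?M" using gc by blast
    fix y y' assume y: "y \<in> carrier ?N" "y' \<in> carrier ?N"
    have "f (g y \<oplus>\<^bsub>?M\<^esub> g y') = y \<oplus>\<^bsub>?N\<^esub> y'" using f(1) gc fg y unfolding mod_hom_def by auto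
    then show "g (y \<oplus>\<^bsub>?N\<^esub> y') = g y \<oplus>\<^bsub>?M\<^esub> g y'"
      using gf[OF M.completion_add_closed[OF gc gc]] y by metis
  next
    fix r y assume y: "r \<in> carrier R" "y \<in> carrier ?N"
    have "f (r \<odot>\<^bsub>?M\<^esub> g y) = r \<odot>\<^bsub>?N\<^esub> y" using f(1) gc fg y unfolding mod_hom_def by auto
    then show "g (r \<odot>\<^bsub>?N\<^esub> y) = r \<odot>\<^bsub>?M\<^esub> g y"
      using gf[OF M.completion_smult_closed[OF y(1) gc]] y by metis
  qed
  have gsurj: "g ` carrier ?N = carrier ?M" using gc gf fc by (metis (no_types, lifting) image_eqI image_subset_iff subsetI subset_antisym)
  show "\<exists>g\<in>mod_hom R M (quotient_module N H). g ` carrier M = carrier (quotient_module N H)"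
    if "H \<in> cofinite_submodules R N"
    using finite_quotient_of_completion[OF M N f(1) bij_betw_imp_surj_on[OF f(2)] cont(1) that] by metis
  show "\<exists>g\<in>mod_hom R N (quotient_module M H'). g ` carrier N = carrier (quotient_module M H')"
    if "H' \<in> cofinite_submodules R M"
    using finite_quotient_of_completion[OF N M ghom gsurj cont(2) that] by metis
qed


section \<open>Rings of fractions of a domain\<close>

locale domain_fractions = domain R for R (structure) +
  fixes S :: "'a set"
  assumes S_subset: "S \<subseteq> carrier R"
    and zero_notin_S: "\<zero> \<notin> S"
    and one_in_S [simp]: "\<one> \<in> S"
    and S_mult [simp, intro]: "s \<in> S \<Longrightarrow> t \<in> S \<Longrightarrow> s \<otimes> t \<in> S"
begin

abbreviation A where "A \<equiv> fraction_ring R S"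
abbreviation fr where "fr \<equiv> fraction R S"

lemma S_carrier [simp, intro]: "s \<in> S \<Longrightarrow> s \<in> carrier R"
  using S_subset by auto

lemma S_nonzero: "s \<in> S \<Longrightarrow> s \<noteq> \<zero>"
  using zero_notin_S by auto

lemma fraction_iff:
  assumes "r \<in> carrier R" "s \<in> S"
  shows "(r', s') \<in> fr r s \<longleftrightarrow> r' \<in> carrier R \<and> s' \<in> S \<and> r \<otimes> s' = r' \<otimes> s"
proof -
  have "(\<exists>t\<in>S. t \<otimes> (r \<otimes> s' \<ominus> r' \<otimes> s) = \<zero>) \<longleftrightarrow> r \<otimes> s' = r' \<otimes> s"
    if c: "r' \<in> carrier R \<and> s' \<in> S"
  proof
    assume "\<exists>t\<in>S. t \<otimes> (r \<otimes> s' \<ominus> r' \<otimes> s) = \<zero>"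
    then obtain t where t: "t \<in> S" "t \<otimes> (r \<otimes> s' \<ominus> r' \<otimes> s) = \<zero>" by blast
    have d: "r \<otimes> s' \<in> carrier R" "r' \<otimes> s \<in> carrier R" using assms c by simp_all
    have "r \<otimes> s' \<ominus> r' \<otimes> s = \<zero>"
      using integral[OF t(2) S_carrier[OF t(1)] minus_closed[OF d]] S_nonzero[OF t(1)] by blast
    then show "r \<otimes> s' = r' \<otimes> s" using d by simp
  next
    assume "r \<otimes> s' = r' \<otimes> s"
    then have "\<one> \<otimes> (r \<otimes> s' \<ominus> r' \<otimes> s) = \<zero>" using assms c by (simp add: minus_eq r_neg)
    then show "\<exists>t\<in>S. t \<otimes> (r \<otimes> s' \<ominus> r' \<otimes> s) = \<zero>" by (rule bexI[OF _ one_in_S])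
  qed
  moreover have "(r', s') \<in> fr r s \<longleftrightarrow>
      (r' \<in> carrier R \<and> s' \<in> S) \<and> (\<exists>t\<in>S. t \<otimes> (r \<otimes> s' \<ominus> r' \<otimes> s) = \<zero>)"
    unfolding fraction_def by (simp only: mem_Collect_eq case_prod_conv Int_iff mem_Sigma_iff conj_assoc)
  ultimately show ?thesis by blast
qed

lemma fraction_trans:
  assumes "r \<in> carrier R" "s \<in> S" "r' \<in> carrier R" "s' \<in> S" "r'' \<in> carrier R" "s'' \<in> S"
    and "r \<otimes> s' = r' \<otimes> s" "r \<otimes> s'' = r'' \<otimes> s"
  shows "r' \<otimes> s'' = r'' \<otimes> s'"
proof -
  have "s \<otimes> (r' \<otimes> s'') = (r' \<otimes> s) \<otimes> s''" using assms by (simp add: m_ac)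
  also have "\<dots> = (r \<otimes> s'') \<otimes> s'" using assms(1-6) by (simp add: assms(7)[symmetric] m_ac)
  also have "\<dots> = s \<otimes> (r'' \<otimes> s')" using assms(1-6) by (simp add: assms(8) m_ac)
  finally show ?thesis using m_lcancel[OF S_nonzero] assms by auto
qed

lemma fraction_eq_iff:
  assumes "r \<in> carrier R" "s \<in> S" "r' \<in> carrier R" "s' \<in> S"
  shows "fr r s = fr r' s' \<longleftrightarrow> r \<otimes> s' = r' \<otimes> s"
proof
  assume eq: "fr r s = fr r' s'"
  have "(r', s') \<in> fr r' s'" using fraction_iff[OF assms(3,4)] assms by simp
  then have "(r', s') \<in> fr r s" unfolding eq .
  then show "r \<otimes> s' = r' \<otimes> s" using fraction_iff[OF assms(1,2)] by blast
next
  assume eq: "r \<otimes> s' = r' \<otimes> s"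
  have "x \<in> fr r s \<longleftrightarrow> x \<in> fr r' s'" for x
  proof (cases x)
    case (Pair a b)
    show ?thesis
      unfolding Pair fraction_iff[OF assms(1,2)] fraction_iff[OF assms(3,4)]
      using fraction_trans[OF assms _ _ eq, of a b] fraction_trans[OF assms(3,4,1,2) _ _ eq[symmetric], of a b]
      by blast
  qed
  then show "fr r s = fr r' s'" by blast
qed

lemma fraction_self: "r \<in> carrier R \<Longrightarrow> s \<in> S \<Longrightarrow> (r, s) \<in> fr r s"
  using fraction_iff by auto

lemma fraction_ring_carrier: "carrier A = {fr r s | r s. r \<in> carrier R \<and> s \<in> S}"
  by (simp add: fraction_ring_def)

lemma fraction_closed [simp, intro]: "r \<in> carrier R \<Longrightarrow> s \<in> S \<Longrightarrow> fr r s \<in> carrier A"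
  unfolding fraction_ring_carrier by blast

lemma fractionE:
  assumes "a \<in> carrier A"
  obtains r s where "r \<in> carrier R" "s \<in> S" "a = fr r s"
  using assms unfolding fraction_ring_carrier by blast

lemma fraction_union:
  assumes rs: "r \<in> carrier R" "s \<in> S" "r' \<in> carrier R" "s' \<in> S"
    and const: "\<And>a b a' b'. a \<in> carrier R \<Longrightarrow> b \<in> S \<Longrightarrow> a' \<in> carrier R \<Longrightarrow> b' \<in> S \<Longrightarrow>
      r \<otimes> b = a \<otimes> s \<Longrightarrow> r' \<otimes> b' = a' \<otimes> s' \<Longrightarrow> f a b a' b' = f r s r' s'"
  shows "(\<Union>(a, b)\<in>fr r s. \<Union>(a', b')\<in>fr r' s'. f a b a' b') = f r s r' s'"
proof -
  have "f a b a' b' = f r s r' s'" if "(a, b) \<in> fr r s" "(a', b') \<in> fr r' s'" for a b a' b'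
    using that const unfolding fraction_iff[OF rs(1,2)] fraction_iff[OF rs(3,4)] by blast
  moreover have "(r, s) \<in> fr r s" "(r', s') \<in> fr r' s'" using fraction_self rs by auto
  ultimately show ?thesis by blast
qed

lemma fraction_mult [simp]:
  assumes rs: "r \<in> carrier R" "s \<in> S" "r' \<in> carrier R" "s' \<in> S"
  shows "fr r s \<otimes>\<^bsub>A\<^esub> fr r' s' = fr (r \<otimes> r') (s \<otimes> s')"
proof -
  have "(\<Union>(a, b)\<in>fr r s. \<Union>(a', b')\<in>fr r' s'. fr (a \<otimes> a') (b \<otimes> b')) = fr (r \<otimes> r') (s \<otimes> s')"
  proof (rule fraction_union[OF rs])
    fix a b a' b' assume c: "a \<in> carrier R" "b \<in> S" "a' \<in> carrier R" "b' \<in> S"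
      and eq: "r \<otimes> b = a \<otimes> s" "r' \<otimes> b' = a' \<otimes> s'"
    have "(a \<otimes> a') \<otimes> (s \<otimes> s') = (a \<otimes> s) \<otimes> (a' \<otimes> s')" using c rs by (simp add: m_ac)
    also have "\<dots> = (r \<otimes> r') \<otimes> (b \<otimes> b')" unfolding eq[symmetric] using c rs by (simp add: m_ac)
    finally show "fr (a \<otimes> a') (b \<otimes> b') = fr (r \<otimes> r') (s \<otimes> s')"
      using c rs by (subst fraction_eq_iff) auto
  qed
  then show ?thesis by (simp add: fraction_ring_def)
qed

lemma fraction_add [simp]:
  assumes rs: "r \<in> carrier R" "s \<in> S" "r' \<in> carrier R" "s' \<in> S"
  shows "fr r s \<oplus>\<^bsub>A\<^esub> fr r' s' = fr (r \<otimes> s' \<oplus> r' \<otimes> s) (s \<otimes> s')"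
proof -
  have "(\<Union>(a, b)\<in>fr r s. \<Union>(a', b')\<in>fr r' s'. fr (a \<otimes> b' \<oplus> a' \<otimes> b) (b \<otimes> b')) =
      fr (r \<otimes> s' \<oplus> r' \<otimes> s) (s \<otimes> s')"
  proof (rule fraction_union[OF rs])
    fix a b a' b' assume c: "a \<in> carrier R" "b \<in> S" "a' \<in> carrier R" "b' \<in> S"
      and eq: "r \<otimes> b = a \<otimes> s" "r' \<otimes> b' = a' \<otimes> s'"
    have "(a \<otimes> b' \<oplus> a' \<otimes> b) \<otimes> (s \<otimes> s') = (a \<otimes> s) \<otimes> (b' \<otimes> s') \<oplus> (a' \<otimes> s') \<otimes> (b \<otimes> s)"
      using c rs by (simp add: l_distr r_distr m_ac)
    also have "\<dots> = (r \<otimes> s' \<oplus> r' \<otimes> s) \<otimes> (b \<otimes> b')"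
      unfolding eq[symmetric] using c rs by (simp add: l_distr r_distr m_ac)
    finally show "fr (a \<otimes> b' \<oplus> a' \<otimes> b) (b \<otimes> b') = fr (r \<otimes> s' \<oplus> r' \<otimes> s) (s \<otimes> s')"
      using c rs by (subst fraction_eq_iff) auto
  qed
  then show ?thesis by (simp add: fraction_ring_def)
qed

lemma fraction_one: "\<one>\<^bsub>A\<^esub> = fr \<one> \<one>" and fraction_zero: "\<zero>\<^bsub>A\<^esub> = fr \<zero> \<one>"
  by (simp_all add: fraction_ring_def)

lemma fraction_ring_cring: "cring A"
proof (rule cringI)
  show "abelian_group A"
  proof (rule abelian_groupI)
    fix x y assume "x \<in> carrier A" "y \<in> carrier A"
    then obtain r s r' s' where xy: "r \<in> carrier R" "s \<in> S" "x = fr r s"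
      "r' \<in> carrier R" "s' \<in> S" "y = fr r' s'" by (metis fractionE)
    then show "x \<oplus>\<^bsub>A\<^esub> y \<in> carrier A" by simp
    from xy show "x \<oplus>\<^bsub>A\<^esub> y = y \<oplus>\<^bsub>A\<^esub> x" by (simp add: a_comm m_comm)
    fix z assume "z \<in> carrier A"
    then obtain r'' s'' where "r'' \<in> carrier R" "s'' \<in> S" "z = fr r'' s''" by (metis fractionE)
    with xy show "x \<oplus>\<^bsub>A\<^esub> y \<oplus>\<^bsub>A\<^esub> z = x \<oplus>\<^bsub>A\<^esub> (y \<oplus>\<^bsub>A\<^esub> z)"
      by (simp add: fraction_eq_iff l_distr r_distr m_ac a_ac)
  next
    show "\<zero>\<^bsub>A\<^esub> \<in> carrier A" by (simp add: fraction_zero)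
  next
    fix x assume "x \<in> carrier A"
    then obtain r s where x: "r \<in> carrier R" "s \<in> S" "x = fr r s" by (metis fractionE)
    then show "\<zero>\<^bsub>A\<^esub> \<oplus>\<^bsub>A\<^esub> x = x" by (simp add: fraction_zero)
    have "fr (\<ominus> r) s \<oplus>\<^bsub>A\<^esub> x = \<zero>\<^bsub>A\<^esub>"
      using x by (simp add: fraction_zero fraction_eq_iff l_minus l_neg)
    then show "\<exists>y\<in>carrier A. y \<oplus>\<^bsub>A\<^esub> x = \<zero>\<^bsub>A\<^esub>" using x by blast
  qed
  show "comm_monoid A"
  proof (rule comm_monoidI)
    fix x y assume "x \<in> carrier A" "y \<in> carrier A"
    then obtain r s r' s' where xy: "r \<in> carrier R" "s \<in> S" "x = fr r s"
      "r' \<in> carrier R" "s' \<in> S" "y = fr r' s'" by (metis fractionE)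
    then show "x \<otimes>\<^bsub>A\<^esub> y \<in> carrier A" by simp
    from xy show "x \<otimes>\<^bsub>A\<^esub> y = y \<otimes>\<^bsub>A\<^esub> x" by (simp add: m_comm)
    fix z assume "z \<in> carrier A"
    then obtain r'' s'' where "r'' \<in> carrier R" "s'' \<in> S" "z = fr r'' s''" by (metis fractionE)
    with xy show "x \<otimes>\<^bsub>A\<^esub> y \<otimes>\<^bsub>A\<^esub> z = x \<otimes>\<^bsub>A\<^esub> (y \<otimes>\<^bsub>A\<^esub> z)"
      by (simp add: m_assoc)
  next
    show "\<one>\<^bsub>A\<^esub> \<in> carrier A" by (simp add: fraction_one)
  next
    fix x assume "x \<in> carrier A"
    then obtain r s where x: "r \<in> carrier R" "s \<in> S" "x = fr r s" by (metis fractionE)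
    then show "\<one>\<^bsub>A\<^esub> \<otimes>\<^bsub>A\<^esub> x = x" by (simp add: fraction_one)
  qed
  fix x y z assume "x \<in> carrier A" "y \<in> carrier A" "z \<in> carrier A"
  then obtain r s r' s' r'' s'' where "r \<in> carrier R" "s \<in> S" "x = fr r s"
      "r' \<in> carrier R" "s' \<in> S" "y = fr r' s'" "r'' \<in> carrier R" "s'' \<in> S" "z = fr r'' s''"
    by (metis fractionE)
  then show "(x \<oplus>\<^bsub>A\<^esub> y) \<otimes>\<^bsub>A\<^esub> z = x \<otimes>\<^bsub>A\<^esub> z \<oplus>\<^bsub>A\<^esub> y \<otimes>\<^bsub>A\<^esub> z"
    by (simp add: fraction_eq_iff l_distr r_distr m_ac)
qed

lemma fraction_hom: "(\<lambda>r. fr r \<one>) \<in> ring_hom R A"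
  by (rule ring_hom_memI) (simp_all add: fraction_one)

lemma fraction_eq_zero_iff: "r \<in> carrier R \<Longrightarrow> s \<in> S \<Longrightarrow> fr r s = \<zero>\<^bsub>A\<^esub> \<longleftrightarrow> r = \<zero>"
  by (simp add: fraction_zero fraction_eq_iff)

end


section \<open>Base change\<close>

locale scalar_extension = module R M + A: cring A
  for R :: "('a, 'r) ring_scheme" (structure) and M :: "('a, 'm, 'k) module_scheme" (structure)
    and A :: "('b, 's) ring_scheme" (structure) +
  fixes \<phi> :: "'a \<Rightarrow> 'b"
  assumes hom: "\<phi> \<in> ring_hom R A"
begin

abbreviation F where "F \<equiv> free_Abelian_group (carrier M \<times> carrier A)"
definition K where "K = generate F (tensor_relations R A \<phi> M)"
abbreviation T where "T \<equiv> base_change R A \<phi> M"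
definition cls where "cls z = K #>\<^bsub>F\<^esub> z"
definition tensor where "tensor x a = cls (frag_of (x, a))"
definition scale where "scale b = frag_extend (\<lambda>(x, a). frag_of (x, b \<otimes>\<^bsub>A\<^esub> a))"

lemma phi_closed [simp, intro]: "r \<in> carrier R \<Longrightarrow> \<phi> r \<in> carrier A"
  using hom ring_hom_closed by metis

lemma keys_diff_subset: "Poly_Mapping.keys x \<subseteq> V \<Longrightarrow> Poly_Mapping.keys y \<subseteq> V \<Longrightarrow>
    Poly_Mapping.keys (x - y :: _ \<Rightarrow>\<^sub>0 int) \<subseteq> V"
  using keys_diff[of x y] by blast

lemma keys_add_subset: "Poly_Mapping.keys x \<subseteq> V \<Longrightarrow> Poly_Mapping.keys y \<subseteq> V \<Longrightarrow>
    Poly_Mapping.keys (x + y :: _ \<Rightarrow>\<^sub>0 int) \<subseteq> V"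
  using keys_add[of x y] by blast

lemma relations_subset: "tensor_relations R A \<phi> M \<subseteq> carrier F"
  unfolding tensor_relations_def
  by (intro Un_least subsetI; elim CollectE exE conjE;
      simp only: carrier_free_Abelian_group_iff; intro keys_diff_subset; simp)

lemma F_group: "comm_group F"
  by (rule abelian_free_Abelian_group)

lemma K_subgroup: "subgroup K F"
  unfolding K_def by (rule group.generate_is_subgroup[OF group_free_Abelian_group relations_subset])

lemma K_normal: "K \<lhd> F"
  by (rule comm_group.subgroup_imp_normal[OF F_group K_subgroup])

lemma K_keys: "z \<in> K \<Longrightarrow> Poly_Mapping.keys z \<subseteq> carrier M \<times> carrier A"
  using subsetD[OF subgroup.subset[OF K_subgroup]] by simp

lemma zero_in_K: "0 \<in> K"
  using subgroup.one_closed[OF K_subgroup] by simp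

lemma K_add: "z \<in> K \<Longrightarrow> w \<in> K \<Longrightarrow> z + w \<in> K"
  using subgroup.m_closed[OF K_subgroup] by fastforce

lemma K_neg: "z \<in> K \<Longrightarrow> - z \<in> K"
  using subgroup.m_inv_closed[OF K_subgroup] K_keys by fastforce

lemma K_diff: "z \<in> K \<Longrightarrow> w \<in> K \<Longrightarrow> z - w \<in> K"
  using K_add[of z "- w"] K_neg by simp

lemma cls_alt: "cls z = {k + z | k. k \<in> K}"
  by (auto simp: cls_def r_coset_def)

lemma cls_eq_iff: "cls z = cls w \<longleftrightarrow> z - w \<in> K"
proof
  assume "cls z = cls w"
  moreover have "z \<in> cls z" using zero_in_K unfolding cls_alt by force
  ultimately obtain k where "k \<in> K" "z = k + w" unfolding cls_alt by auto
  then show "z - w \<in> K" by simp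
next
  assume d: "z - w \<in> K"
  have "k + z \<in> cls w" if "k \<in> K" for k
    unfolding cls_alt using K_add[OF that d] by (auto intro!: exI[of _ "k + (z - w)"])
  moreover have "k + w \<in> cls z" if "k \<in> K" for k
    unfolding cls_alt using K_diff[OF that d] by (auto intro!: exI[of _ "k - (z - w)"])
  ultimately show "cls z = cls w" unfolding cls_alt by blast
qed

lemma T_carrier: "carrier T = cls ` {z. Poly_Mapping.keys z \<subseteq> carrier M \<times> carrier A}"
  by (auto simp: base_change_def Let_def FactGroup_def RCOSETS_def cls_def K_def)

lemma cls_closed [intro]: "Poly_Mapping.keys z \<subseteq> carrier M \<times> carrier A \<Longrightarrow> cls z \<in> carrier T"
  unfolding T_carrier by auto

lemma T_zero: "\<zero>\<^bsub>T\<^esub> = cls 0"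
  by (simp add: base_change_def Let_def FactGroup_def cls_alt K_def)

lemma T_add:
  assumes "Poly_Mapping.keys z \<subseteq> carrier M \<times> carrier A" "Poly_Mapping.keys w \<subseteq> carrier M \<times> carrier A"
  shows "cls z \<oplus>\<^bsub>T\<^esub> cls w = cls (z + w)"
proof -
  have "cls z <#>\<^bsub>F\<^esub> cls w = cls (z + w)"
    using normal.rcos_sum[OF K_normal, of z w] assms unfolding cls_def by simp
  then show ?thesis by (simp add: base_change_def Let_def FactGroup_def)
qed

lemma scale_add: "scale b (z + w) = scale b z + scale b w"
  by (simp add: scale_def frag_extend_add)

lemma scale_diff: "scale b (z - w) = scale b z - scale b w"
  by (simp add: scale_def frag_extend_diff)

lemma scale_zero [simp]: "scale b 0 = 0"
  by (simp add: scale_def)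

lemma scale_neg: "scale b (- z) = - scale b z"
  using scale_diff[of b 0 z] by simp

lemma scale_of [simp]: "scale b (frag_of (x, a)) = frag_of (x, b \<otimes>\<^bsub>A\<^esub> a)"
  by (simp add: scale_def)

lemma scale_keys:
  assumes b: "b \<in> carrier A"
  shows "Poly_Mapping.keys z \<subseteq> carrier M \<times> carrier A \<Longrightarrow>
    Poly_Mapping.keys (scale b z) \<subseteq> carrier M \<times> carrier A"
proof (rule free_Abelian_group_induct[where S = "carrier M \<times> carrier A" and x = z])
  show "Poly_Mapping.keys (scale b (frag_of p)) \<subseteq> carrier M \<times> carrier A"
    if "p \<in> carrier M \<times> carrier A" for p
    using that b by (cases p) auto
  show "Poly_Mapping.keys (scale b (x - y)) \<subseteq> carrier M \<times> carrier A"
    if "Poly_Mapping.keys (scale b x) \<subseteq> carrier M \<times> carrier A"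
      "Poly_Mapping.keys (scale b y) \<subseteq> carrier M \<times> carrier A" for x y
    unfolding scale_diff by (rule keys_diff_subset[OF that])
qed auto

lemma scale_relations:
  assumes b: "b \<in> carrier A" and z: "z \<in> tensor_relations R A \<phi> M"
  shows "scale b z \<in> tensor_relations R A \<phi> M"
proof -
  consider (1) x y a where "z = frag_of (x \<oplus>\<^bsub>M\<^esub> y, a) - frag_of (x, a) - frag_of (y, a)"
      "x \<in> carrier M" "y \<in> carrier M" "a \<in> carrier A"
    | (2) x a c where "z = frag_of (x, a \<oplus>\<^bsub>A\<^esub> c) - frag_of (x, a) - frag_of (x, c)"
      "x \<in> carrier M" "a \<in> carrier A" "c \<in> carrier A"
    | (3) r x a where "z = frag_of (r \<odot>\<^bsub>M\<^esub> x, a) - frag_of (x, \<phi> r \<otimes>\<^bsub>A\<^esub> a)"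
      "r \<in> carrier R" "x \<in> carrier M" "a \<in> carrier A"
    using z unfolding tensor_relations_def by blast
  then show ?thesis
  proof cases
    case 1
    then have "scale b z = frag_of (x \<oplus>\<^bsub>M\<^esub> y, b \<otimes>\<^bsub>A\<^esub> a) - frag_of (x, b \<otimes>\<^bsub>A\<^esub> a) - frag_of (y, b \<otimes>\<^bsub>A\<^esub> a)"
      by (simp add: scale_diff)
    then show ?thesis unfolding tensor_relations_def using 1 b by blast
  next
    case 2
    then have "scale b z = frag_of (x, b \<otimes>\<^bsub>A\<^esub> a \<oplus>\<^bsub>A\<^esub> b \<otimes>\<^bsub>A\<^esub> c) - frag_of (x, b \<otimes>\<^bsub>A\<^esub> a) - frag_of (x, b \<otimes>\<^bsub>A\<^esub> c)"
      using b by (simp add: scale_diff A.r_distr)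
    then show ?thesis unfolding tensor_relations_def using 2 b by blast
  next
    case 3
    then have "scale b z = frag_of (r \<odot>\<^bsub>M\<^esub> x, b \<otimes>\<^bsub>A\<^esub> a) - frag_of (x, \<phi> r \<otimes>\<^bsub>A\<^esub> (b \<otimes>\<^bsub>A\<^esub> a))"
      using b by (simp add: scale_diff A.m_lcomm)
    then show ?thesis unfolding tensor_relations_def using 3 b by blast
  qed
qed

lemma scale_K:
  assumes b: "b \<in> carrier A" and z: "z \<in> K"
  shows "scale b z \<in> K"
  using z unfolding K_def
proof (induction rule: generate.induct)
  case one
  then show ?case using zero_in_K by (simp add: K_def)
next
  case (incl h)
  then show ?case using scale_relations[OF b] generate.incl by metis
next
  case (inv h)
  have "h \<in> K" unfolding K_def using inv generate.incl by metis
  then have "inv\<^bsub>F\<^esub> h = - h" using K_keys by simp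
  moreover have "scale b h \<in> K" unfolding K_def using inv scale_relations[OF b] generate.incl by metis
  ultimately show ?case using K_neg by (simp add: scale_neg K_def)
next
  case (eng h1 h2)
  then show ?case using K_add by (simp add: scale_add K_def)
qed

lemma T_smult:
  assumes b: "b \<in> carrier A" and z: "Poly_Mapping.keys z \<subseteq> carrier M \<times> carrier A"
  shows "b \<odot>\<^bsub>T\<^esub> cls z = cls (scale b z)"
proof -
  have "b \<odot>\<^bsub>T\<^esub> cls z = (\<Union>z'\<in>cls z. cls (scale b z'))"
    by (simp add: base_change_def Let_def cls_def K_def scale_def)
  moreover have "cls (scale b z') = cls (scale b z)" if z': "z' \<in> cls z" for z'
    using z' scale_K[OF b] unfolding cls_eq_iff unfolding cls_alt by (auto simp: scale_add)
  moreover have "z \<in> cls z" using zero_in_K unfolding cls_alt by force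
  ultimately show ?thesis by blast
qed

lemma T_abelian_group: "abelian_group T"
proof (rule abelian_groupI)
  fix u v assume "u \<in> carrier T" "v \<in> carrier T"
  then obtain z w where zw: "Poly_Mapping.keys z \<subseteq> carrier M \<times> carrier A" "u = cls z"
      "Poly_Mapping.keys w \<subseteq> carrier M \<times> carrier A" "v = cls w" unfolding T_carrier by auto
  have zw': "Poly_Mapping.keys (z + w) \<subseteq> carrier M \<times> carrier A" by (rule keys_add_subset[OF zw(1,3)])
  then show "u \<oplus>\<^bsub>T\<^esub> v \<in> carrier T" using zw by (auto simp: T_add)
  show "u \<oplus>\<^bsub>T\<^esub> v = v \<oplus>\<^bsub>T\<^esub> u" using zw by (simp add: T_add add.commute)
  fix t assume "t \<in> carrier T"
  then obtain y where y: "Poly_Mapping.keys y \<subseteq> carrier M \<times> carrier A" "t = cls y"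
    unfolding T_carrier by auto
  have "Poly_Mapping.keys (w + y) \<subseteq> carrier M \<times> carrier A" by (rule keys_add_subset[OF zw(3) y(1)])
  then show "u \<oplus>\<^bsub>T\<^esub> v \<oplus>\<^bsub>T\<^esub> t = u \<oplus>\<^bsub>T\<^esub> (v \<oplus>\<^bsub>T\<^esub> t)" using zw zw' y by (simp add: T_add add.assoc)
next
  show "\<zero>\<^bsub>T\<^esub> \<in> carrier T" unfolding T_zero by (rule cls_closed) simp
next
  fix u assume "u \<in> carrier T"
  then obtain z where z: "Poly_Mapping.keys z \<subseteq> carrier M \<times> carrier A" "u = cls z"
    unfolding T_carrier by auto
  then show "\<zero>\<^bsub>T\<^esub> \<oplus>\<^bsub>T\<^esub> u = u" by (simp add: T_zero T_add)
  have "cls (- z) \<oplus>\<^bsub>T\<^esub> u = \<zero>\<^bsub>T\<^esub>" using z by (simp add: T_zero T_add)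
  moreover have "cls (- z) \<in> carrier T" by (rule cls_closed) (use z in simp)
  ultimately show "\<exists>y\<in>carrier T. y \<oplus>\<^bsub>T\<^esub> u = \<zero>\<^bsub>T\<^esub>" by blast
qed

lemma tensor_closed [simp, intro]: "x \<in> carrier M \<Longrightarrow> a \<in> carrier A \<Longrightarrow> tensor x a \<in> carrier T"
  unfolding tensor_def by (rule cls_closed) simp

lemma cls_frag_diff:
  assumes "frag_of p - frag_of q - frag_of q' \<in> K"
    "p \<in> carrier M \<times> carrier A" "q \<in> carrier M \<times> carrier A" "q' \<in> carrier M \<times> carrier A"
  shows "cls (frag_of p) = cls (frag_of q) \<oplus>\<^bsub>T\<^esub> cls (frag_of q')"
  using assms by (subst T_add) (auto simp: cls_eq_iff diff_diff_eq)

lemma relation_in_K: "z \<in> tensor_relations R A \<phi> M \<Longrightarrow> z \<in> K"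
  unfolding K_def by (rule generate.incl)

lemma tensor_add_left:
  "x \<in> carrier M \<Longrightarrow> y \<in> carrier M \<Longrightarrow> a \<in> carrier A \<Longrightarrow>
    tensor (x \<oplus>\<^bsub>M\<^esub> y) a = tensor x a \<oplus>\<^bsub>T\<^esub> tensor y a"
  unfolding tensor_def
  by (rule cls_frag_diff, rule relation_in_K) (auto simp: tensor_relations_def)

lemma tensor_add_right:
  "x \<in> carrier M \<Longrightarrow> a \<in> carrier A \<Longrightarrow> b \<in> carrier A \<Longrightarrow>
    tensor x (a \<oplus>\<^bsub>A\<^esub> b) = tensor x a \<oplus>\<^bsub>T\<^esub> tensor x b"
  unfolding tensor_def
  by (rule cls_frag_diff, rule relation_in_K) (auto simp: tensor_relations_def)

lemma tensor_smult_left: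
  "r \<in> carrier R \<Longrightarrow> x \<in> carrier M \<Longrightarrow> a \<in> carrier A \<Longrightarrow>
    tensor (r \<odot>\<^bsub>M\<^esub> x) a = tensor x (\<phi> r \<otimes>\<^bsub>A\<^esub> a)"
  unfolding tensor_def cls_eq_iff
  by (rule relation_in_K) (auto simp: tensor_relations_def)

lemma smult_tensor:
  "x \<in> carrier M \<Longrightarrow> a \<in> carrier A \<Longrightarrow> b \<in> carrier A \<Longrightarrow> b \<odot>\<^bsub>T\<^esub> tensor x a = tensor x (b \<otimes>\<^bsub>A\<^esub> a)"
  unfolding tensor_def by (subst T_smult) auto

lemma T_induct [consumes 1, case_names zero diff tensor]:
  assumes w: "w \<in> carrier T" and zero: "P \<zero>\<^bsub>T\<^esub>"
    and diff: "\<And>u v. u \<in> carrier T \<Longrightarrow> v \<in> carrier T \<Longrightarrow> P u \<Longrightarrow> P v \<Longrightarrow> P (u \<ominus>\<^bsub>T\<^esub> v)"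
    and tensor: "\<And>x a. x \<in> carrier M \<Longrightarrow> a \<in> carrier A \<Longrightarrow> P (tensor x a)"
  shows "P w"
proof -
  interpret T: abelian_group T by (rule T_abelian_group)
  obtain z where z: "Poly_Mapping.keys z \<subseteq> carrier M \<times> carrier A" "w = cls z"
    using w unfolding T_carrier by auto
  have "P (cls z)" using z(1)
  proof (rule free_Abelian_group_induct)
    show "P (cls 0)" using zero by (simp add: T_zero)
    show "P (cls (frag_of p))" if "p \<in> carrier M \<times> carrier A" for p
      using that tensor unfolding tensor_def by (cases p) auto
    fix x y assume xy: "Poly_Mapping.keys x \<subseteq> carrier M \<times> carrier A"
      "Poly_Mapping.keys y \<subseteq> carrier M \<times> carrier A" "P (cls x)" "P (cls y)"
    have c: "cls x \<in> carrier T" "cls y \<in> carrier T" "cls (x - y) \<in> carrier T"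
      using xy keys_diff_subset[OF xy(1,2)] by auto
    have "cls (x - y) \<oplus>\<^bsub>T\<^esub> cls y = cls x"
      using xy keys_diff_subset[OF xy(1,2)] by (simp add: T_add)
    then have "cls x \<ominus>\<^bsub>T\<^esub> cls y = cls (x - y)"
      using c by (metis T.add.inv_solve_right T.minus_eq)
    then show "P (cls (x - y))" using diff[OF c(1,2) xy(3,4)] by simp
  qed
  then show ?thesis using z by simp
qed

lemma T_smult_add:
  assumes "b \<in> carrier A" "u \<in> carrier T" "v \<in> carrier T"
  shows "b \<odot>\<^bsub>T\<^esub> (u \<oplus>\<^bsub>T\<^esub> v) = b \<odot>\<^bsub>T\<^esub> u \<oplus>\<^bsub>T\<^esub> b \<odot>\<^bsub>T\<^esub> v"
proof -
  obtain z w where zw: "Poly_Mapping.keys z \<subseteq> carrier M \<times> carrier A" "u = cls z"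
      "Poly_Mapping.keys w \<subseteq> carrier M \<times> carrier A" "v = cls w" using assms unfolding T_carrier by auto
  have "Poly_Mapping.keys (z + w) \<subseteq> carrier M \<times> carrier A" by (rule keys_add_subset[OF zw(1,3)])
  then show ?thesis using zw assms(1) scale_keys[OF assms(1)] by (simp add: T_add T_smult scale_add)
qed

lemma T_smult_closed: "b \<in> carrier A \<Longrightarrow> u \<in> carrier T \<Longrightarrow> b \<odot>\<^bsub>T\<^esub> u \<in> carrier T"
  unfolding T_carrier using T_smult scale_keys by fastforce

lemma T_module: "module A T"
proof (rule moduleI)
  interpret T: abelian_group T by (rule T_abelian_group)
  show "cring A" by (rule A.is_cring)
  show "abelian_group T" by (rule T_abelian_group)
  have zero: "b \<odot>\<^bsub>T\<^esub> \<zero>\<^bsub>T\<^esub> = \<zero>\<^bsub>T\<^esub>" if "b \<in> carrier A" for b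
    using that by (simp add: T_zero T_smult)
  have diff: "b \<odot>\<^bsub>T\<^esub> (u \<ominus>\<^bsub>T\<^esub> v) = b \<odot>\<^bsub>T\<^esub> u \<ominus>\<^bsub>T\<^esub> b \<odot>\<^bsub>T\<^esub> v"
    if c: "b \<in> carrier A" "u \<in> carrier T" "v \<in> carrier T" for b u v
  proof -
    have "b \<odot>\<^bsub>T\<^esub> (u \<ominus>\<^bsub>T\<^esub> v) \<oplus>\<^bsub>T\<^esub> b \<odot>\<^bsub>T\<^esub> v = b \<odot>\<^bsub>T\<^esub> u"
      using c T_smult_add[of b "u \<ominus>\<^bsub>T\<^esub> v" v] by (simp add: T.minus_eq T.a_assoc T.l_neg)
    then show ?thesis using c T_smult_closed
      by (metis T.add.inv_solve_right T.minus_closed T.minus_eq)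
  qed
  show "b \<odot>\<^bsub>T\<^esub> u \<in> carrier T" if "b \<in> carrier A" "u \<in> carrier T" for b u
    using T_smult_closed that .
  show "b \<odot>\<^bsub>T\<^esub> (u \<oplus>\<^bsub>T\<^esub> v) = b \<odot>\<^bsub>T\<^esub> u \<oplus>\<^bsub>T\<^esub> b \<odot>\<^bsub>T\<^esub> v"
    if "b \<in> carrier A" "u \<in> carrier T" "v \<in> carrier T" for b u v using T_smult_add that .
  have swap: "(p \<ominus>\<^bsub>T\<^esub> q) \<oplus>\<^bsub>T\<^esub> (p' \<ominus>\<^bsub>T\<^esub> q') = (p \<oplus>\<^bsub>T\<^esub> p') \<ominus>\<^bsub>T\<^esub> (q \<oplus>\<^bsub>T\<^esub> q')"
    if "p \<in> carrier T" "q \<in> carrier T" "p' \<in> carrier T" "q' \<in> carrier T" for p q p' q'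
    using that by (simp add: T.minus_eq T.minus_add T.a_ac)
  show "(b \<oplus>\<^bsub>A\<^esub> c) \<odot>\<^bsub>T\<^esub> u = b \<odot>\<^bsub>T\<^esub> u \<oplus>\<^bsub>T\<^esub> c \<odot>\<^bsub>T\<^esub> u"
    if bc: "b \<in> carrier A" "c \<in> carrier A" and u: "u \<in> carrier T" for b c u
    using u
  proof (induction rule: T_induct)
    case (diff u v)
    then show ?case using bc T_smult_closed \<open>\<And>v u b. _ \<Longrightarrow> _ \<Longrightarrow> _ \<Longrightarrow> b \<odot>\<^bsub>T\<^esub> (u \<ominus>\<^bsub>T\<^esub> v) = _\<close>
      by (simp add: swap)
  qed (use bc in \<open>simp_all add: zero smult_tensor A.l_distr tensor_add_right\<close>)
  show "(b \<otimes>\<^bsub>A\<^esub> c) \<odot>\<^bsub>T\<^esub> u = b \<odot>\<^bsub>T\<^esub> (c \<odot>\<^bsub>T\<^esub> u)"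
    if bc: "b \<in> carrier A" "c \<in> carrier A" and u: "u \<in> carrier T" for b c u
    using u
  proof (induction rule: T_induct)
    case (diff u v)
    then show ?case using bc T_smult_closed \<open>\<And>v u b. _ \<Longrightarrow> _ \<Longrightarrow> _ \<Longrightarrow> b \<odot>\<^bsub>T\<^esub> (u \<ominus>\<^bsub>T\<^esub> v) = _\<close>
      by simp
  qed (use bc in \<open>simp_all add: zero smult_tensor A.m_assoc\<close>)
  show "\<one>\<^bsub>A\<^esub> \<odot>\<^bsub>T\<^esub> u = u" if u: "u \<in> carrier T" for u
    using u
  proof (induction rule: T_induct)
    case (diff u v)
    then show ?case using \<open>\<And>v u b. _ \<Longrightarrow> _ \<Longrightarrow> _ \<Longrightarrow> b \<odot>\<^bsub>T\<^esub> (u \<ominus>\<^bsub>T\<^esub> v) = _\<close> by simp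
  qed (simp_all add: zero smult_tensor)
qed

text \<open>The values \<open>\<beta> x a\<close> extend to the free abelian group on the pairs \<open>(x, a)\<close>, and the extension kills the
  relations.\<close>

theorem tensor_universal:
  assumes G: "abelian_group G"
    and closed: "\<And>x a. x \<in> carrier M \<Longrightarrow> a \<in> carrier A \<Longrightarrow> \<beta> x a \<in> carrier G"
    and add_left: "\<And>x y a. x \<in> carrier M \<Longrightarrow> y \<in> carrier M \<Longrightarrow> a \<in> carrier A \<Longrightarrow>
      \<beta> (x \<oplus>\<^bsub>M\<^esub> y) a = \<beta> x a \<oplus>\<^bsub>G\<^esub> \<beta> y a"
    and add_right: "\<And>x a b. x \<in> carrier M \<Longrightarrow> a \<in> carrier A \<Longrightarrow> b \<in> carrier A \<Longrightarrow>
      \<beta> x (a \<oplus>\<^bsub>A\<^esub> b) = \<beta> x a \<oplus>\<^bsub>G\<^esub> \<beta> x b"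
    and balanced: "\<And>r x a. r \<in> carrier R \<Longrightarrow> x \<in> carrier M \<Longrightarrow> a \<in> carrier A \<Longrightarrow>
      \<beta> (r \<odot>\<^bsub>M\<^esub> x) a = \<beta> x (\<phi> r \<otimes>\<^bsub>A\<^esub> a)"
  obtains h where "h \<in> carrier T \<rightarrow> carrier G"
    "\<forall>u\<in>carrier T. \<forall>v\<in>carrier T. h (u \<oplus>\<^bsub>T\<^esub> v) = h u \<oplus>\<^bsub>G\<^esub> h v"
    "\<forall>x\<in>carrier M. \<forall>a\<in>carrier A. h (tensor x a) = \<beta> x a"
proof -
  interpret G: abelian_group G by fact
  obtain h0 where h0: "h0 \<in> hom F (add_monoid G)"
      "\<And>p. p \<in> carrier M \<times> carrier A \<Longrightarrow> h0 (frag_of p) = (\<lambda>(x, a). \<beta> x a) p"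
    by (rule comm_group.free_Abelian_group_universal[OF G.a_comm_group, of "\<lambda>(x, a). \<beta> x a" "carrier M \<times> carrier A"])
       (use closed in auto)
  have h0c: "h0 z \<in> carrier G" if "Poly_Mapping.keys z \<subseteq> carrier M \<times> carrier A" for z
    using h0(1) that unfolding hom_def by auto
  have h0_add: "h0 (z + w) = h0 z \<oplus>\<^bsub>G\<^esub> h0 w"
    if "Poly_Mapping.keys z \<subseteq> carrier M \<times> carrier A" "Poly_Mapping.keys w \<subseteq> carrier M \<times> carrier A" for z w
    using h0(1) that unfolding hom_def by auto
  have h0_zero: "h0 0 = \<zero>\<^bsub>G\<^esub>"
    using h0_add[of 0 0] h0c[of 0] by (simp add: G.add.l_cancel_one')
  have h0_diff: "h0 (z - w) = h0 z \<ominus>\<^bsub>G\<^esub> h0 w"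
    if "Poly_Mapping.keys z \<subseteq> carrier M \<times> carrier A" "Poly_Mapping.keys w \<subseteq> carrier M \<times> carrier A" for z w
  proof -
    have "h0 (z - w) \<oplus>\<^bsub>G\<^esub> h0 w = h0 z"
      using h0_add[OF keys_diff_subset[OF that] that(2)] by simp
    then show ?thesis
      using h0c[OF that(1)] h0c[OF that(2)] h0c[OF keys_diff_subset[OF that]] by (metis G.add.inv_solve_right G.minus_eq)
  qed
  have cancel: "p \<oplus>\<^bsub>G\<^esub> q \<oplus>\<^bsub>G\<^esub> \<ominus>\<^bsub>G\<^esub> p \<oplus>\<^bsub>G\<^esub> \<ominus>\<^bsub>G\<^esub> q = \<zero>\<^bsub>G\<^esub>" if "p \<in> carrier G" "q \<in> carrier G" for p q
  proof -
    have "p \<oplus>\<^bsub>G\<^esub> q \<oplus>\<^bsub>G\<^esub> \<ominus>\<^bsub>G\<^esub> p \<oplus>\<^bsub>G\<^esub> \<ominus>\<^bsub>G\<^esub> q = (p \<oplus>\<^bsub>G\<^esub> q) \<oplus>\<^bsub>G\<^esub> \<ominus>\<^bsub>G\<^esub> (p \<oplus>\<^bsub>G\<^esub> q)"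
      using that by (simp add: G.minus_add G.a_assoc)
    then show ?thesis using that by (simp add: G.r_neg)
  qed
  have h0_rel: "h0 z = \<zero>\<^bsub>G\<^esub>" if z: "z \<in> tensor_relations R A \<phi> M" for z
    using z closed unfolding tensor_relations_def
    by (elim UnE CollectE exE conjE)
       (simp_all add: h0_diff h0(2) keys_diff_subset add_left add_right balanced cancel G.minus_eq G.r_neg)
  have h0_K: "h0 z = \<zero>\<^bsub>G\<^esub>" if "z \<in> K" for z
    using that unfolding K_def
  proof (induction rule: generate.induct)
    case one
    then show ?case using h0_zero by simp
  next
    case (incl h)
    then show ?case by (rule h0_rel)
  next
    case (inv h)
    then have k: "Poly_Mapping.keys h \<subseteq> carrier M \<times> carrier A"
      using K_keys relation_in_K by blast
    then have "h0 (- h) = h0 0 \<ominus>\<^bsub>G\<^esub> h0 h" using h0_diff[of 0 h] by simp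
    then show ?case using k h0_rel[OF inv] h0_zero by (simp add: G.minus_eq)
  next
    case (eng h1 h2)
    then have "Poly_Mapping.keys h1 \<subseteq> carrier M \<times> carrier A" "Poly_Mapping.keys h2 \<subseteq> carrier M \<times> carrier A"
      using K_keys unfolding K_def by auto
    then show ?case using h0_add eng by simp
  qed
  define h where "h = (\<lambda>u. h0 (SOME z. Poly_Mapping.keys z \<subseteq> carrier M \<times> carrier A \<and> u = cls z))"
  have h: "h (cls z) = h0 z" if z: "Poly_Mapping.keys z \<subseteq> carrier M \<times> carrier A" for z
  proof -
    define w where "w = (SOME w. Poly_Mapping.keys w \<subseteq> carrier M \<times> carrier A \<and> cls z = cls w)"
    have w: "Poly_Mapping.keys w \<subseteq> carrier M \<times> carrier A" "cls z = cls w"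
      unfolding w_def by (rule someI2[of _ z]; use z in simp)+
    then have "h0 z \<ominus>\<^bsub>G\<^esub> h0 w = \<zero>\<^bsub>G\<^esub>" using h0_diff[OF z w(1)] h0_K cls_eq_iff by auto
    moreover have "h0 z = (h0 z \<ominus>\<^bsub>G\<^esub> h0 w) \<oplus>\<^bsub>G\<^esub> h0 w"
      using h0c[OF z] h0c[OF w(1)] by (simp add: G.minus_eq G.a_assoc G.l_neg)
    ultimately have "h0 z = h0 w" using h0c[OF w(1)] by simp
    then show ?thesis unfolding h_def w_def by simp
  qed
  show thesis
  proof (rule that; (intro ballI)?)
    show "h \<in> carrier T \<rightarrow> carrier G" unfolding T_carrier using h h0c by auto
    show "h (u \<oplus>\<^bsub>T\<^esub> v) = h u \<oplus>\<^bsub>G\<^esub> h v" if uv: "u \<in> carrier T" "v \<in> carrier T" for u v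
    proof -
      obtain z w where zw: "Poly_Mapping.keys z \<subseteq> carrier M \<times> carrier A" "u = cls z"
          "Poly_Mapping.keys w \<subseteq> carrier M \<times> carrier A" "v = cls w" using uv unfolding T_carrier by auto
      have "Poly_Mapping.keys (z + w) \<subseteq> carrier M \<times> carrier A" by (rule keys_add_subset[OF zw(1,3)])
      then show ?thesis using zw by (simp add: T_add h h0_add)
    qed
    show "h (tensor x a) = \<beta> x a" if "x \<in> carrier M" "a \<in> carrier A" for x a
      unfolding tensor_def using that by (subst h) (simp_all add: h0(2))
  qed
qed

lemma tensor_zero_left: "a \<in> carrier A \<Longrightarrow> tensor \<zero>\<^bsub>M\<^esub> a = \<zero>\<^bsub>T\<^esub>"
proof -
  assume a: "a \<in> carrier A"
  interpret T: abelian_group T by (rule T_abelian_group)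
  have "tensor \<zero>\<^bsub>M\<^esub> a = tensor \<zero>\<^bsub>M\<^esub> a \<oplus>\<^bsub>T\<^esub> tensor \<zero>\<^bsub>M\<^esub> a"
    using tensor_add_left[of "\<zero>\<^bsub>M\<^esub>" "\<zero>\<^bsub>M\<^esub>" a] a by simp
  then show ?thesis using a T.add.l_cancel_one'[of "tensor \<zero>\<^bsub>M\<^esub> a" "tensor \<zero>\<^bsub>M\<^esub> a"] by simp
qed

lemma tensor_diff_left:
  assumes "x \<in> carrier M" "y \<in> carrier M" "a \<in> carrier A"
  shows "tensor (x \<ominus>\<^bsub>M\<^esub> y) a = tensor x a \<ominus>\<^bsub>T\<^esub> tensor y a"
proof -
  interpret T: abelian_group T by (rule T_abelian_group)
  have "tensor (x \<ominus>\<^bsub>M\<^esub> y) a \<oplus>\<^bsub>T\<^esub> tensor y a = tensor x a"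
    using tensor_add_left[of "x \<ominus>\<^bsub>M\<^esub> y" y a] assms
    by (simp add: M.minus_eq M.a_assoc M.l_neg)
  then show ?thesis using assms
    by (metis M.minus_closed T.add.inv_solve_right T.minus_eq tensor_closed)
qed

lemma tensor_lincomb:
  assumes b: "b \<in> carrier A"
  shows "set cs \<subseteq> carrier R \<Longrightarrow> set ms \<subseteq> carrier M \<Longrightarrow>
    tensor (lincomb M cs ms) b =
      lincomb T (map (\<lambda>c. \<phi> c \<otimes>\<^bsub>A\<^esub> b) cs) (map (\<lambda>m. tensor m \<one>\<^bsub>A\<^esub>) ms)"
proof (induction cs ms rule: list_induct2')
  case (4 c cs m ms)
  then have c: "c \<in> carrier R" "m \<in> carrier M" "lincomb M cs ms \<in> carrier M" by auto
  then have "tensor (c \<odot>\<^bsub>M\<^esub> m) b = (\<phi> c \<otimes>\<^bsub>A\<^esub> b) \<odot>\<^bsub>T\<^esub> tensor m \<one>\<^bsub>A\<^esub>"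
    using b by (simp add: tensor_smult_left smult_tensor)
  then show ?case using 4 c b by (simp add: tensor_add_left)
qed (use tensor_zero_left[OF b] in auto)

end


section \<open>Local generators and local bases\<close>

text \<open>Generation of the localisation at \<open>I\<close> by \<open>n\<close> elements, expressed inside \<open>M\<close>: a single denominator
  \<open>u\<close> serves for all of \<open>M\<close>. For finitely generated \<open>M\<close> this is no restriction.\<close>

definition locally_generated ::
  "('a, 'r) ring_scheme \<Rightarrow> 'a set \<Rightarrow> ('a, 'm, 'k) module_scheme \<Rightarrow> nat \<Rightarrow> bool" where
  "locally_generated R I M n \<longleftrightarrow>
    (\<exists>ms u. length ms = n \<and> set ms \<subseteq> carrier M \<and> u \<in> carrier R - I \<and>
      (\<forall>x\<in>carrier M. u \<odot>\<^bsub>M\<^esub> x \<in> combinations M (carrier R) ms))"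

definition lin_independent :: "('a, 'r) ring_scheme \<Rightarrow> ('a, 'm, 'k) module_scheme \<Rightarrow> 'm list \<Rightarrow> bool" where
  "lin_independent R M ms \<longleftrightarrow> set ms \<subseteq> carrier M \<and>
    (\<forall>cs. length cs = length ms \<and> set cs \<subseteq> carrier R \<and> lincomb M cs ms = \<zero>\<^bsub>M\<^esub> \<longrightarrow> set cs \<subseteq> {\<zero>\<^bsub>R\<^esub>})"

definition locally_free ::
  "('a, 'r) ring_scheme \<Rightarrow> 'a set \<Rightarrow> ('a, 'm, 'k) module_scheme \<Rightarrow> nat \<Rightarrow> bool" where
  "locally_free R I M n \<longleftrightarrow>
    (\<exists>ms u. length ms = n \<and> lin_independent R M ms \<and> u \<in> carrier R - I \<and>
      (\<forall>x\<in>carrier M. u \<odot>\<^bsub>M\<^esub> x \<in> combinations M (carrier R) ms))"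

lemma locally_free_imp_generated: "locally_free R I M n \<Longrightarrow> locally_generated R I M n"
  unfolding locally_free_def locally_generated_def lin_independent_def by metis

lemma (in abelian_group) a_inv_zero: "\<ominus> \<zero> = \<zero>"
  by (metis minus_equality r_zero zero_closed)

context module
begin

lemma lincomb_diff:
  "length cs = length ps \<Longrightarrow> length ds = length ps \<Longrightarrow>
    set cs \<subseteq> carrier R \<Longrightarrow> set ds \<subseteq> carrier R \<Longrightarrow> set ps \<subseteq> carrier M \<Longrightarrow>
    lincomb M (map2 (\<lambda>c d. c \<ominus> d) cs ds) ps = lincomb M cs ps \<ominus>\<^bsub>M\<^esub> lincomb M ds ps"
proof (induction ps arbitrary: cs ds)
  case Nil
  then show ?case by (simp add: M.minus_eq M.a_inv_zero)
next
  case (Cons p ps)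
  then obtain c cs' d ds' where "cs = c # cs'" "ds = d # ds'"
    by (metis length_Suc_conv)
  with Cons show ?case
    by (simp add: smult_l_distr smult_l_minus R.minus_eq M.minus_eq M.minus_add M.a_ac)
qed

lemma lin_independent_unique:
  assumes "lin_independent R M ms" and "length cs = length ms" "length ds = length ms"
    "set cs \<subseteq> carrier R" "set ds \<subseteq> carrier R" "lincomb M cs ms = lincomb M ds ms"
  shows "cs = ds"
proof (rule nth_equalityI)
  show "length cs = length ds" using assms by simp
  fix i assume i: "i < length cs"
  have ms: "set ms \<subseteq> carrier M" using assms(1) unfolding lin_independent_def by simp
  let ?zs = "map2 (\<lambda>c d. c \<ominus> d) cs ds"
  have "lincomb M ?zs ms = \<zero>\<^bsub>M\<^esub>"
    using lincomb_diff[OF assms(2,3,4,5) ms] assms(5,6) ms by (simp add: M.minus_eq M.r_neg)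
  moreover have "set ?zs \<subseteq> carrier R"
    using assms(4,5) by (force dest: set_zip_leftD set_zip_rightD)
  moreover have "length ?zs = length ms" using assms by simp
  ultimately have "set ?zs \<subseteq> {\<zero>}"
    using spec[OF conjunct2[OF assms(1)[unfolded lin_independent_def]], of ?zs] by (simp only: simp_thms)
  then have "?zs ! i = \<zero>" using i assms(2,3) nth_mem[of i ?zs] by auto
  then have "cs ! i \<ominus> ds ! i = \<zero>" using i assms(2,3) by simp
  moreover have "cs ! i \<in> carrier R" "ds ! i \<in> carrier R"
    using i assms(2-5) nth_mem[of i cs] nth_mem[of i ds] by auto
  ultimately show "cs ! i = ds ! i" by simp
qed

lemma quotient_abelian_group:
  assumes H: "submodule H R M"
  shows "abelian_group (quotient_module M H)"
proof (rule abelian_groupI)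
  have zero: "\<zero>\<^bsub>quotient_module M H\<^esub> = H +>\<^bsub>M\<^esub> \<zero>\<^bsub>M\<^esub>"
    using submoduleE(1)[OF H] by (simp add: quotient_module_def)
  fix U V assume "U \<in> carrier (quotient_module M H)" "V \<in> carrier (quotient_module M H)"
  then obtain x y where xy: "x \<in> carrier M" "U = H +>\<^bsub>M\<^esub> x" "y \<in> carrier M" "V = H +>\<^bsub>M\<^esub> y"
    unfolding quotient_carrier by auto
  then show "U \<oplus>\<^bsub>quotient_module M H\<^esub> V \<in> carrier (quotient_module M H)"
    unfolding quotient_carrier using quotient_add[OF H] by auto
  show "U \<oplus>\<^bsub>quotient_module M H\<^esub> V = V \<oplus>\<^bsub>quotient_module M H\<^esub> U"
    using xy quotient_add[OF H] by (simp add: M.a_comm)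
  fix W assume "W \<in> carrier (quotient_module M H)"
  then obtain z where "z \<in> carrier M" "W = H +>\<^bsub>M\<^esub> z" unfolding quotient_carrier by auto
  then show "U \<oplus>\<^bsub>quotient_module M H\<^esub> V \<oplus>\<^bsub>quotient_module M H\<^esub> W =
      U \<oplus>\<^bsub>quotient_module M H\<^esub> (V \<oplus>\<^bsub>quotient_module M H\<^esub> W)"
    using xy quotient_add[OF H] by (simp add: M.a_assoc)
next
  have zero: "\<zero>\<^bsub>quotient_module M H\<^esub> = H +>\<^bsub>M\<^esub> \<zero>\<^bsub>M\<^esub>"
    using submoduleE(1)[OF H] by (simp add: quotient_module_def)
  show "\<zero>\<^bsub>quotient_module M H\<^esub> \<in> carrier (quotient_module M H)"
    unfolding zero quotient_carrier by auto
  fix U assume "U \<in> carrier (quotient_module M H)"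
  then obtain x where x: "x \<in> carrier M" "U = H +>\<^bsub>M\<^esub> x" unfolding quotient_carrier by auto
  then show "\<zero>\<^bsub>quotient_module M H\<^esub> \<oplus>\<^bsub>quotient_module M H\<^esub> U = U"
    unfolding zero using quotient_add[OF H] by simp
  have "(H +>\<^bsub>M\<^esub> (\<ominus>\<^bsub>M\<^esub> x)) \<oplus>\<^bsub>quotient_module M H\<^esub> U = \<zero>\<^bsub>quotient_module M H\<^esub>"
    unfolding zero using x quotient_add[OF H] by (simp add: M.l_neg)
  moreover have "H +>\<^bsub>M\<^esub> (\<ominus>\<^bsub>M\<^esub> x) \<in> carrier (quotient_module M H)"
    unfolding quotient_carrier using x by auto
  ultimately show "\<exists>V\<in>carrier (quotient_module M H). V \<oplus>\<^bsub>quotient_module M H\<^esub> U = \<zero>\<^bsub>quotient_module M H\<^esub>"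
    by (rule bexI)
qed

lemma submodule_sum:
  assumes H: "submodule H R M" and K: "submodule K R M"
  defines "L \<equiv> {h \<oplus>\<^bsub>M\<^esub> k | h k. h \<in> H \<and> k \<in> K}"
  shows "submodule L R M" "H \<subseteq> L" "K \<subseteq> L"
proof -
  note Hc = submoduleE[OF H] and Kc = submoduleE[OF K]
  note z = zero_in_submodule[OF H] zero_in_submodule[OF K]
  have LI: "h \<oplus>\<^bsub>M\<^esub> k \<in> L" if "h \<in> H" "k \<in> K" for h k using that unfolding L_def by auto
  show HL: "H \<subseteq> L"
  proof
    fix h assume h: "h \<in> H"
    then have "h \<oplus>\<^bsub>M\<^esub> \<zero>\<^bsub>M\<^esub> \<in> L" by (rule LI[OF _ z(2)])
    then show "h \<in> L" using h Hc(1) by auto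
  qed
  show "K \<subseteq> L"
  proof
    fix k assume k: "k \<in> K"
    then have "\<zero>\<^bsub>M\<^esub> \<oplus>\<^bsub>M\<^esub> k \<in> L" by (rule LI[OF z(1)])
    then show "k \<in> L" using k Kc(1) by auto
  qed
  show "submodule L R M"
  proof (rule submoduleI)
    show "L \<subseteq> carrier M" unfolding L_def using Hc(1) Kc(1) by auto
    show "\<zero>\<^bsub>M\<^esub> \<in> L" using z HL by auto
    show "\<ominus>\<^bsub>M\<^esub> a \<in> L" if aL: "a \<in> L" for a
    proof -
      obtain h k where hk: "h \<in> H" "k \<in> K" "a = h \<oplus>\<^bsub>M\<^esub> k" using aL unfolding L_def by auto
      have "h \<in> carrier M" "k \<in> carrier M" using hk Hc(1) Kc(1) by auto
      then have "\<ominus>\<^bsub>M\<^esub> a = \<ominus>\<^bsub>M\<^esub> h \<oplus>\<^bsub>M\<^esub> \<ominus>\<^bsub>M\<^esub> k" using hk by (simp add: M.minus_add)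
      then show ?thesis using LI[OF Hc(3)[OF hk(1)] Kc(3)[OF hk(2)]] by simp
    qed
    show "a \<oplus>\<^bsub>M\<^esub> b \<in> L" if aL: "a \<in> L" "b \<in> L" for a b
    proof -
      obtain h k where hk: "h \<in> H" "k \<in> K" "a = h \<oplus>\<^bsub>M\<^esub> k" using aL unfolding L_def by auto
      obtain h' k' where hk': "h' \<in> H" "k' \<in> K" "b = h' \<oplus>\<^bsub>M\<^esub> k'" using aL unfolding L_def by auto
      have "h \<in> carrier M" "k \<in> carrier M" "h' \<in> carrier M" "k' \<in> carrier M"
        using hk hk' Hc(1) Kc(1) by auto
      then have "a \<oplus>\<^bsub>M\<^esub> b = (h \<oplus>\<^bsub>M\<^esub> h') \<oplus>\<^bsub>M\<^esub> (k \<oplus>\<^bsub>M\<^esub> k')" using hk hk' by (simp add: M.a_ac)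
      then show ?thesis using LI[OF Hc(5)[OF hk(1) hk'(1)] Kc(5)[OF hk(2) hk'(2)]] by simp
    qed
    show "c \<odot>\<^bsub>M\<^esub> a \<in> L" if c: "c \<in> carrier R" and aL: "a \<in> L" for c a
    proof -
      obtain h k where hk: "h \<in> H" "k \<in> K" "a = h \<oplus>\<^bsub>M\<^esub> k" using aL unfolding L_def by auto
      have "h \<in> carrier M" "k \<in> carrier M" using hk Hc(1) Kc(1) by auto
      then have "c \<odot>\<^bsub>M\<^esub> a = c \<odot>\<^bsub>M\<^esub> h \<oplus>\<^bsub>M\<^esub> c \<odot>\<^bsub>M\<^esub> k" using hk c by (simp add: smult_r_distr)
      then show ?thesis using LI[OF Hc(4)[OF c hk(1)] Kc(4)[OF c hk(2)]] by simp
    qed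
  qed
qed

text \<open>The multiplier in Nakayama's lemma is congruent modulo the prime ideal \<open>I\<close> to a power of \<open>e \<notin> I\<close>,
  so it is itself a denominator at \<open>I\<close>.\<close>

lemma nakayama_at_prime_span:
  assumes I: "primeideal I R"
    and ps: "set ps \<subseteq> carrier M" and ms: "set ms \<subseteq> carrier M" and e: "e \<in> carrier R - I"
    and gen: "\<And>x. x \<in> carrier M \<Longrightarrow> \<exists>h\<in>combinations M (carrier R) ms.
        \<exists>y\<in>combinations M I ps. e \<odot>\<^bsub>M\<^esub> x = h \<oplus>\<^bsub>M\<^esub> y"
  shows "\<exists>v\<in>carrier R - I. \<forall>x\<in>carrier M. v \<odot>\<^bsub>M\<^esub> x \<in> combinations M (carrier R) ms"
proof -
  interpret I: primeideal I R by fact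
  obtain v k where v: "v \<in> carrier R" "v \<ominus> e [^] (k::nat) \<in> I"
      "\<And>x. x \<in> carrier M \<Longrightarrow> v \<odot>\<^bsub>M\<^esub> x \<in> combinations M (carrier R) ms"
    using nakayama[OF I.is_ideal combinations_submodule[OF R.oneideal ms] order_refl ps _ gen] e by auto
  have eR: "e \<in> carrier R" "e \<notin> I" using e by auto
  have ek: "e [^] n \<notin> I" for n :: nat
  proof (induction n)
    case 0
    then show ?case using I.one_imp_carrier I.I_notcarr by auto
  next
    case (Suc n)
    then show ?case using I.I_prime[of "e [^] n" e] eR by auto
  qed
  have "v \<notin> I"
  proof
    assume "v \<in> I"
    then have "v \<oplus> \<ominus> (v \<ominus> e [^] k) \<in> I" using v(2) by auto
    moreover have "v \<oplus> \<ominus> (v \<ominus> e [^] k) = e [^] k"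
    proof -
      define f where "f = e [^] k"
      have f: "f \<in> carrier R" unfolding f_def using eR by auto
      have "v \<oplus> \<ominus> (v \<ominus> f) = f" using v(1) f by algebra
      then show ?thesis unfolding f_def .
    qed
    ultimately show False using ek by simp
  qed
  then show ?thesis using v(1,3) by auto
qed

end


section \<open>Free modules\<close>

lemma free_module_simps [simp]:
  "\<zero>\<^bsub>free_module R Y\<^esub> = (\<lambda>i\<in>Y. \<zero>\<^bsub>R\<^esub>)"
  "f \<oplus>\<^bsub>free_module R Y\<^esub> g = (\<lambda>i\<in>Y. f i \<oplus>\<^bsub>R\<^esub> g i)"
  "r \<odot>\<^bsub>free_module R Y\<^esub> f = (\<lambda>i\<in>Y. r \<otimes>\<^bsub>R\<^esub> f i)"
  by (simp_all add: free_module_def)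

lemma free_module_carrier:
  "finite Y \<Longrightarrow> carrier (free_module R Y) = (Y \<rightarrow>\<^sub>E carrier R)"
  by (auto simp: free_module_def)

lemma (in cring) free_module_is_module:
  assumes "finite Y"
  shows "module R (free_module R Y)"
proof (rule moduleI)
  have mem: "f i \<in> carrier R" if "f \<in> carrier (free_module R Y)" "i \<in> Y" for f i
    using that free_module_carrier[OF assms, of R] by auto
  have ext: "f = g" if "f \<in> carrier (free_module R Y)" "g \<in> carrier (free_module R Y)"
      "\<And>i. i \<in> Y \<Longrightarrow> f i = g i" for f g
    using that PiE_ext[of f Y "\<lambda>_. carrier R" g] free_module_carrier[OF assms, of R] by auto
  have closed: "(\<lambda>i\<in>Y. f i) \<in> carrier (free_module R Y)" if "\<And>i. i \<in> Y \<Longrightarrow> f i \<in> carrier R" for f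
    using that free_module_carrier[OF assms, of R] by auto
  have zero: "\<zero>\<^bsub>free_module R Y\<^esub> \<in> carrier (free_module R Y)"
    unfolding free_module_simps by (rule closed) simp
  have add: "f \<oplus>\<^bsub>free_module R Y\<^esub> g \<in> carrier (free_module R Y)"
    if "f \<in> carrier (free_module R Y)" "g \<in> carrier (free_module R Y)" for f g
    unfolding free_module_simps by (rule closed) (simp add: mem that)
  have smult: "a \<odot>\<^bsub>free_module R Y\<^esub> f \<in> carrier (free_module R Y)"
    if "a \<in> carrier R" "f \<in> carrier (free_module R Y)" for a f
    unfolding free_module_simps by (rule closed) (simp add: mem that)
  show "cring R" by (rule is_cring)
  show "abelian_group (free_module R Y)"
  proof (rule abelian_groupI)
    fix f assume f: "f \<in> carrier (free_module R Y)"
    show "\<zero>\<^bsub>free_module R Y\<^esub> \<oplus>\<^bsub>free_module R Y\<^esub> f = f"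
      by (rule ext[OF add[OF zero f] f]) (simp add: mem[OF f])
    have g: "(\<lambda>i\<in>Y. \<ominus> f i) \<in> carrier (free_module R Y)" by (rule closed) (simp add: mem[OF f])
    have "(\<lambda>i\<in>Y. \<ominus> f i) \<oplus>\<^bsub>free_module R Y\<^esub> f = \<zero>\<^bsub>free_module R Y\<^esub>"
      by (rule ext[OF add[OF g f] zero]) (simp add: mem[OF f] l_neg)
    then show "\<exists>y\<in>carrier (free_module R Y). y \<oplus>\<^bsub>free_module R Y\<^esub> f = \<zero>\<^bsub>free_module R Y\<^esub>"
      by (rule bexI[OF _ g])
    fix g assume g: "g \<in> carrier (free_module R Y)"
    show "f \<oplus>\<^bsub>free_module R Y\<^esub> g = g \<oplus>\<^bsub>free_module R Y\<^esub> f"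
      by (rule ext[OF add[OF f g] add[OF g f]]) (simp add: mem[OF f] mem[OF g] a_comm)
    fix h assume h: "h \<in> carrier (free_module R Y)"
    show "f \<oplus>\<^bsub>free_module R Y\<^esub> g \<oplus>\<^bsub>free_module R Y\<^esub> h =
        f \<oplus>\<^bsub>free_module R Y\<^esub> (g \<oplus>\<^bsub>free_module R Y\<^esub> h)"
      by (rule ext[OF add[OF add[OF f g] h] add[OF f add[OF g h]]])
         (simp add: mem[OF f] mem[OF g] mem[OF h] a_assoc)
  qed (use add zero in auto)
  show "\<one> \<odot>\<^bsub>free_module R Y\<^esub> g = g" if g: "g \<in> carrier (free_module R Y)" for g
    by (rule ext[OF smult[OF one_closed g] g]) (simp add: mem[OF g])
  fix a f assume a: "a \<in> carrier R" and f: "f \<in> carrier (free_module R Y)"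
  show "a \<odot>\<^bsub>free_module R Y\<^esub> f \<in> carrier (free_module R Y)" by (rule smult[OF a f])
  { fix b assume b: "b \<in> carrier R"
    show "(a \<oplus> b) \<odot>\<^bsub>free_module R Y\<^esub> f =
        a \<odot>\<^bsub>free_module R Y\<^esub> f \<oplus>\<^bsub>free_module R Y\<^esub> b \<odot>\<^bsub>free_module R Y\<^esub> f"
      by (rule ext[OF smult[OF _ f] add[OF smult[OF a f] smult[OF b f]]])
         (simp_all add: a b mem[OF f] l_distr)
    show "(a \<otimes> b) \<odot>\<^bsub>free_module R Y\<^esub> f = a \<odot>\<^bsub>free_module R Y\<^esub> (b \<odot>\<^bsub>free_module R Y\<^esub> f)"
      by (rule ext[OF smult[OF _ f] smult[OF a smult[OF b f]]])
         (simp_all add: a b mem[OF f] m_assoc) }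
  fix g assume g: "g \<in> carrier (free_module R Y)"
  show "a \<odot>\<^bsub>free_module R Y\<^esub> (f \<oplus>\<^bsub>free_module R Y\<^esub> g) =
      a \<odot>\<^bsub>free_module R Y\<^esub> f \<oplus>\<^bsub>free_module R Y\<^esub> a \<odot>\<^bsub>free_module R Y\<^esub> g"
    by (rule ext[OF smult[OF a add[OF f g]] add[OF smult[OF a f] smult[OF a g]]])
       (simp add: a mem[OF f] mem[OF g] r_distr)
qed

definition unit_vector :: "('a, 'r) ring_scheme \<Rightarrow> 'i set \<Rightarrow> 'i \<Rightarrow> 'i \<Rightarrow> 'a" where
  "unit_vector R Y x = (\<lambda>i\<in>Y. if i = x then \<one>\<^bsub>R\<^esub> else \<zero>\<^bsub>R\<^esub>)"

lemma (in cring) unit_vector_closed: "finite Y \<Longrightarrow> unit_vector R Y x \<in> carrier (free_module R Y)"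
  unfolding free_module_carrier unit_vector_def by auto

lemma (in cring) lincomb_unit_vectors:
  assumes f: "f \<in> carrier (free_module R (set xs))" and "distinct xs"
  shows "lincomb (free_module R (set xs)) (map f xs) (map (unit_vector R (set xs)) xs) = f"
proof -
  let ?F = "free_module R (set xs)"
  interpret F: module R ?F by (rule free_module_is_module) simp
  have fE: "f \<in> set xs \<rightarrow>\<^sub>E carrier R" using f free_module_carrier[of "set xs" R] by simp
  have fc: "f i \<in> carrier R" if "i \<in> set xs" for i using fE that by auto
  have closed: "lincomb ?F (map f ys) (map (unit_vector R (set xs)) ys) \<in> set xs \<rightarrow>\<^sub>E carrier R"
    if "set ys \<subseteq> set xs" for ys
    unfolding free_module_carrier[OF finite_set, symmetric]
    by (rule F.lincomb_closed) (use that fc unit_vector_closed[OF finite_set] in auto)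
  have at: "lincomb ?F (map f ys) (map (unit_vector R (set xs)) ys) i = (if i \<in> set ys then f i else \<zero>)"
    if "set ys \<subseteq> set xs" "distinct ys" "i \<in> set xs" for ys i
    using that
  proof (induction ys)
    case (Cons y ys)
    then have "f y \<in> carrier R" using fc by auto
    with Cons show ?case using fc[of i] by (auto simp: unit_vector_def)
  qed auto
  show ?thesis
    by (rule extensionalityI[of _ "set xs"]) (use closed[of xs] fE at[of xs] assms(2) in \<open>auto simp: PiE_def\<close>)
qed

lemma mod_hom_zero:
  assumes "module R M" "module R N" "f \<in> mod_hom R M N"
  shows "f \<zero>\<^bsub>M\<^esub> = \<zero>\<^bsub>N\<^esub>"
proof -
  interpret M: module R M by fact
  interpret N: module R N by fact
  have "f \<zero>\<^bsub>M\<^esub> \<in> carrier N" using assms(3) unfolding mod_hom_def by auto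
  moreover have "\<forall>r\<in>carrier R. \<forall>x\<in>carrier M. f (r \<odot>\<^bsub>M\<^esub> x) = r \<odot>\<^bsub>N\<^esub> f x"
    using assms(3) unfolding mod_hom_def by auto
  then have "f (\<zero>\<^bsub>R\<^esub> \<odot>\<^bsub>M\<^esub> \<zero>\<^bsub>M\<^esub>) = \<zero>\<^bsub>R\<^esub> \<odot>\<^bsub>N\<^esub> f \<zero>\<^bsub>M\<^esub>" by (meson M.R.zero_closed M.M.zero_closed)
  ultimately show ?thesis by simp
qed

lemma mod_hom_lincomb:
  assumes "module R M" "module R N" "f \<in> mod_hom R M N"
  shows "set cs \<subseteq> carrier R \<Longrightarrow> set ps \<subseteq> carrier M \<Longrightarrow> f (lincomb M cs ps) = lincomb N cs (map f ps)"
proof (induction cs ps rule: list_induct2')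
  interpret M: module R M by fact
  case (4 c cs p ps)
  then show ?case using assms(3) M.lincomb_closed[of cs ps] unfolding mod_hom_def by auto
qed (use mod_hom_zero[OF assms] in auto)


section \<open>The localisation of a module at a maximal ideal\<close>

locale localised_at = module R M + D: domain R + I: maximalideal I R
  for I and R :: "('a, 'r) ring_scheme" (structure) and M :: "('a, 'm, 'k) module_scheme" (structure)
begin

lemma I_prime: "primeideal I R"
  by (rule R.maximalideal_prime[OF I.is_maximalideal])

lemma one_notin_I [simp]: "\<one> \<notin> I"
  using I.one_imp_carrier I.I_notcarr by auto

sublocale frac: domain_fractions R "carrier R - I"
proof unfold_locales
  show "s \<otimes> t \<in> carrier R - I" if "s \<in> carrier R - I" "t \<in> carrier R - I" for s t
    using that primeideal.I_prime[OF I_prime, of s t] by auto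
qed (use one_notin_I in auto)

abbreviation "A \<equiv> fraction_ring R (carrier R - I)"
abbreviation "fr \<equiv> fraction R (carrier R - I)"

sublocale ext: scalar_extension R M A "\<lambda>r. fr r \<one>"
  by (intro scalar_extension.intro scalar_extension_axioms.intro module_axioms frac.fraction_ring_cring frac.fraction_hom)

abbreviation "T \<equiv> base_change R A (\<lambda>r. fr r \<one>) M"

lemma T_eq: "localised_module R I M = T" and A_eq: "local_ring_at R I = A"
  by (simp_all add: localised_module_def local_ring_at_def)

sublocale T: module A T
  by (rule ext.T_module)

lemma oneA [simp]: "\<one>\<^bsub>A\<^esub> = fr \<one> \<one>"
  by (rule frac.fraction_one)

lemma inverse_mod:
  assumes "s \<in> carrier R - I"
  obtains c where "c \<in> carrier R" "c \<otimes> s \<ominus> \<one> \<in> I"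
proof -
  have s: "s \<in> carrier R" "s \<notin> I" using assms by auto
  note K = R.add_principal_ideal[OF I.is_ideal s(1)]
  have "{j \<oplus> b \<otimes> s | j b. j \<in> I \<and> b \<in> carrier R} = carrier R"
    using I.I_maximal[OF K(1,2) additive_subgroup.a_subset[OF ideal.axioms(1)[OF K(1)]]] K(3) s(2) by auto
  then have "\<one> \<in> {j \<oplus> b \<otimes> s | j b. j \<in> I \<and> b \<in> carrier R}" by simp
  then obtain j b where jb: "j \<in> I" "b \<in> carrier R" "\<one> = j \<oplus> b \<otimes> s" by auto
  have j: "j \<in> carrier R" using jb(1) I.a_subset by auto
  have "b \<otimes> s \<ominus> \<one> = \<ominus> j" unfolding jb(3) using j jb(2) s(1) by algebra
  then have "b \<otimes> s \<ominus> \<one> \<in> I" using jb(1) by simp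
  then show thesis using that jb(2) by simp
qed

text \<open>Numerators and denominators can be collected: every element of the localisation is \<open>x / s\<close>.\<close>

lemma pure_tensor:
  assumes "w \<in> carrier T"
  obtains x s where "x \<in> carrier M" "s \<in> carrier R - I" "w = ext.tensor x (fr \<one> s)"
proof -
  have "\<exists>x\<in>carrier M. \<exists>s\<in>carrier R - I. w = ext.tensor x (fr \<one> s)"
    using assms
  proof (induction rule: ext.T_induct)
    case zero
    have "\<zero>\<^bsub>T\<^esub> = ext.tensor \<zero>\<^bsub>M\<^esub> (fr \<one> \<one>)" using ext.tensor_zero_left[of "fr \<one> \<one>"] by simp
    then show ?case using frac.one_in_S M.zero_closed by (intro bexI)
  next
    case (diff u v)
    then obtain x s y t where xs: "x \<in> carrier M" "s \<in> carrier R - I" "u = ext.tensor x (fr \<one> s)"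
      "y \<in> carrier M" "t \<in> carrier R - I" "v = ext.tensor y (fr \<one> t)" by (elim bexE)
    have R: "s \<in> carrier R" "t \<in> carrier R" using xs by auto
    have st: "s \<otimes> t \<in> carrier R - I" using xs(2,5) by (rule frac.S_mult)
    have "fr \<one> s = fr t \<one> \<otimes>\<^bsub>A\<^esub> fr \<one> (s \<otimes> t)" "fr \<one> t = fr s \<one> \<otimes>\<^bsub>A\<^esub> fr \<one> (s \<otimes> t)"
      using R xs(2,5) st by (simp_all add: frac.fraction_eq_iff R.m_comm)
    then have "u = ext.tensor (t \<odot>\<^bsub>M\<^esub> x) (fr \<one> (s \<otimes> t))" "v = ext.tensor (s \<odot>\<^bsub>M\<^esub> y) (fr \<one> (s \<otimes> t))"
      using xs R st by (simp_all add: ext.tensor_smult_left)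
    then have "u \<ominus>\<^bsub>T\<^esub> v = ext.tensor (t \<odot>\<^bsub>M\<^esub> x \<ominus>\<^bsub>M\<^esub> s \<odot>\<^bsub>M\<^esub> y) (fr \<one> (s \<otimes> t))"
      using xs R st by (simp add: ext.tensor_diff_left)
    moreover have "t \<odot>\<^bsub>M\<^esub> x \<ominus>\<^bsub>M\<^esub> s \<odot>\<^bsub>M\<^esub> y \<in> carrier M" using xs R by auto
    ultimately show ?case using st by (intro bexI)
  next
    case (tensor x a)
    from tensor(2) obtain r s where rs: "r \<in> carrier R" "s \<in> carrier R - I" "a = fr r s" by (rule frac.fractionE)
    have "ext.tensor (r \<odot>\<^bsub>M\<^esub> x) (fr \<one> s) = ext.tensor x (fr r \<one> \<otimes>\<^bsub>A\<^esub> fr \<one> s)"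
      by (rule ext.tensor_smult_left) (use rs tensor in auto)
    also have "fr r \<one> \<otimes>\<^bsub>A\<^esub> fr \<one> s = a" using rs by simp
    finally have "ext.tensor x a = ext.tensor (r \<odot>\<^bsub>M\<^esub> x) (fr \<one> s)" by (rule sym)
    moreover have "r \<odot>\<^bsub>M\<^esub> x \<in> carrier M" using rs tensor by auto
    ultimately show ?case using rs(2) by (intro bexI)
  qed
  then show thesis using that by (elim bexE)
qed

lemma tensors_generate:
  assumes ms: "set ms \<subseteq> carrier M" and u: "u \<in> carrier R - I"
    and span: "\<forall>x\<in>carrier M. u \<odot>\<^bsub>M\<^esub> x \<in> combinations M (carrier R) ms"
  shows "carrier T = combinations T (carrier A) (map (\<lambda>m. ext.tensor m \<one>\<^bsub>A\<^esub>) ms)"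
proof -
  let ?ts = "map (\<lambda>m. ext.tensor m \<one>\<^bsub>A\<^esub>) ms"
  have ts: "set ?ts \<subseteq> carrier T" using ms by (auto simp del: oneA)
  have sub: "submodule (combinations T (carrier A) ?ts) A T"
    by (rule T.combinations_submodule[OF ring.oneideal[OF cring.axioms(1)[OF frac.fraction_ring_cring]] ts])
  have "w \<in> combinations T (carrier A) ?ts" if wT: "w \<in> carrier T" for w
  proof -
    obtain x s where xs: "x \<in> carrier M" "s \<in> carrier R - I" "w = ext.tensor x (fr \<one> s)"
      using pure_tensor[OF wT] .
    have us: "u \<otimes> s \<in> carrier R - I" using u xs(2) by (rule frac.S_mult)
    have R: "u \<in> carrier R" "s \<in> carrier R" using u xs by auto
    have "fr \<one> s = fr u \<one> \<otimes>\<^bsub>A\<^esub> fr \<one> (u \<otimes> s)"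
      using R xs(2) us by (simp add: frac.fraction_eq_iff R.m_comm)
    then have w: "w = ext.tensor (u \<odot>\<^bsub>M\<^esub> x) (fr \<one> (u \<otimes> s))"
      using xs R us by (simp add: ext.tensor_smult_left)
    obtain cs where cs: "u \<odot>\<^bsub>M\<^esub> x = lincomb M cs ms" "length cs = length ms" "set cs \<subseteq> carrier R"
      using bspec[OF span xs(1)] unfolding combinations_def by auto
    have b: "fr \<one> (u \<otimes> s) \<in> carrier A" using us by simp
    have "w = lincomb T (map (\<lambda>c. fr c \<one> \<otimes>\<^bsub>A\<^esub> fr \<one> (u \<otimes> s)) cs) ?ts"
      unfolding w cs(1) by (rule ext.tensor_lincomb[OF b cs(3) ms])
    moreover have "set (map (\<lambda>c. fr c \<one> \<otimes>\<^bsub>A\<^esub> fr \<one> (u \<otimes> s)) cs) \<subseteq> carrier A"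
      using cs(3) b by auto
    ultimately show ?thesis unfolding combinations_def using cs(2)
      by (intro CollectI exI[of _ "map (\<lambda>c. fr c \<one> \<otimes>\<^bsub>A\<^esub> fr \<one> (u \<otimes> s)) cs"]) simp
  qed
  then show ?thesis using T.submoduleE(1)[OF sub] by auto
qed

text \<open>The reduction \<open>A \<rightarrow> R / I\<close>, lifted to representatives in \<open>R\<close>.\<close>

lemma residue:
  obtains \<rho> where "\<And>a. a \<in> carrier A \<Longrightarrow> \<rho> a \<in> carrier R"
    "\<And>r s. r \<in> carrier R \<Longrightarrow> s \<in> carrier R - I \<Longrightarrow> \<rho> (fr r s) \<otimes> s \<ominus> r \<in> I"
    "\<And>q r s. q \<in> carrier R \<Longrightarrow> r \<in> carrier R \<Longrightarrow> s \<in> carrier R - I \<Longrightarrow> q \<otimes> s \<ominus> r \<in> I \<Longrightarrow>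
      q \<ominus> \<rho> (fr r s) \<in> I"
proof -
  have ex: "\<exists>q\<in>carrier R. \<forall>r\<in>carrier R. \<forall>s\<in>carrier R - I. a = fr r s \<longrightarrow> q \<otimes> s \<ominus> r \<in> I"
    if a: "a \<in> carrier A" for a
  proof -
    obtain r s where rs: "r \<in> carrier R" "s \<in> carrier R - I" "a = fr r s" using a by (rule frac.fractionE)
    obtain c where c: "c \<in> carrier R" "c \<otimes> s \<ominus> \<one> \<in> I" using inverse_mod[OF rs(2)] .
    have sR: "s \<in> carrier R" "s \<notin> I" using rs by auto
    have "r \<otimes> c \<otimes> s' \<ominus> r' \<in> I" if rs': "r' \<in> carrier R" "s' \<in> carrier R - I" "a = fr r' s'" for r' s'
    proof -
      have s'R: "s' \<in> carrier R" using rs' by auto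
      have eq: "r \<otimes> s' = r' \<otimes> s" using rs rs' frac.fraction_eq_iff by auto
      have "r \<otimes> c \<otimes> s' \<ominus> r' = c \<otimes> (r \<otimes> s') \<ominus> r'" using rs(1) c(1) s'R rs'(1) by (simp add: R.m_ac)
      also have "\<dots> = r' \<otimes> (c \<otimes> s \<ominus> \<one>)" unfolding eq using c(1) sR(1) rs'(1) by algebra
      also have "\<dots> \<in> I" using c(2) rs'(1) by (rule I.I_l_closed)
      finally show ?thesis .
    qed
    then show ?thesis using rs(1) c(1) by (intro bexI[of _ "r \<otimes> c"]) auto
  qed
  then have "\<forall>a\<in>carrier A. \<exists>q. q \<in> carrier R \<and> (\<forall>r\<in>carrier R. \<forall>s\<in>carrier R - I. a = fr r s \<longrightarrow> q \<otimes> s \<ominus> r \<in> I)"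
    unfolding Bex_def by simp
  from bchoice[OF this] obtain \<rho> where \<rho>: "\<forall>a\<in>carrier A. \<rho> a \<in> carrier R \<and>
      (\<forall>r\<in>carrier R. \<forall>s\<in>carrier R - I. a = fr r s \<longrightarrow> \<rho> a \<otimes> s \<ominus> r \<in> I)" by (elim exE)
  have closed: "\<rho> a \<in> carrier R" if "a \<in> carrier A" for a using \<rho> that by simp
  have mod: "\<rho> (fr r s) \<otimes> s \<ominus> r \<in> I" if "r \<in> carrier R" "s \<in> carrier R - I" for r s
    using bspec[OF \<rho> frac.fraction_closed[OF that]] that by simp
  have unique: "q \<ominus> \<rho> (fr r s) \<in> I"
    if q: "q \<in> carrier R" "r \<in> carrier R" "s \<in> carrier R - I" "q \<otimes> s \<ominus> r \<in> I" for q r s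
  proof -
    let ?p = "\<rho> (fr r s)"
    have R: "?p \<in> carrier R" "s \<in> carrier R" "s \<notin> I" using closed q by auto
    have "(q \<otimes> s \<ominus> r) \<oplus> \<ominus> (?p \<otimes> s \<ominus> r) \<in> I" using q(4) mod[OF q(2,3)] by auto
    moreover have "(q \<otimes> s \<ominus> r) \<oplus> \<ominus> (?p \<otimes> s \<ominus> r) = (q \<ominus> ?p) \<otimes> s" using R(1,2) q(1,2) by algebra
    ultimately show ?thesis
      using primeideal.I_prime[OF I_prime, of "q \<ominus> ?p" s] R q(1) by auto
  qed
  show thesis by (rule that[OF closed mod unique])
qed

text \<open>Let \<open>N\<close> be the span of \<open>ms\<close>. The residue map makes \<open>M / (N + I M)\<close> a quotient of the localisation, so generators of the
  localisation give generators modulo \<open>I M\<close>; the rest is Nakayama's lemma.\<close>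

lemma generated_by_tensors:
  assumes fg: "finitely_generated_module R M"
    and ms: "set ms \<subseteq> carrier M" and ws: "length ws = length ms"
    and w: "\<And>i. i < length ms \<Longrightarrow> \<exists>s\<in>carrier R - I. ws ! i = ext.tensor (ms ! i) (fr \<one> s)"
    and span: "carrier T \<subseteq> combinations T (carrier A) ws"
  shows "\<exists>u\<in>carrier R - I. \<forall>x\<in>carrier M. u \<odot>\<^bsub>M\<^esub> x \<in> combinations M (carrier R) ms"
proof -
  obtain ps where ps: "set ps \<subseteq> carrier M" "carrier M = combinations M (carrier R) ps"
    using fg finitely_generated_iff by auto
  obtain \<rho> where \<rho>: "\<And>a. a \<in> carrier A \<Longrightarrow> \<rho> a \<in> carrier R"
    "\<And>r s. r \<in> carrier R \<Longrightarrow> s \<in> carrier R - I \<Longrightarrow> \<rho> (fr r s) \<otimes> s \<ominus> r \<in> I"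
    "\<And>q r s. q \<in> carrier R \<Longrightarrow> r \<in> carrier R \<Longrightarrow> s \<in> carrier R - I \<Longrightarrow> q \<otimes> s \<ominus> r \<in> I \<Longrightarrow>
      q \<ominus> \<rho> (fr r s) \<in> I"
    using residue by metis
  define C where "C = combinations M (carrier R) ms"
  define J where "J = combinations M I ps"
  have C: "submodule C R M" unfolding C_def by (rule combinations_submodule[OF R.oneideal ms])
  have J: "submodule J R M" unfolding J_def by (rule combinations_submodule[OF I.is_ideal ps(1)])
  define H where "H = {h \<oplus>\<^bsub>M\<^esub> k | h k. h \<in> C \<and> k \<in> J}"
  have H: "submodule H R M" and CH: "C \<subseteq> H" and JH: "J \<subseteq> H"
    unfolding H_def using submodule_sum[OF C J] by auto
  note Hc = submoduleE[OF H]
  have IM: "a \<odot>\<^bsub>M\<^esub> x \<in> H" if "a \<in> I" "x \<in> carrier M" for a x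
    using smult_in_combinations[OF I.is_ideal that(1) _ ps(1), of x] that(2) ps(2) JH unfolding J_def by auto
  let ?Q = "quotient_module M H"
  have cong: "H +>\<^bsub>M\<^esub> (q \<odot>\<^bsub>M\<^esub> x) = H +>\<^bsub>M\<^esub> (q' \<odot>\<^bsub>M\<^esub> x)"
    if "q \<in> carrier R" "q' \<in> carrier R" "q \<ominus> q' \<in> I" "x \<in> carrier M" for q q' x
  proof -
    have "q \<odot>\<^bsub>M\<^esub> x \<ominus>\<^bsub>M\<^esub> q' \<odot>\<^bsub>M\<^esub> x = (q \<ominus> q') \<odot>\<^bsub>M\<^esub> x"
      using that by (simp add: R.minus_eq M.minus_eq smult_l_distr smult_l_minus)
    then show ?thesis using quotient_eq_iff[OF H] IM[OF that(3,4)] that by simp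
  qed
  define \<beta> where "\<beta> = (\<lambda>x a. H +>\<^bsub>M\<^esub> (\<rho> a \<odot>\<^bsub>M\<^esub> x))"
  have rho_mult: "\<rho> a \<otimes> \<rho> b \<ominus> \<rho> (a \<otimes>\<^bsub>A\<^esub> b) \<in> I" if ab: "a \<in> carrier A" "b \<in> carrier A" for a b
  proof -
    obtain r s where rs: "r \<in> carrier R" "s \<in> carrier R - I" "a = fr r s" using ab(1) by (rule frac.fractionE)
    obtain r' s' where rs': "r' \<in> carrier R" "s' \<in> carrier R - I" "b = fr r' s'" using ab(2) by (rule frac.fractionE)
    have R: "s \<in> carrier R" "s' \<in> carrier R" "\<rho> a \<in> carrier R" "\<rho> b \<in> carrier R" using rs rs' \<rho>(1) ab by auto
    have "(\<rho> a \<otimes> \<rho> b) \<otimes> (s \<otimes> s') \<ominus> r \<otimes> r' =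
        (\<rho> a \<otimes> s) \<otimes> (\<rho> b \<otimes> s' \<ominus> r') \<oplus> r' \<otimes> (\<rho> a \<otimes> s \<ominus> r)"
      using R rs(1) rs'(1) by algebra
    also have "\<dots> \<in> I"
      using \<rho>(2)[OF rs(1,2)] \<rho>(2)[OF rs'(1,2)] R rs(1) rs'(1)
      unfolding rs(3)[symmetric] rs'(3)[symmetric]
      by (intro I.a_closed I.I_l_closed[where a = "\<rho> b \<otimes> s' \<ominus> r'"] I.I_l_closed[where a = "\<rho> a \<otimes> s \<ominus> r"]) auto
    finally have mod: "(\<rho> a \<otimes> \<rho> b) \<otimes> (s \<otimes> s') \<ominus> r \<otimes> r' \<in> I" .
    have eq: "a \<otimes>\<^bsub>A\<^esub> b = fr (r \<otimes> r') (s \<otimes> s')"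
      unfolding rs(3) rs'(3) by (rule frac.fraction_mult[OF rs(1,2) rs'(1,2)])
    show ?thesis
      unfolding eq by (rule \<rho>(3)[OF R.m_closed[OF R(3,4)] R.m_closed[OF rs(1) rs'(1)] frac.S_mult[OF rs(2) rs'(2)] mod])
  qed
  have rho_add: "(\<rho> a \<oplus> \<rho> b) \<ominus> \<rho> (a \<oplus>\<^bsub>A\<^esub> b) \<in> I" if ab: "a \<in> carrier A" "b \<in> carrier A" for a b
  proof -
    obtain r s where rs: "r \<in> carrier R" "s \<in> carrier R - I" "a = fr r s" using ab(1) by (rule frac.fractionE)
    obtain r' s' where rs': "r' \<in> carrier R" "s' \<in> carrier R - I" "b = fr r' s'" using ab(2) by (rule frac.fractionE)
    have R: "s \<in> carrier R" "s' \<in> carrier R" "\<rho> a \<in> carrier R" "\<rho> b \<in> carrier R" using rs rs' \<rho>(1) ab by auto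
    have "(\<rho> a \<oplus> \<rho> b) \<otimes> (s \<otimes> s') \<ominus> (r \<otimes> s' \<oplus> r' \<otimes> s) =
        s \<otimes> (\<rho> b \<otimes> s' \<ominus> r') \<oplus> s' \<otimes> (\<rho> a \<otimes> s \<ominus> r)"
      using R rs(1) rs'(1) by algebra
    also have "\<dots> \<in> I"
      using \<rho>(2)[OF rs(1,2)] \<rho>(2)[OF rs'(1,2)] R rs(1) rs'(1)
      unfolding rs(3)[symmetric] rs'(3)[symmetric]
      by (intro I.a_closed I.I_l_closed[where a = "\<rho> b \<otimes> s' \<ominus> r'"] I.I_l_closed[where a = "\<rho> a \<otimes> s \<ominus> r"]) auto
    finally have mod: "(\<rho> a \<oplus> \<rho> b) \<otimes> (s \<otimes> s') \<ominus> (r \<otimes> s' \<oplus> r' \<otimes> s) \<in> I" .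
    have eq: "a \<oplus>\<^bsub>A\<^esub> b = fr (r \<otimes> s' \<oplus> r' \<otimes> s) (s \<otimes> s')"
      unfolding rs(3) rs'(3) by (rule frac.fraction_add[OF rs(1,2) rs'(1,2)])
    have "r \<otimes> s' \<oplus> r' \<otimes> s \<in> carrier R" using rs(1) rs'(1) R(1,2) by simp
    then show ?thesis
      unfolding eq by (rule \<rho>(3)[OF R.a_closed[OF R(3,4)] _ frac.S_mult[OF rs(2) rs'(2)] mod])
  qed
  have rho_of: "r \<ominus> \<rho> (fr r \<one>) \<in> I" if "r \<in> carrier R" for r
  proof -
    have "r \<otimes> \<one> \<ominus> r \<in> I" using that I.zero_closed by (simp add: R.minus_eq R.r_neg)
    then show ?thesis by (rule \<rho>(3)[OF that that frac.one_in_S])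
  qed
  have \<beta>mem: "\<rho> a \<odot>\<^bsub>M\<^esub> x \<in> carrier M" if "x \<in> carrier M" "a \<in> carrier A" for x a using \<rho>(1) that by auto
  obtain h where h': "h \<in> carrier T \<rightarrow> carrier ?Q"
    "\<forall>u\<in>carrier T. \<forall>v\<in>carrier T. h (u \<oplus>\<^bsub>T\<^esub> v) = h u \<oplus>\<^bsub>?Q\<^esub> h v"
    "\<forall>x\<in>carrier M. \<forall>a\<in>carrier A. h (ext.tensor x a) = \<beta> x a"
  proof (rule ext.tensor_universal[of ?Q \<beta>])
    show "abelian_group ?Q" by (rule quotient_abelian_group[OF H])
    show "\<beta> x a \<in> carrier ?Q" if "x \<in> carrier M" "a \<in> carrier A" for x a
      unfolding \<beta>_def quotient_carrier using \<beta>mem[OF that] by auto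
    show "\<beta> (x \<oplus>\<^bsub>M\<^esub> y) a = \<beta> x a \<oplus>\<^bsub>?Q\<^esub> \<beta> y a"
      if "x \<in> carrier M" "y \<in> carrier M" "a \<in> carrier A" for x y a
      unfolding \<beta>_def using quotient_add[OF H] \<beta>mem \<rho>(1) that by (simp add: smult_r_distr)
    show "\<beta> x (a \<oplus>\<^bsub>A\<^esub> b) = \<beta> x a \<oplus>\<^bsub>?Q\<^esub> \<beta> x b"
      if c: "x \<in> carrier M" "a \<in> carrier A" "b \<in> carrier A" for x a b
    proof -
      have "\<beta> x a \<oplus>\<^bsub>?Q\<^esub> \<beta> x b = H +>\<^bsub>M\<^esub> ((\<rho> a \<oplus> \<rho> b) \<odot>\<^bsub>M\<^esub> x)"
        unfolding \<beta>_def using quotient_add[OF H] \<beta>mem \<rho>(1) c by (simp add: smult_l_distr)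
      also have "\<dots> = \<beta> x (a \<oplus>\<^bsub>A\<^esub> b)"
        unfolding \<beta>_def by (rule cong) (use rho_add[OF c(2,3)] \<rho>(1) c in auto)
      finally show ?thesis by simp
    qed
    show "\<beta> (r \<odot>\<^bsub>M\<^esub> x) a = \<beta> x (fr r \<one> \<otimes>\<^bsub>A\<^esub> a)"
      if c: "r \<in> carrier R" "x \<in> carrier M" "a \<in> carrier A" for r x a
    proof -
      have frA: "fr r \<one> \<in> carrier A" using c by simp
      have "\<beta> (r \<odot>\<^bsub>M\<^esub> x) a = H +>\<^bsub>M\<^esub> (r \<odot>\<^bsub>M\<^esub> (\<rho> a \<odot>\<^bsub>M\<^esub> x))"
        unfolding \<beta>_def using \<rho>(1) c by (simp add: smult_assoc1[symmetric] R.m_comm)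
      also have "\<dots> = H +>\<^bsub>M\<^esub> (\<rho> (fr r \<one>) \<odot>\<^bsub>M\<^esub> (\<rho> a \<odot>\<^bsub>M\<^esub> x))"
        by (rule cong) (use rho_of[OF c(1)] \<rho>(1) c in auto)
      also have "\<dots> = H +>\<^bsub>M\<^esub> ((\<rho> (fr r \<one>) \<otimes> \<rho> a) \<odot>\<^bsub>M\<^esub> x)"
        using \<rho>(1)[OF frA] \<rho>(1)[OF c(3)] c(2) by (simp add: smult_assoc1)
      also have "\<dots> = \<beta> x (fr r \<one> \<otimes>\<^bsub>A\<^esub> a)"
        unfolding \<beta>_def by (rule cong) (use rho_mult[OF frA c(3)] \<rho>(1) frA c in auto)
      finally show ?thesis .
    qed
  qed
  have h: "h \<in> carrier T \<rightarrow> carrier ?Q"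
    "\<And>u v. u \<in> carrier T \<Longrightarrow> v \<in> carrier T \<Longrightarrow> h (u \<oplus>\<^bsub>T\<^esub> v) = h u \<oplus>\<^bsub>?Q\<^esub> h v"
    "\<And>x a. x \<in> carrier M \<Longrightarrow> a \<in> carrier A \<Longrightarrow> h (ext.tensor x a) = \<beta> x a"
    using h' by auto
  define K where "K = {t \<in> carrier T. h t = H}"
  have Qzero: "\<zero>\<^bsub>?Q\<^esub> = H" by (simp add: quotient_module_def)
  interpret Q: abelian_group ?Q by (rule quotient_abelian_group[OF H])
  have h0: "h \<zero>\<^bsub>T\<^esub> = H"
    using h(2)[of "\<zero>\<^bsub>T\<^esub>" "\<zero>\<^bsub>T\<^esub>"] h(1) Q.add.l_cancel_one'[of "h \<zero>\<^bsub>T\<^esub>" "h \<zero>\<^bsub>T\<^esub>"] Qzero by auto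
  have Ksm: "b \<odot>\<^bsub>T\<^esub> t \<in> K" if b: "b \<in> carrier A" and t: "t \<in> K" for b t
  proof -
    have tT: "t \<in> carrier T" "h t = H" using t unfolding K_def by auto
    obtain x s where xs: "x \<in> carrier M" "s \<in> carrier R - I" "t = ext.tensor x (fr \<one> s)"
      using pure_tensor[OF tT(1)] .
    define a where "a = fr \<one> s"
    have a: "a \<in> carrier A" unfolding a_def using xs(2) by simp
    have "\<rho> a \<odot>\<^bsub>M\<^esub> x \<in> H"
      using tT(2) h(3)[OF xs(1) a] quotient_zero_iff[OF H \<beta>mem[OF xs(1) a]] unfolding xs(3) a_def \<beta>_def by simp
    then have in_H: "\<rho> b \<odot>\<^bsub>M\<^esub> (\<rho> a \<odot>\<^bsub>M\<^esub> x) \<in> H" using Hc(4) \<rho>(1)[OF b] by simp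
    have "h (b \<odot>\<^bsub>T\<^esub> t) = H +>\<^bsub>M\<^esub> (\<rho> (b \<otimes>\<^bsub>A\<^esub> a) \<odot>\<^bsub>M\<^esub> x)"
      unfolding xs(3) a_def[symmetric] using a b xs(1) h(3) by (simp add: ext.smult_tensor \<beta>_def)
    also have "\<dots> = H +>\<^bsub>M\<^esub> ((\<rho> b \<otimes> \<rho> a) \<odot>\<^bsub>M\<^esub> x)"
      by (rule cong[symmetric]) (use rho_mult[OF b a] \<rho>(1) a b xs(1) in auto)
    also have "\<dots> = H +>\<^bsub>M\<^esub> (\<rho> b \<odot>\<^bsub>M\<^esub> (\<rho> a \<odot>\<^bsub>M\<^esub> x))"
      using \<rho>(1)[OF a] \<rho>(1)[OF b] xs(1) by (simp add: smult_assoc1)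
    also have "\<dots> = H" using quotient_zero_iff[OF H] in_H Hc(1) by auto
    finally show ?thesis unfolding K_def using ext.T_smult_closed[OF b tT(1)] by simp
  qed
  have K: "submodule K A T"
  proof (rule T.submoduleI)
    show "K \<subseteq> carrier T" unfolding K_def by auto
    show "\<zero>\<^bsub>T\<^esub> \<in> K" unfolding K_def using h0 by simp
    show "b \<odot>\<^bsub>T\<^esub> t \<in> K" if "b \<in> carrier A" "t \<in> K" for b t using Ksm that .
    show "\<ominus>\<^bsub>T\<^esub> t \<in> K" if "t \<in> K" for t
    proof -
      have "t \<in> carrier T" using that unfolding K_def by simp
      then have "\<ominus>\<^bsub>T\<^esub> t = (\<ominus>\<^bsub>A\<^esub> \<one>\<^bsub>A\<^esub>) \<odot>\<^bsub>T\<^esub> t" by (simp add: T.smult_l_minus T.smult_one del: oneA)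
      then show ?thesis using Ksm[OF _ that, of "\<ominus>\<^bsub>A\<^esub> \<one>\<^bsub>A\<^esub>"] by (simp del: oneA)
    qed
    show "t \<oplus>\<^bsub>T\<^esub> t' \<in> K" if "t \<in> K" "t' \<in> K" for t t'
      using that h(2)[of t t'] Q.l_zero[OF Q.zero_closed] Qzero unfolding K_def by auto
  qed
  have "set ws \<subseteq> K"
  proof
    fix t assume "t \<in> set ws"
    then obtain i where i: "i < length ms" "t = ws ! i" using ws by (metis in_set_conv_nth)
    obtain s where s: "s \<in> carrier R - I" "ws ! i = ext.tensor (ms ! i) (fr \<one> s)" using w[OF i(1)] by auto
    have m: "ms ! i \<in> carrier M" "ms ! i \<in> C"
      using i(1) ms generators_in_combinations[OF ms] nth_mem[of i ms] unfolding C_def by auto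
    have a: "fr \<one> s \<in> carrier A" using s(1) by simp
    have "\<rho> (fr \<one> s) \<odot>\<^bsub>M\<^esub> (ms ! i) \<in> H" using Hc(4)[OF \<rho>(1)[OF a]] m CH by auto
    then have "h t = H"
      unfolding i(2) s(2) h(3)[OF m(1) a] \<beta>_def using quotient_zero_iff[OF H] Hc(1) by auto
    then show "t \<in> K" unfolding K_def i(2) s(2) using ext.tensor_closed[OF m(1) a] by simp
  qed
  then have TK: "carrier T \<subseteq> K"
    using span T.submodule_lincomb[OF K] unfolding combinations_def by auto
  have all: "x \<in> H" if x: "x \<in> carrier M" for x
  proof -
    have a: "fr \<one> \<one> \<in> carrier A" by simp
    have "h (ext.tensor x (fr \<one> \<one>)) = H" using TK ext.tensor_closed[OF x a] unfolding K_def by auto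
    then have "H = H +>\<^bsub>M\<^esub> (\<rho> (fr \<one> \<one>) \<odot>\<^bsub>M\<^esub> x)" using h(3)[OF x a] unfolding \<beta>_def by simp
    also have "\<dots> = H +>\<^bsub>M\<^esub> (\<one> \<odot>\<^bsub>M\<^esub> x)"
      by (rule cong[symmetric]) (use rho_of[of \<one>] \<rho>(1)[OF a] x in auto)
    finally have "H +>\<^bsub>M\<^esub> x = H" using x by simp
    then show ?thesis using quotient_zero_iff[OF H x] by simp
  qed
  have "\<exists>h\<in>combinations M (carrier R) ms. \<exists>y\<in>combinations M I ps. \<one> \<odot>\<^bsub>M\<^esub> x = h \<oplus>\<^bsub>M\<^esub> y"
    if "x \<in> carrier M" for x
    using all[OF that] that unfolding H_def C_def J_def by auto
  from nakayama_at_prime_span[OF I_prime ps(1) ms _ this] one_notin_I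
  show ?thesis by auto
qed

end


section \<open>Coordinates with respect to a local basis\<close>

lemma lincomb_cong:
  "length ps = length cs \<Longrightarrow> length ds = length cs \<Longrightarrow> length qs = length cs \<Longrightarrow>
    (\<And>i. i < length cs \<Longrightarrow> cs ! i \<odot>\<^bsub>M\<^esub> ps ! i = ds ! i \<odot>\<^bsub>M\<^esub> qs ! i) \<Longrightarrow>
    lincomb M cs ps = lincomb M ds qs"
proof (induction cs arbitrary: ps ds qs)
  case (Cons c cs)
  then obtain p ps' d ds' q qs' where eqs: "ps = p # ps'" "ds = d # ds'" "qs = q # qs'"
    by (metis length_Suc_conv)
  have "lincomb M cs ps' = lincomb M ds' qs'"
  proof (rule Cons.IH)
    show "cs ! i \<odot>\<^bsub>M\<^esub> ps' ! i = ds' ! i \<odot>\<^bsub>M\<^esub> qs' ! i" if "i < length cs" for i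
      using Cons.prems(4)[of "Suc i"] that eqs by simp
  qed (use Cons.prems eqs in auto)
  then show ?case using Cons.prems(4)[of 0] eqs by simp
qed auto

lemma exists_map_eq:
  assumes "distinct xs" "length cs = length xs"
  shows "\<exists>g\<in>extensional (set xs). map g xs = cs"
proof -
  define g where "g = restrict (\<lambda>x. the (map_of (zip xs cs) x)) (set xs)"
  have "map g xs = cs"
  proof (rule nth_equalityI)
    fix i assume "i < length (map g xs)"
    then show "map g xs ! i = cs ! i"
      using map_of_zip_nth[of xs cs i] assms unfolding g_def by simp
  qed (simp add: assms)
  then show ?thesis unfolding g_def by (intro bexI) auto
qed

context module
begin

text \<open>Since the coordinates of \<open>u x\<close> are unique, they depend linearly on \<open>x\<close>. In this sense a local basis
  gives a linear embedding of \<open>M\<close> into a free module, up to the denominator \<open>u\<close>.\<close>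

lemma coordinates:
  assumes ind: "lin_independent R M ms" and u: "u \<in> carrier R"
    and span: "\<forall>x\<in>carrier M. u \<odot>\<^bsub>M\<^esub> x \<in> combinations M (carrier R) ms"
  shows "\<exists>coord.
    (\<forall>x\<in>carrier M. length (coord x) = length ms \<and> set (coord x) \<subseteq> carrier R \<and>
      lincomb M (coord x) ms = u \<odot>\<^bsub>M\<^esub> x) \<and>
    (\<forall>x\<in>carrier M. \<forall>y\<in>carrier M. coord (x \<oplus>\<^bsub>M\<^esub> y) = map2 (\<oplus>) (coord x) (coord y)) \<and>
    (\<forall>r\<in>carrier R. \<forall>x\<in>carrier M. coord (r \<odot>\<^bsub>M\<^esub> x) = map ((\<otimes>) r) (coord x)) \<and>
    (\<forall>cs. length cs = length ms \<and> set cs \<subseteq> carrier R \<longrightarrow> coord (lincomb M cs ms) = map ((\<otimes>) u) cs)"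
proof -
  have ms: "set ms \<subseteq> carrier M" using ind unfolding lin_independent_def by simp
  have "\<forall>x\<in>carrier M. \<exists>cs. u \<odot>\<^bsub>M\<^esub> x = lincomb M cs ms \<and> length cs = length ms \<and> set cs \<subseteq> carrier R"
    using span unfolding combinations_def by simp
  from bchoice[OF this] obtain coord where coord: "\<forall>x\<in>carrier M. u \<odot>\<^bsub>M\<^esub> x = lincomb M (coord x) ms \<and>
      length (coord x) = length ms \<and> set (coord x) \<subseteq> carrier R" by (elim exE)
  have 1: "length (coord x) = length ms" "set (coord x) \<subseteq> carrier R" "lincomb M (coord x) ms = u \<odot>\<^bsub>M\<^esub> x"
    if "x \<in> carrier M" for x using coord that by auto
  have eq: "coord x = cs" if "x \<in> carrier M" "length cs = length ms" "set cs \<subseteq> carrier R"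
      "lincomb M cs ms = u \<odot>\<^bsub>M\<^esub> x" for x cs
    by (rule lin_independent_unique[OF ind]) (use 1 that in auto)
  show ?thesis
  proof (intro exI[of _ coord] conjI ballI allI impI)
    fix x assume x: "x \<in> carrier M"
    show "length (coord x) = length ms" "set (coord x) \<subseteq> carrier R" "lincomb M (coord x) ms = u \<odot>\<^bsub>M\<^esub> x"
      using 1[OF x] by auto
  next
    fix x y assume x: "x \<in> carrier M" and y: "y \<in> carrier M"
    show "coord (x \<oplus>\<^bsub>M\<^esub> y) = map2 (\<oplus>) (coord x) (coord y)"
    proof (rule eq)
      show "set (map2 (\<oplus>) (coord x) (coord y)) \<subseteq> carrier R"
        using 1(2)[OF x] 1(2)[OF y] by (force dest: set_zip_leftD set_zip_rightD)
      show "lincomb M (map2 (\<oplus>) (coord x) (coord y)) ms = u \<odot>\<^bsub>M\<^esub> (x \<oplus>\<^bsub>M\<^esub> y)"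
        using lincomb_add[OF 1(1)[OF x] 1(1)[OF y] 1(2)[OF x] 1(2)[OF y] ms] 1(3) x y u
        by (simp add: smult_r_distr)
    qed (use x y 1 in auto)
  next
    fix r x assume r: "r \<in> carrier R" and x: "x \<in> carrier M"
    show "coord (r \<odot>\<^bsub>M\<^esub> x) = map ((\<otimes>) r) (coord x)"
    proof (rule eq)
      show "set (map ((\<otimes>) r) (coord x)) \<subseteq> carrier R" using 1(2)[OF x] r by auto
      show "lincomb M (map ((\<otimes>) r) (coord x)) ms = u \<odot>\<^bsub>M\<^esub> (r \<odot>\<^bsub>M\<^esub> x)"
        using lincomb_smult[OF r 1(2)[OF x] ms] 1(3)[OF x] x r u
        by (simp add: smult_assoc1[symmetric] R.m_comm)
    qed (use x r 1 in auto)
  next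
    fix cs assume cs: "length cs = length ms \<and> set cs \<subseteq> carrier R"
    show "coord (lincomb M cs ms) = map ((\<otimes>) u) cs"
    proof (rule eq)
      show "set (map ((\<otimes>) u) cs) \<subseteq> carrier R" using cs u by auto
      show "lincomb M (map ((\<otimes>) u) cs) ms = u \<odot>\<^bsub>M\<^esub> lincomb M cs ms"
        using lincomb_smult[OF u conjunct2[OF cs] ms] .
    qed (use cs ms in auto)
  qed
qed

end

lemma (in module) free_module_lincomb_hom:
  assumes ps: "set ps \<subseteq> carrier M" "length ps = length xs"
  shows "(\<lambda>g. lincomb M (map g xs) ps) \<in> mod_hom R (free_module R (set xs)) M"
  unfolding mod_hom_def
proof (intro CollectI conjI ballI)
  have mem: "set (map g xs) \<subseteq> carrier R" if "g \<in> carrier (free_module R (set xs))" for g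
    using that free_module_carrier[of "set xs" R] by auto
  show "(\<lambda>g. lincomb M (map g xs) ps) \<in> carrier (free_module R (set xs)) \<rightarrow> carrier M"
    using mem lincomb_closed ps by auto
  fix g assume g: "g \<in> carrier (free_module R (set xs))"
  { fix h assume h: "h \<in> carrier (free_module R (set xs))"
    have "map (g \<oplus>\<^bsub>free_module R (set xs)\<^esub> h) xs = map2 (\<oplus>) (map g xs) (map h xs)"
      by (rule nth_equalityI) auto
    then show "lincomb M (map (g \<oplus>\<^bsub>free_module R (set xs)\<^esub> h) xs) ps =
        lincomb M (map g xs) ps \<oplus>\<^bsub>M\<^esub> lincomb M (map h xs) ps"
      using lincomb_add[OF _ _ mem[OF g] mem[OF h] ps(1)] ps(2) by (simp only: length_map) }
next
  have mem: "set (map g xs) \<subseteq> carrier R" if "g \<in> carrier (free_module R (set xs))" for g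
    using that free_module_carrier[of "set xs" R] by auto
  fix r g assume r: "r \<in> carrier R" and g: "g \<in> carrier (free_module R (set xs))"
  have "map (r \<odot>\<^bsub>free_module R (set xs)\<^esub> g) xs = map ((\<otimes>) r) (map g xs)"
    by (rule nth_equalityI) auto
  then show "lincomb M (map (r \<odot>\<^bsub>free_module R (set xs)\<^esub> g) xs) ps = r \<odot>\<^bsub>M\<^esub> lincomb M (map g xs) ps"
    using lincomb_smult[OF r mem[OF g] ps(1)] by (simp only:)
qed

lemma (in module) free_module_lincomb_surj:
  assumes "distinct xs" and ps: "length ps = length xs"
    and x: "x \<in> combinations M (carrier R) ps"
  shows "\<exists>g\<in>carrier (free_module R (set xs)). lincomb M (map g xs) ps = x"
proof -
  obtain cs where cs: "x = lincomb M cs ps" "length cs = length ps" "set cs \<subseteq> carrier R"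
    using x unfolding combinations_def by auto
  obtain g where g: "g \<in> extensional (set xs)" "map g xs = cs"
    using exists_map_eq[OF assms(1), of cs] cs(2) ps by auto
  then have "g \<in> carrier (free_module R (set xs))"
    unfolding free_module_carrier[OF finite_set] using cs(3) by (auto simp: PiE_def)
  then show ?thesis using g(2) cs(1) by auto
qed

lemma least_eq_least:
  fixes P Q :: "nat \<Rightarrow> bool"
  assumes PQ: "\<And>n. P n \<Longrightarrow> Q n" and QP: "\<And>n. Q n \<Longrightarrow> \<exists>m\<le>n. P m" and ex: "\<exists>n. Q n"
  shows "(LEAST n. P n) = (LEAST n. Q n)"
proof (rule Least_equality)
  have Q: "Q (LEAST n. Q n)" using ex by (rule LeastI_ex)
  then obtain m where m: "m \<le> (LEAST n. Q n)" "P m" using QP by blast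
  then have "m = (LEAST n. Q n)" using Least_le[of Q m] PQ by (simp add: le_antisym)
  then show "P (LEAST n. Q n)" using m by simp
  show "(LEAST n. Q n) \<le> n" if "P n" for n using PQ[OF that] by (rule Least_le)
qed


section \<open>Generators and bases of the localisation\<close>

context localised_at
begin

lemma generators_imp_locally_generated:
  assumes fg: "finitely_generated_module R M" and ws: "set ws \<subseteq> carrier T"
    and span: "carrier T \<subseteq> combinations T (carrier A) ws"
  obtains ms ss u where "length ms = length ws" "length ss = length ws" "set ms \<subseteq> carrier M"
    "set ss \<subseteq> carrier R - I" "\<forall>i<length ws. ws ! i = ext.tensor (ms ! i) (fr \<one> (ss ! i))"
    "u \<in> carrier R - I" "\<forall>x\<in>carrier M. u \<odot>\<^bsub>M\<^esub> x \<in> combinations M (carrier R) ms"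
proof -
  have "\<forall>w\<in>set ws. \<exists>p. fst p \<in> carrier M \<and> snd p \<in> carrier R - I \<and> w = ext.tensor (fst p) (fr \<one> (snd p))"
  proof
    fix w assume "w \<in> set ws"
    then have "w \<in> carrier T" using ws by auto
    then obtain x s where "x \<in> carrier M" "s \<in> carrier R - I" "w = ext.tensor x (fr \<one> s)" by (rule pure_tensor)
    then show "\<exists>p. fst p \<in> carrier M \<and> snd p \<in> carrier R - I \<and> w = ext.tensor (fst p) (fr \<one> (snd p))"
      by (intro exI[of _ "(x, s)"]) simp
  qed
  from bchoice[OF this] obtain p where p: "\<forall>w\<in>set ws. fst (p w) \<in> carrier M \<and> snd (p w) \<in> carrier R - I \<and>
      w = ext.tensor (fst (p w)) (fr \<one> (snd (p w)))" by (elim exE)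
  define ms where "ms = map (\<lambda>w. fst (p w)) ws"
  define ss where "ss = map (\<lambda>w. snd (p w)) ws"
  have ms: "set ms \<subseteq> carrier M" "length ms = length ws" and ss: "set ss \<subseteq> carrier R - I" "length ss = length ws"
    unfolding ms_def ss_def using p by auto
  have eq: "ws ! i = ext.tensor (ms ! i) (fr \<one> (ss ! i))" "ss ! i \<in> carrier R - I" if "i < length ws" for i
    using bspec[OF p nth_mem[OF that]] that unfolding ms_def ss_def by simp_all
  have "\<exists>u\<in>carrier R - I. \<forall>x\<in>carrier M. u \<odot>\<^bsub>M\<^esub> x \<in> combinations M (carrier R) ms"
  proof (rule generated_by_tensors[OF fg ms(1) ms(2)[symmetric] _ span])
    show "\<exists>s\<in>carrier R - I. ws ! i = ext.tensor (ms ! i) (fr \<one> s)" if "i < length ms" for i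
      using eq[of i] that ms(2) by (intro bexI) auto
  qed
  then obtain u where "u \<in> carrier R - I" "\<forall>x\<in>carrier M. u \<odot>\<^bsub>M\<^esub> x \<in> combinations M (carrier R) ms" by auto
  then show thesis using that[of ms ss u] ms ss eq(1) by simp
qed

text \<open>A generating list may contain repetitions, so a list of length \<open>n\<close> gives a generating set with at
  most \<open>n\<close> elements, and only the minima agree.\<close>

theorem local_min_generators_eq:
  assumes fg: "finitely_generated_module R M"
  shows "local_min_generators R I M = (LEAST n. locally_generated R I M n)"
  unfolding local_min_generators_def T_eq A_eq min_generators_def
proof (rule least_eq_least)
  fix n assume "\<exists>S. finite S \<and> card S = n \<and> S \<subseteq> carrier T \<and> module_span A T S = carrier T"
  then obtain S where S: "finite S" "card S = n" "S \<subseteq> carrier T" "module_span A T S = carrier T" by auto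
  obtain ws where ws: "set ws = S" "length ws = n"
    using finite_distinct_list[OF S(1)] distinct_card S(2) by metis
  have "carrier T \<subseteq> combinations T (carrier A) ws"
    using T.span_eq_combinations[of ws] S ws by simp
  then obtain ms u where "length ms = n" "set ms \<subseteq> carrier M" "u \<in> carrier R - I"
      "\<forall>x\<in>carrier M. u \<odot>\<^bsub>M\<^esub> x \<in> combinations M (carrier R) ms"
    using generators_imp_locally_generated[OF fg, of ws] S(3) ws by metis
  then show "locally_generated R I M n" unfolding locally_generated_def by auto
next
  fix n assume "locally_generated R I M n"
  then obtain ms u where ms: "length ms = n" "set ms \<subseteq> carrier M" "u \<in> carrier R - I"
      "\<forall>x\<in>carrier M. u \<odot>\<^bsub>M\<^esub> x \<in> combinations M (carrier R) ms"
    unfolding locally_generated_def by auto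
  let ?ts = "map (\<lambda>m. ext.tensor m \<one>\<^bsub>A\<^esub>) ms"
  have "set ?ts \<subseteq> carrier T" using ms(2) by (auto simp del: oneA)
  moreover have "module_span A T (set ?ts) = carrier T"
    using T.span_eq_combinations[OF calculation] tensors_generate[OF ms(2-4)] by simp
  moreover have "card (set ?ts) \<le> n" using card_length[of ?ts] ms(1) by simp
  ultimately show "\<exists>m\<le>n. \<exists>S. finite S \<and> card S = m \<and> S \<subseteq> carrier T \<and> module_span A T S = carrier T"
    by (intro exI[of _ "card (set ?ts)"] conjI exI[of _ "set ?ts"] refl finite_set)
next
  obtain ps where ps: "set ps \<subseteq> carrier M" "carrier M = combinations M (carrier R) ps"
    using fg finitely_generated_iff by auto
  have "locally_generated R I M (length ps)"
    unfolding locally_generated_def using ps by (intro exI[of _ ps] exI[of _ \<one>]) auto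
  then show "\<exists>n. locally_generated R I M n" by (rule exI)
qed

lemma common_denominator:
  "set as \<subseteq> carrier A \<Longrightarrow>
    \<exists>s\<in>carrier R - I. \<exists>rs. set rs \<subseteq> carrier R \<and> length rs = length as \<and> as = map (\<lambda>r. fr r s) rs"
proof (induction as)
  case Nil
  then show ?case using frac.one_in_S by (intro bexI[of _ \<one>] exI[of _ "[]"]) auto
next
  case (Cons a as)
  then obtain s rs where s: "s \<in> carrier R - I" "set rs \<subseteq> carrier R" "length rs = length as"
      "as = map (\<lambda>r. fr r s) rs" by auto
  have "a \<in> carrier A" using Cons.prems by simp
  then obtain r t where rt: "r \<in> carrier R" "t \<in> carrier R - I" "a = fr r t" by (rule frac.fractionE)
  have st: "s \<otimes> t \<in> carrier R - I" using s(1) rt(2) by (rule frac.S_mult)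
  have R: "s \<in> carrier R" "t \<in> carrier R" using s rt by auto
  have "fr r t = fr (r \<otimes> s) (s \<otimes> t)"
    using rt R st by (subst frac.fraction_eq_iff) (auto simp: R.m_ac)
  moreover have "fr q s = fr (q \<otimes> t) (s \<otimes> t)" if "q \<in> set rs" for q
    using that s(1,2) R st by (subst frac.fraction_eq_iff) (auto simp: R.m_ac)
  ultimately have "a # as = map (\<lambda>r. fr r (s \<otimes> t)) ((r \<otimes> s) # map (\<lambda>q. q \<otimes> t) rs)"
    using rt(3) s(4) by simp
  moreover have "set ((r \<otimes> s) # map (\<lambda>q. q \<otimes> t) rs) \<subseteq> carrier R" using s(2) R rt(1) by auto
  ultimately show ?case using st s(3)
    by (intro bexI[OF _ st] exI[of _ "(r \<otimes> s) # map (\<lambda>q. q \<otimes> t) rs"]) simp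
qed

text \<open>Each coordinate of \<open>u x\<close>, divided by \<open>u\<close>, is a linear form on \<open>M\<close> with values in \<open>A\<close>; its extension
  to the localisation detects the corresponding coefficient.\<close>

lemma tensors_independent:
  assumes ind: "lin_independent R M ms" and u: "u \<in> carrier R - I"
    and span: "\<forall>x\<in>carrier M. u \<odot>\<^bsub>M\<^esub> x \<in> combinations M (carrier R) ms"
  shows "lin_independent A T (map (\<lambda>m. ext.tensor m \<one>\<^bsub>A\<^esub>) ms)"
  unfolding lin_independent_def
proof (intro conjI allI impI)
  let ?ts = "map (\<lambda>m. ext.tensor m \<one>\<^bsub>A\<^esub>) ms"
  have ms: "set ms \<subseteq> carrier M" using ind unfolding lin_independent_def by simp
  show "set ?ts \<subseteq> carrier T" using ms by (auto simp del: oneA)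
  fix as assume as: "length as = length ?ts \<and> set as \<subseteq> carrier A \<and> lincomb T as ?ts = \<zero>\<^bsub>T\<^esub>"
  have uR: "u \<in> carrier R" "u \<noteq> \<zero>" using u I.zero_closed by auto
  from coordinates[OF ind uR(1) span] obtain coord where coord': "\<forall>x\<in>carrier M. length (coord x) = length ms \<and> set (coord x) \<subseteq> carrier R \<and>
      lincomb M (coord x) ms = u \<odot>\<^bsub>M\<^esub> x"
    "\<forall>x\<in>carrier M. \<forall>y\<in>carrier M. coord (x \<oplus>\<^bsub>M\<^esub> y) = map2 (\<oplus>) (coord x) (coord y)"
    "\<forall>r\<in>carrier R. \<forall>x\<in>carrier M. coord (r \<odot>\<^bsub>M\<^esub> x) = map ((\<otimes>) r) (coord x)"
    "\<forall>cs. length cs = length ms \<and> set cs \<subseteq> carrier R \<longrightarrow> coord (lincomb M cs ms) = map ((\<otimes>) u) cs"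
    by (elim exE conjE)
  have coord:
    "\<And>x. x \<in> carrier M \<Longrightarrow> length (coord x) = length ms"
    "\<And>x. x \<in> carrier M \<Longrightarrow> set (coord x) \<subseteq> carrier R"
    "\<And>x. x \<in> carrier M \<Longrightarrow> lincomb M (coord x) ms = u \<odot>\<^bsub>M\<^esub> x"
    "\<And>x y. x \<in> carrier M \<Longrightarrow> y \<in> carrier M \<Longrightarrow> coord (x \<oplus>\<^bsub>M\<^esub> y) = map2 (\<oplus>) (coord x) (coord y)"
    "\<And>r x. r \<in> carrier R \<Longrightarrow> x \<in> carrier M \<Longrightarrow> coord (r \<odot>\<^bsub>M\<^esub> x) = map ((\<otimes>) r) (coord x)"
    "\<And>cs. length cs = length ms \<Longrightarrow> set cs \<subseteq> carrier R \<Longrightarrow> coord (lincomb M cs ms) = map ((\<otimes>) u) cs"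
    using coord' by auto
  obtain s rs where rs: "s \<in> carrier R - I" "set rs \<subseteq> carrier R" "length rs = length as"
      "as = map (\<lambda>r. fr r s) rs" using common_denominator[of as] as by auto
  have sR: "s \<in> carrier R" using rs by auto
  define y where "y = lincomb M rs ms"
  have y: "y \<in> carrier M" unfolding y_def using rs(2) ms by simp
  have b: "fr \<one> s \<in> carrier A" using rs(1) by simp
  have "as = map (\<lambda>r. fr r \<one> \<otimes>\<^bsub>A\<^esub> fr \<one> s) rs" unfolding rs(4)
  proof (rule map_cong[OF refl])
    fix r assume "r \<in> set rs"
    then have "r \<in> carrier R" using rs(2) by auto
    then show "fr r s = fr r \<one> \<otimes>\<^bsub>A\<^esub> fr \<one> s"
      using frac.fraction_mult[OF _ frac.one_in_S R.one_closed rs(1)] sR by simp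
  qed
  then have ty: "ext.tensor y (fr \<one> s) = \<zero>\<^bsub>T\<^esub>"
    unfolding y_def ext.tensor_lincomb[OF b rs(2) ms] using as by (simp only:)
  have "rs ! i = \<zero>" if i: "i < length ms" for i
  proof -
    have cR: "coord x ! i \<in> carrier R" if "x \<in> carrier M" for x
      using coord(1,2)[OF that] i nth_mem[of i "coord x"] by auto
    define \<beta> where "\<beta> = (\<lambda>x a. fr (coord x ! i) u \<otimes>\<^bsub>A\<^esub> a)"
    have fA: "fr (coord x ! i) u \<in> carrier A" if "x \<in> carrier M" for x
      by (rule frac.fraction_closed[OF cR[OF that] u])
    obtain h where h: "h \<in> carrier T \<rightarrow> carrier A"
      "\<forall>u\<in>carrier T. \<forall>v\<in>carrier T. h (u \<oplus>\<^bsub>T\<^esub> v) = h u \<oplus>\<^bsub>A\<^esub> h v"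
      "\<forall>x\<in>carrier M. \<forall>a\<in>carrier A. h (ext.tensor x a) = \<beta> x a"
    proof (rule ext.tensor_universal[of A \<beta>])
      show "abelian_group A" by (rule ext.A.is_abelian_group)
      show "\<beta> x a \<in> carrier A" if "x \<in> carrier M" "a \<in> carrier A" for x a
        unfolding \<beta>_def using fA that by simp
      show "\<beta> (x \<oplus>\<^bsub>M\<^esub> y) a = \<beta> x a \<oplus>\<^bsub>A\<^esub> \<beta> y a"
        if c: "x \<in> carrier M" "y \<in> carrier M" "a \<in> carrier A" for x y a
      proof -
        have "coord (x \<oplus>\<^bsub>M\<^esub> y) ! i = coord x ! i \<oplus> coord y ! i"
          using coord(4)[OF c(1,2)] coord(1)[OF c(1)] coord(1)[OF c(2)] i by simp
        moreover have "fr (coord x ! i \<oplus> coord y ! i) u = fr (coord x ! i) u \<oplus>\<^bsub>A\<^esub> fr (coord y ! i) u"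
        proof -
          have "fr (coord x ! i) u \<oplus>\<^bsub>A\<^esub> fr (coord y ! i) u =
              fr (coord x ! i \<otimes> u \<oplus> coord y ! i \<otimes> u) (u \<otimes> u)"
            by (rule frac.fraction_add[OF cR[OF c(1)] u cR[OF c(2)] u])
          also have "\<dots> = fr (coord x ! i \<oplus> coord y ! i) u"
            using cR[OF c(1)] cR[OF c(2)] uR(1) u frac.S_mult[OF u u]
            by (subst frac.fraction_eq_iff) (auto simp: R.l_distr R.m_assoc)
          finally show ?thesis by (rule sym)
        qed
        ultimately show ?thesis unfolding \<beta>_def using fA c ext.A.l_distr by simp
      qed
      show "\<beta> x (a \<oplus>\<^bsub>A\<^esub> b) = \<beta> x a \<oplus>\<^bsub>A\<^esub> \<beta> x b"
        if "x \<in> carrier M" "a \<in> carrier A" "b \<in> carrier A" for x a b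
        unfolding \<beta>_def using fA that ext.A.r_distr by simp
      show "\<beta> (r \<odot>\<^bsub>M\<^esub> x) a = \<beta> x (fr r \<one> \<otimes>\<^bsub>A\<^esub> a)"
        if c: "r \<in> carrier R" "x \<in> carrier M" "a \<in> carrier A" for r x a
      proof -
        have "coord (r \<odot>\<^bsub>M\<^esub> x) ! i = r \<otimes> coord x ! i"
          using coord(5)[OF c(1,2)] coord(1)[OF c(2)] i by simp
        moreover have "fr (r \<otimes> coord x ! i) u = fr (coord x ! i) u \<otimes>\<^bsub>A\<^esub> fr r \<one>"
          using frac.fraction_mult[OF cR[OF c(2)] u c(1) frac.one_in_S] cR[OF c(2)] uR(1) c(1)
          by (simp add: R.m_comm)
        moreover have "fr r \<one> \<in> carrier A" using c(1) by simp
        ultimately show ?thesis unfolding \<beta>_def using fA[OF c(2)] c(3) by (simp only: ext.A.m_assoc)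
      qed
    qed
    have h0: "h \<zero>\<^bsub>T\<^esub> = \<zero>\<^bsub>A\<^esub>"
    proof -
      have "h \<zero>\<^bsub>T\<^esub> = h \<zero>\<^bsub>T\<^esub> \<oplus>\<^bsub>A\<^esub> h \<zero>\<^bsub>T\<^esub>"
        using bspec[OF bspec[OF h(2) T.zero_closed] T.zero_closed] by simp
      moreover have "h \<zero>\<^bsub>T\<^esub> \<in> carrier A" using h(1) T.zero_closed by blast
      ultimately show ?thesis using ext.A.add.l_cancel_one'[of "h \<zero>\<^bsub>T\<^esub>" "h \<zero>\<^bsub>T\<^esub>"] by simp
    qed
    have "\<beta> y (fr \<one> s) = \<zero>\<^bsub>A\<^esub>" using bspec[OF bspec[OF h(3) y] b] ty h0 by simp
    then have "fr (coord y ! i \<otimes> \<one>) (u \<otimes> s) = \<zero>\<^bsub>A\<^esub>"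
      unfolding \<beta>_def using frac.fraction_mult[OF cR[OF y] u R.one_closed rs(1)] by simp
    then have "coord y ! i = \<zero>"
      using frac.fraction_eq_zero_iff[OF _ frac.S_mult[OF u rs(1)], of "coord y ! i \<otimes> \<one>"] cR[OF y] by simp
    moreover have "coord y = map ((\<otimes>) u) rs"
      unfolding y_def by (rule coord(6)) (use rs as in auto)
    ultimately have "u \<otimes> rs ! i = \<zero>" using i rs(3) as by simp
    moreover have "rs ! i \<in> carrier R" by (rule subsetD[OF rs(2) nth_mem]) (use rs(3) as i in simp)
    ultimately show "rs ! i = \<zero>" using D.integral[of u "rs ! i"] uR by auto
  qed
  then have "set rs \<subseteq> {\<zero>}" using rs(3) as by (auto simp: in_set_conv_nth)
  moreover have "fr \<zero> s = \<zero>\<^bsub>A\<^esub>" using frac.fraction_eq_zero_iff[OF R.zero_closed rs(1)] by simp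
  ultimately show "set as \<subseteq> {\<zero>\<^bsub>A\<^esub>}" unfolding rs(4) by auto
qed

text \<open>The members of a basis of the localisation have the form \<open>m / s\<close>. The numerators \<open>m\<close> are independent,
  because a relation with coefficients \<open>c\<close> between them is one with coefficients \<open>c s\<close> between the basis
  elements, and \<open>s \<noteq> 0\<close> in a domain.\<close>

theorem free_of_rank_iff:
  assumes fg: "finitely_generated_module R M"
  shows "free_of_rank (local_ring_at R I) (localised_module R I M) n \<longleftrightarrow> locally_free R I M n"
proof -
  define xs where "xs = [0..<n]"
  have xs: "set xs = {..<n}" "distinct xs" "length xs = n" unfolding xs_def by auto
  let ?F = "free_module A (set xs)"
  interpret F: module A ?F by (rule ext.A.free_module_is_module) simp
  have "free_of_rank A T n \<longleftrightarrow> (\<exists>f. f \<in> mod_hom A ?F T \<and> bij_betw f (carrier ?F) (carrier T))"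
    unfolding free_of_rank_def mod_iso_def xs(1)[symmetric] by auto
  also have "\<dots> \<longleftrightarrow> locally_free R I M n"
  proof
    assume "\<exists>f. f \<in> mod_hom A ?F T \<and> bij_betw f (carrier ?F) (carrier T)"
    then obtain f where f: "f \<in> mod_hom A ?F T" "bij_betw f (carrier ?F) (carrier T)" by auto
    define es where "es = map (unit_vector A (set xs)) xs"
    have es: "set es \<subseteq> carrier ?F" "length es = n"
      unfolding es_def using ext.A.unit_vector_closed[OF finite_set[of xs]] by (auto simp: xs(3))
    define ws where "ws = map f es"
    have fc: "f g \<in> carrier T" if "g \<in> carrier ?F" for g using f(1) that unfolding mod_hom_def by auto
    have ws: "set ws \<subseteq> carrier T" "length ws = n" unfolding ws_def using es fc by auto
    have gA: "set (map g xs) \<subseteq> carrier A" if "g \<in> carrier ?F" for g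
      using that free_module_carrier[of "set xs" A] by auto
    have fg_eq: "f g = lincomb T (map g xs) ws" if g: "g \<in> carrier ?F" for g
    proof -
      have "f g = f (lincomb ?F (map g xs) es)"
        unfolding es_def using ext.A.lincomb_unit_vectors[OF g xs(2)] by simp
      then show ?thesis
        unfolding ws_def
        using mod_hom_lincomb[OF F.module_axioms T.module_axioms f(1) gA[OF g] es(1)] by simp
    qed
    have "carrier T \<subseteq> combinations T (carrier A) ws"
    proof
      fix t assume "t \<in> carrier T"
      then obtain g where g: "g \<in> carrier ?F" "t = f g" using f(2) unfolding bij_betw_def by auto
      then show "t \<in> combinations T (carrier A) ws"
        unfolding combinations_def using fg_eq[OF g(1)] gA[OF g(1)] xs(3) ws(2)
        by (intro CollectI exI[of _ "map g xs"]) simp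
    qed
    then obtain ms ss u where ms: "length ms = length ws" "length ss = length ws" "set ms \<subseteq> carrier M"
      "set ss \<subseteq> carrier R - I" "\<forall>i<length ws. ws ! i = ext.tensor (ms ! i) (fr \<one> (ss ! i))"
      "u \<in> carrier R - I" "\<forall>x\<in>carrier M. u \<odot>\<^bsub>M\<^esub> x \<in> combinations M (carrier R) ms"
      using generators_imp_locally_generated[OF fg ws(1)] by metis
    have "lin_independent R M ms"
      unfolding lin_independent_def
    proof (intro conjI allI impI ms(3))
      fix cs assume cs: "length cs = length ms \<and> set cs \<subseteq> carrier R \<and> lincomb M cs ms = \<zero>\<^bsub>M\<^esub>"
      have csn: "length cs = n" using cs ms(1) ws(2) by simp
      have cR: "cs ! i \<in> carrier R" "ss ! i \<in> carrier R - I" "ms ! i \<in> carrier M" if i: "i < n" for i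
      proof -
        have len: "i < length cs" "i < length ss" "i < length ms" using i csn ms(1,2) ws(2) by auto
        show "cs ! i \<in> carrier R" using subsetD[OF _ nth_mem[OF len(1)]] cs by auto
        show "ss ! i \<in> carrier R - I" by (rule subsetD[OF ms(4) nth_mem[OF len(2)]])
        show "ms ! i \<in> carrier M" by (rule subsetD[OF ms(3) nth_mem[OF len(3)]])
      qed
      have sR: "ss ! i \<in> carrier R" if "i < n" for i using cR(2)[OF that] by simp
      define g where "g = (\<lambda>i\<in>set xs. fr (cs ! i \<otimes> ss ! i) \<one>)"
      have gF: "g \<in> carrier ?F"
        unfolding g_def free_module_carrier[OF finite_set] using cR(1) sR xs(1) by auto
      have "lincomb T (map (\<lambda>c. fr c \<one> \<otimes>\<^bsub>A\<^esub> \<one>\<^bsub>A\<^esub>) cs) (map (\<lambda>m. ext.tensor m \<one>\<^bsub>A\<^esub>) ms) =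
          lincomb T (map g xs) ws"
      proof (rule lincomb_cong)
        fix i assume "i < length (map (\<lambda>c. fr c \<one> \<otimes>\<^bsub>A\<^esub> \<one>\<^bsub>A\<^esub>) cs)"
        then have i: "i < n" using csn by simp
        note c = cR[OF i] sR[OF i]
        have "(fr (cs ! i) \<one> \<otimes>\<^bsub>A\<^esub> \<one>\<^bsub>A\<^esub>) \<odot>\<^bsub>T\<^esub> ext.tensor (ms ! i) \<one>\<^bsub>A\<^esub> = ext.tensor (ms ! i) (fr (cs ! i) \<one>)"
          using c by (simp add: ext.smult_tensor)
        also have "\<dots> = ext.tensor (ms ! i) (fr (cs ! i \<otimes> ss ! i) \<one> \<otimes>\<^bsub>A\<^esub> fr \<one> (ss ! i))"
        proof -
          have "fr (cs ! i) \<one> = fr (cs ! i \<otimes> ss ! i) \<one> \<otimes>\<^bsub>A\<^esub> fr \<one> (ss ! i)"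
            using c by (subst frac.fraction_mult) (auto simp: frac.fraction_eq_iff)
          then show ?thesis by (simp only:)
        qed
        also have "\<dots> = fr (cs ! i \<otimes> ss ! i) \<one> \<odot>\<^bsub>T\<^esub> ws ! i"
          using c i ms(5) ws(2) by (subst ext.smult_tensor[symmetric]) auto
        finally show "map (\<lambda>c. fr c \<one> \<otimes>\<^bsub>A\<^esub> \<one>\<^bsub>A\<^esub>) cs ! i \<odot>\<^bsub>T\<^esub> map (\<lambda>m. ext.tensor m \<one>\<^bsub>A\<^esub>) ms ! i =
            map g xs ! i \<odot>\<^bsub>T\<^esub> ws ! i"
          using i csn ms(1) ws(2) xs unfolding g_def xs_def by simp
      qed (use csn ms(1) ws(2) xs(3) in auto)
      also have "lincomb T (map (\<lambda>c. fr c \<one> \<otimes>\<^bsub>A\<^esub> \<one>\<^bsub>A\<^esub>) cs) (map (\<lambda>m. ext.tensor m \<one>\<^bsub>A\<^esub>) ms) =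
          ext.tensor (lincomb M cs ms) \<one>\<^bsub>A\<^esub>"
        by (rule ext.tensor_lincomb[symmetric]) (use cs ms(3) ext.A.one_closed in auto)
      also have "\<dots> = \<zero>\<^bsub>T\<^esub>" using cs ext.tensor_zero_left[OF ext.A.one_closed] by simp
      finally have "f g = \<zero>\<^bsub>T\<^esub>" using fg_eq[OF gF] by simp
      then have "f g = f \<zero>\<^bsub>?F\<^esub>" using mod_hom_zero[OF F.module_axioms T.module_axioms f(1)] by simp
      then have "g = \<zero>\<^bsub>?F\<^esub>" using f(2) gF F.zero_closed unfolding bij_betw_def inj_on_def by blast
      then have g0: "g i = \<zero>\<^bsub>A\<^esub>" if "i < n" for i using that xs(1) by simp
      have "cs ! i = \<zero>" if i: "i < n" for i
      proof -
        have "fr (cs ! i \<otimes> ss ! i) \<one> = \<zero>\<^bsub>A\<^esub>" using g0[OF i] i xs(1) unfolding g_def by simp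
        then have "cs ! i \<otimes> ss ! i = \<zero>"
          using frac.fraction_eq_zero_iff[OF _ frac.one_in_S, of "cs ! i \<otimes> ss ! i"] cR(1)[OF i] sR[OF i] by simp
        then show ?thesis
          using D.integral[OF _ cR(1)[OF i] sR[OF i]] cR(2)[OF i] I.zero_closed by auto
      qed
      then show "set cs \<subseteq> {\<zero>}" using csn by (auto simp: in_set_conv_nth)
    qed
    then show "locally_free R I M n" unfolding locally_free_def using ms ws(2) by auto
  next
    assume "locally_free R I M n"
    then obtain ms u where ms: "length ms = n" "lin_independent R M ms" "u \<in> carrier R - I"
        "\<forall>x\<in>carrier M. u \<odot>\<^bsub>M\<^esub> x \<in> combinations M (carrier R) ms"
      unfolding locally_free_def by auto
    have msM: "set ms \<subseteq> carrier M" using ms(2) unfolding lin_independent_def by simp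
    let ?ts = "map (\<lambda>m. ext.tensor m \<one>\<^bsub>A\<^esub>) ms"
    have ts: "set ?ts \<subseteq> carrier T" using msM by (auto simp del: oneA)
    define f where "f = (\<lambda>g. lincomb T (map g xs) ?ts)"
    have hom: "f \<in> mod_hom A ?F T"
      unfolding f_def by (rule T.free_module_lincomb_hom[OF ts]) (simp add: ms(1) xs(3))
    have ind: "lin_independent A T ?ts" by (rule tensors_independent[OF ms(2-4)])
    have gA: "set (map g xs) \<subseteq> carrier A" if "g \<in> carrier ?F" for g
      using that free_module_carrier[of "set xs" A] by auto
    have "inj_on f (carrier ?F)"
    proof (rule inj_onI)
      fix g h assume gh: "g \<in> carrier ?F" "h \<in> carrier ?F" "f g = f h"
      have "map g xs = map h xs"
        by (rule T.lin_independent_unique[OF ind _ _ gA[OF gh(1)] gA[OF gh(2)]])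
           (use gh(3) ms(1) xs(3) in \<open>auto simp: f_def\<close>)
      then have "\<forall>i\<in>set xs. g i = h i" by simp
      moreover have "g \<in> set xs \<rightarrow>\<^sub>E carrier A" "h \<in> set xs \<rightarrow>\<^sub>E carrier A"
        using gh(1,2) free_module_carrier[of "set xs" A] by auto
      ultimately show "g = h" by (metis PiE_ext)
    qed
    moreover have "f ` carrier ?F = carrier T"
    proof
      show "f ` carrier ?F \<subseteq> carrier T" using hom unfolding mod_hom_def by auto
      show "carrier T \<subseteq> f ` carrier ?F"
      proof
        fix t assume "t \<in> carrier T"
        then have "t \<in> combinations T (carrier A) ?ts"
          using tensors_generate[OF msM ms(3,4)] by simp
        then obtain g where "g \<in> carrier ?F" "lincomb T (map g xs) ?ts = t"
          using T.free_module_lincomb_surj[OF xs(2), of ?ts t] ms(1) xs(3) by auto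
        then show "t \<in> f ` carrier ?F" unfolding f_def by auto
      qed
    qed
    ultimately show "\<exists>f. f \<in> mod_hom A ?F T \<and> bij_betw f (carrier ?F) (carrier T)"
      using hom unfolding bij_betw_def by (intro exI[of _ f]) simp
  qed
  finally show ?thesis unfolding T_eq A_eq .
qed

end


section \<open>Locally free modules are projective\<close>

lemma (in noetherian_ring) exists_maximal_ideal_above:
  assumes "ideal L R" "L \<noteq> carrier R"
  obtains I where "maximalideal I R" "L \<subseteq> I"
proof -
  let ?J = "{J. ideal J R \<and> L \<subseteq> J \<and> J \<noteq> carrier R}"
  have ne: "?J \<noteq> {}" using assms by auto
  have ideals: "ideal J R" if "J \<in> ?J" for J using that by simp
  show thesis
  proof (rule ideal_maximal_element[OF ne ideals])
    fix I assume I: "I \<in> ?J" and max: "\<And>K. K \<in> ?J \<Longrightarrow> I \<subseteq> K \<Longrightarrow> K = I"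
    have "maximalideal I R"
    proof (rule maximalidealI)
      show "ideal I R" "carrier R \<noteq> I" using I by auto
      show "K = I \<or> K = carrier R" if K: "ideal K R" "I \<subseteq> K" "K \<subseteq> carrier R" for K
        using max[of K] I K(1,2) by auto
    qed
    moreover have "L \<subseteq> I" using I by simp
    ultimately show thesis by (rule that)
  qed
qed

lemma mod_hom_comp_add:
  assumes "module R M" "module R N" "f \<in> mod_hom R M N" "g \<in> mod_hom R M N"
  shows "(\<lambda>x. f x \<oplus>\<^bsub>N\<^esub> g x) \<in> mod_hom R M N"
proof -
  interpret N: module R N by fact
  have c: "f x \<in> carrier N" "g x \<in> carrier N" if "x \<in> carrier M" for x
    using assms that unfolding mod_hom_def by auto
  show ?thesis
    using assms(3,4) c unfolding mod_hom_def by (auto simp: N.M.a_ac N.smult_r_distr)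
qed

lemma mod_hom_comp_smult:
  assumes "module R M" "module R N" "f \<in> mod_hom R M N" "a \<in> carrier R"
  shows "(\<lambda>x. a \<odot>\<^bsub>N\<^esub> f x) \<in> mod_hom R M N"
proof -
  interpret N: module R N by fact
  have c: "f x \<in> carrier N" if "x \<in> carrier M" for x
    using assms that unfolding mod_hom_def by auto
  show ?thesis
    using assms(3,4) c unfolding mod_hom_def
    by (auto simp: N.smult_r_distr N.smult_assoc1[symmetric] N.R.m_comm)
qed

text \<open>A section of the surjection from a free module exhibits \<open>M\<close> as a direct summand.\<close>

lemma (in module) projective_if_section:
  fixes xs :: "'c list"
  assumes xs: "set xs \<subseteq> carrier M" "distinct xs"
    and \<sigma>: "\<sigma> \<in> mod_hom R M (free_module R (set xs))"
    and sec: "\<And>x. x \<in> carrier M \<Longrightarrow> lincomb M (map (\<sigma> x) xs) xs = x"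
  shows "projective_module R M"
proof -
  let ?F = "free_module R (set xs)"
  interpret F: module R ?F by (rule R.free_module_is_module) simp
  define \<pi> where "\<pi> = (\<lambda>g. lincomb M (map g xs) xs)"
  have \<pi>: "\<pi> \<in> mod_hom R ?F M" unfolding \<pi>_def by (rule free_module_lincomb_hom[OF xs(1) refl])
  have \<pi>c: "\<pi> g \<in> carrier M" if "g \<in> carrier ?F" for g using \<pi> that unfolding mod_hom_def by auto
  have \<pi>a: "\<pi> (g \<oplus>\<^bsub>?F\<^esub> h) = \<pi> g \<oplus>\<^bsub>M\<^esub> \<pi> h" if "g \<in> carrier ?F" "h \<in> carrier ?F" for g h
    using \<pi> that unfolding mod_hom_def by blast
  have \<pi>s: "\<pi> (r \<odot>\<^bsub>?F\<^esub> g) = r \<odot>\<^bsub>M\<^esub> \<pi> g" if "r \<in> carrier R" "g \<in> carrier ?F" for r g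
    using \<pi> that unfolding mod_hom_def by blast
  have \<sigma>c: "\<sigma> x \<in> carrier ?F" if "x \<in> carrier M" for x using \<sigma> that unfolding mod_hom_def by auto
  have \<sigma>a: "\<sigma> (x \<oplus>\<^bsub>M\<^esub> y) = \<sigma> x \<oplus>\<^bsub>?F\<^esub> \<sigma> y" if "x \<in> carrier M" "y \<in> carrier M" for x y
    using \<sigma> that unfolding mod_hom_def by blast
  have \<sigma>s: "\<sigma> (r \<odot>\<^bsub>M\<^esub> x) = r \<odot>\<^bsub>?F\<^esub> \<sigma> x" if "r \<in> carrier R" "x \<in> carrier M" for r x
    using \<sigma> that unfolding mod_hom_def by blast
  have \<pi>\<sigma>: "\<pi> (\<sigma> x) = x" if "x \<in> carrier M" for x unfolding \<pi>_def by (rule sec[OF that])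
  have \<pi>0: "\<pi> \<zero>\<^bsub>?F\<^esub> = \<zero>\<^bsub>M\<^esub>" by (rule mod_hom_zero[OF F.module_axioms module_axioms \<pi>])
  have \<sigma>0: "\<sigma> \<zero>\<^bsub>M\<^esub> = \<zero>\<^bsub>?F\<^esub>" by (rule mod_hom_zero[OF module_axioms F.module_axioms \<sigma>])
  have neg: "\<ominus>\<^bsub>?F\<^esub> g = (\<ominus> \<one>) \<odot>\<^bsub>?F\<^esub> g" if "g \<in> carrier ?F" for g
    using that F.smult_l_minus[OF R.one_closed that] F.smult_one[OF that] by (simp del: free_module_simps)
  define P where "P = \<sigma> ` carrier M"
  define Q where "Q = {g \<in> carrier ?F. \<pi> g = \<zero>\<^bsub>M\<^esub>}"
  have PI: "\<sigma> x \<in> P" if "x \<in> carrier M" for x unfolding P_def using that by (rule imageI)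
  have QI: "g \<in> Q" if "g \<in> carrier ?F" "\<pi> g = \<zero>\<^bsub>M\<^esub>" for g unfolding Q_def using that by simp
  have Psm: "r \<odot>\<^bsub>?F\<^esub> g \<in> P" if r: "r \<in> carrier R" and g: "g \<in> P" for r g
  proof -
    obtain x where x: "x \<in> carrier M" "g = \<sigma> x" using g unfolding P_def by auto
    show ?thesis unfolding x(2) \<sigma>s[OF r x(1), symmetric] by (rule PI) (use r x in auto)
  qed
  have Qsm: "r \<odot>\<^bsub>?F\<^esub> g \<in> Q" if r: "r \<in> carrier R" and g: "g \<in> Q" for r g
  proof -
    have g': "g \<in> carrier ?F" "\<pi> g = \<zero>\<^bsub>M\<^esub>" using g unfolding Q_def by auto
    show ?thesis by (rule QI[OF F.smult_closed[OF r g'(1)]]) (simp only: \<pi>s[OF r g'(1)] g'(2) smult_r_null[OF r])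
  qed
  have P: "submodule P R ?F"
  proof (rule F.submoduleI)
    show "P \<subseteq> carrier ?F" unfolding P_def using \<sigma>c by auto
    show "\<zero>\<^bsub>?F\<^esub> \<in> P" using PI[OF M.zero_closed] \<sigma>0 by simp
    show "r \<odot>\<^bsub>?F\<^esub> g \<in> P" if "r \<in> carrier R" "g \<in> P" for r g using Psm that .
    show "\<ominus>\<^bsub>?F\<^esub> g \<in> P" if "g \<in> P" for g
      using neg[of g] Psm[of "\<ominus> \<one>" g] that \<sigma>c unfolding P_def by auto
    show "g \<oplus>\<^bsub>?F\<^esub> h \<in> P" if gh: "g \<in> P" "h \<in> P" for g h
    proof -
      obtain x y where xy: "x \<in> carrier M" "g = \<sigma> x" "y \<in> carrier M" "h = \<sigma> y"
        using gh unfolding P_def by auto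
      show ?thesis unfolding xy(2,4) \<sigma>a[OF xy(1,3), symmetric] by (rule PI) (use xy in auto)
    qed
  qed
  have Q: "submodule Q R ?F"
  proof (rule F.submoduleI)
    show "Q \<subseteq> carrier ?F" unfolding Q_def by auto
    show "\<zero>\<^bsub>?F\<^esub> \<in> Q" by (rule QI[OF F.zero_closed \<pi>0])
    show "r \<odot>\<^bsub>?F\<^esub> g \<in> Q" if "r \<in> carrier R" "g \<in> Q" for r g using Qsm that .
    show "\<ominus>\<^bsub>?F\<^esub> g \<in> Q" if "g \<in> Q" for g
    proof -
      have "g \<in> carrier ?F" using that unfolding Q_def by simp
      then show ?thesis using neg[of g] Qsm[OF _ that, of "\<ominus> \<one>"] by simp
    qed
    show "g \<oplus>\<^bsub>?F\<^esub> h \<in> Q" if gh: "g \<in> Q" "h \<in> Q" for g h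
    proof -
      have c: "g \<in> carrier ?F" "h \<in> carrier ?F" "\<pi> g = \<zero>\<^bsub>M\<^esub>" "\<pi> h = \<zero>\<^bsub>M\<^esub>" using gh unfolding Q_def by auto
      show ?thesis
        by (rule QI[OF F.a_closed[OF c(1,2)]])
           (simp only: \<pi>a[OF c(1,2)] c(3,4) M.l_zero[OF M.zero_closed])
    qed
  qed
  have "P \<inter> Q = {\<zero>\<^bsub>?F\<^esub>}"
  proof
    show "P \<inter> Q \<subseteq> {\<zero>\<^bsub>?F\<^esub>}"
    proof
      fix g assume g: "g \<in> P \<inter> Q"
      then obtain x where x: "x \<in> carrier M" "g = \<sigma> x" unfolding P_def by auto
      have "\<pi> g = \<zero>\<^bsub>M\<^esub>" using g unfolding Q_def by simp
      then have "x = \<zero>\<^bsub>M\<^esub>" using \<pi>\<sigma>[OF x(1)] x(2) by simp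
      then show "g \<in> {\<zero>\<^bsub>?F\<^esub>}" using x(2) \<sigma>0 by simp
    qed
    show "{\<zero>\<^bsub>?F\<^esub>} \<subseteq> P \<inter> Q" using F.zero_in_submodule[OF P] F.zero_in_submodule[OF Q] by simp
  qed
  moreover have "P <+>\<^bsub>?F\<^esub> Q = carrier ?F"
  proof
    show "P <+>\<^bsub>?F\<^esub> Q \<subseteq> carrier ?F"
      unfolding set_add_def' using F.submoduleE(1)[OF P] F.submoduleE(1)[OF Q] F.a_closed
      by (auto simp del: free_module_simps)
    show "carrier ?F \<subseteq> P <+>\<^bsub>?F\<^esub> Q"
    proof
      fix g assume g: "g \<in> carrier ?F"
      define p where "p = \<sigma> (\<pi> g)"
      have p: "p \<in> carrier ?F" "p \<in> P" "\<pi> p = \<pi> g"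
        unfolding p_def using \<sigma>c \<pi>c[OF g] PI \<pi>\<sigma> by auto
      have np: "\<pi> (\<ominus>\<^bsub>?F\<^esub> p) = \<ominus>\<^bsub>M\<^esub> \<pi> g"
        using neg[OF p(1)] \<pi>s[of "\<ominus> \<one>" p] p(1,3) \<pi>c[OF g] smult_l_minus[OF R.one_closed \<pi>c[OF g]] by simp
      have "\<pi> (\<ominus>\<^bsub>?F\<^esub> p \<oplus>\<^bsub>?F\<^esub> g) = \<zero>\<^bsub>M\<^esub>"
        using \<pi>a[OF F.a_inv_closed[OF p(1)] g] np M.l_neg[OF \<pi>c[OF g]] by (simp only:)
      then have "\<ominus>\<^bsub>?F\<^esub> p \<oplus>\<^bsub>?F\<^esub> g \<in> Q" using QI[OF F.a_closed[OF F.a_inv_closed[OF p(1)] g]] by simp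
      moreover have "g = p \<oplus>\<^bsub>?F\<^esub> (\<ominus>\<^bsub>?F\<^esub> p \<oplus>\<^bsub>?F\<^esub> g)" using F.r_neg2[OF p(1) g] by (rule sym)
      ultimately show "g \<in> P <+>\<^bsub>?F\<^esub> Q" unfolding set_add_def' using p(2) by blast
    qed
  qed
  moreover have "\<sigma> \<in> mod_iso R M (?F\<lparr>carrier := P\<rparr>)"
  proof -
    have "inj_on \<sigma> (carrier M)" by (rule inj_on_inverseI[of _ \<pi>]) (rule \<pi>\<sigma>)
    moreover have "\<sigma> \<in> mod_hom R M (?F\<lparr>carrier := P\<rparr>)"
      using \<sigma> PI unfolding mod_hom_def by (auto simp del: free_module_simps)
    ultimately show ?thesis unfolding mod_iso_def bij_betw_def P_def by simp
  qed
  ultimately show ?thesis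
    unfolding projective_module_def Let_def using P Q
    by (intro exI[of _ "set xs"] exI[of _ P] exI[of _ Q]) auto
qed

text \<open>The \<open>s\<close> for which the surjection from a free module has a section up to the factor \<open>s\<close> form an
  ideal. It lies in no maximal ideal \<open>I\<close>: with a local basis at \<open>I\<close>, the element \<open>u x\<close> is lifted by
  lifting the basis and keeping the coordinates.\<close>

theorem (in module) locally_free_imp_projective:
  assumes "noetherian_ring R" and fg: "finitely_generated_module R M"
    and free: "\<And>I. maximalideal I R \<Longrightarrow> \<exists>n. locally_free R I M n"
  shows "projective_module R M"
proof -
  interpret noetherian_ring R by fact
  obtain S where S: "finite S" "S \<subseteq> carrier M" "module_span R M S = carrier M"
    using fg unfolding finitely_generated_module_def by auto
  obtain xs where xs: "set xs = S" "distinct xs" using finite_distinct_list[OF S(1)] by auto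
  have xsM: "set xs \<subseteq> carrier M" and gen: "carrier M = combinations M (carrier R) xs"
    using span_eq_combinations[of xs] S xs by auto
  let ?F = "free_module R (set xs)"
  interpret F: module R ?F by (rule R.free_module_is_module) simp
  define \<pi> where "\<pi> = (\<lambda>g. lincomb M (map g xs) xs)"
  have \<pi>: "\<pi> \<in> mod_hom R ?F M" unfolding \<pi>_def by (rule free_module_lincomb_hom[OF xsM refl])
  have \<pi>a: "\<pi> (g \<oplus>\<^bsub>?F\<^esub> h) = \<pi> g \<oplus>\<^bsub>M\<^esub> \<pi> h" if "g \<in> carrier ?F" "h \<in> carrier ?F" for g h
    using \<pi> that unfolding mod_hom_def by blast
  have \<pi>s: "\<pi> (r \<odot>\<^bsub>?F\<^esub> g) = r \<odot>\<^bsub>M\<^esub> \<pi> g" if "r \<in> carrier R" "g \<in> carrier ?F" for r g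
    using \<pi> that unfolding mod_hom_def by blast
  define L where "L = {s \<in> carrier R. \<exists>g\<in>mod_hom R M ?F. \<forall>x\<in>carrier M. \<pi> (g x) = s \<odot>\<^bsub>M\<^esub> x}"
  have hc: "g x \<in> carrier ?F" if "g \<in> mod_hom R M ?F" "x \<in> carrier M" for g x
    using that unfolding mod_hom_def by auto
  have Lmult: "a \<otimes> s \<in> L" if a: "a \<in> carrier R" and s: "s \<in> L" for a s
  proof -
    obtain g where g: "g \<in> mod_hom R M ?F" "\<forall>x\<in>carrier M. \<pi> (g x) = s \<odot>\<^bsub>M\<^esub> x" and sR: "s \<in> carrier R"
      using s unfolding L_def by auto
    have "\<pi> (a \<odot>\<^bsub>?F\<^esub> g x) = (a \<otimes> s) \<odot>\<^bsub>M\<^esub> x" if "x \<in> carrier M" for x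
      using \<pi>s[OF a hc[OF g(1) that]] g(2) that a sR by (simp add: smult_assoc1 del: free_module_simps)
    moreover have "(\<lambda>x. a \<odot>\<^bsub>?F\<^esub> g x) \<in> mod_hom R M ?F"
      by (rule mod_hom_comp_smult[OF module_axioms F.module_axioms g(1) a])
    ultimately show ?thesis
      unfolding L_def using a sR by (intro CollectI conjI bexI[of _ "\<lambda>x. a \<odot>\<^bsub>?F\<^esub> g x"]) auto
  qed
  have Ladd: "s \<oplus> t \<in> L" if s: "s \<in> L" and t: "t \<in> L" for s t
  proof -
    obtain g where g: "g \<in> mod_hom R M ?F" "\<forall>x\<in>carrier M. \<pi> (g x) = s \<odot>\<^bsub>M\<^esub> x" and sR: "s \<in> carrier R"
      using s unfolding L_def by auto
    obtain h where h: "h \<in> mod_hom R M ?F" "\<forall>x\<in>carrier M. \<pi> (h x) = t \<odot>\<^bsub>M\<^esub> x" and tR: "t \<in> carrier R"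
      using t unfolding L_def by auto
    have "\<pi> (g x \<oplus>\<^bsub>?F\<^esub> h x) = (s \<oplus> t) \<odot>\<^bsub>M\<^esub> x" if "x \<in> carrier M" for x
      using \<pi>a[OF hc[OF g(1) that] hc[OF h(1) that]] g(2) h(2) that sR tR
      by (simp add: smult_l_distr del: free_module_simps)
    moreover have "(\<lambda>x. g x \<oplus>\<^bsub>?F\<^esub> h x) \<in> mod_hom R M ?F"
      by (rule mod_hom_comp_add[OF module_axioms F.module_axioms g(1) h(1)])
    ultimately show ?thesis
      unfolding L_def using sR tR by (intro CollectI conjI bexI[of _ "\<lambda>x. g x \<oplus>\<^bsub>?F\<^esub> h x"]) auto
  qed
  have LR: "s \<in> carrier R" if "s \<in> L" for s using that unfolding L_def by simp
  have local_section: "\<exists>s\<in>L. s \<notin> I" if I: "maximalideal I R" for I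
  proof -
    obtain n ms u where ms: "length ms = n" "lin_independent R M ms" "u \<in> carrier R - I"
        "\<forall>x\<in>carrier M. u \<odot>\<^bsub>M\<^esub> x \<in> combinations M (carrier R) ms"
      using free[OF I] unfolding locally_free_def by auto
    have msM: "set ms \<subseteq> carrier M" using ms(2) unfolding lin_independent_def by simp
    have uR: "u \<in> carrier R" using ms(3) by simp
    from coordinates[OF ms(2) uR ms(4)] obtain coord where coord': "\<forall>x\<in>carrier M. length (coord x) = length ms \<and> set (coord x) \<subseteq> carrier R \<and>
        lincomb M (coord x) ms = u \<odot>\<^bsub>M\<^esub> x"
      "\<forall>x\<in>carrier M. \<forall>y\<in>carrier M. coord (x \<oplus>\<^bsub>M\<^esub> y) = map2 (\<oplus>) (coord x) (coord y)"
      "\<forall>r\<in>carrier R. \<forall>x\<in>carrier M. coord (r \<odot>\<^bsub>M\<^esub> x) = map ((\<otimes>) r) (coord x)"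
      "\<forall>cs. length cs = length ms \<and> set cs \<subseteq> carrier R \<longrightarrow> coord (lincomb M cs ms) = map ((\<otimes>) u) cs"
      by (elim exE conjE)
    have coord:
      "\<And>x. x \<in> carrier M \<Longrightarrow> length (coord x) = length ms"
      "\<And>x. x \<in> carrier M \<Longrightarrow> set (coord x) \<subseteq> carrier R"
      "\<And>x. x \<in> carrier M \<Longrightarrow> lincomb M (coord x) ms = u \<odot>\<^bsub>M\<^esub> x"
      "\<And>x y. x \<in> carrier M \<Longrightarrow> y \<in> carrier M \<Longrightarrow> coord (x \<oplus>\<^bsub>M\<^esub> y) = map2 (\<oplus>) (coord x) (coord y)"
      "\<And>r x. r \<in> carrier R \<Longrightarrow> x \<in> carrier M \<Longrightarrow> coord (r \<odot>\<^bsub>M\<^esub> x) = map ((\<otimes>) r) (coord x)"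
      using coord' by auto
    have "\<forall>m\<in>set ms. \<exists>g. g \<in> carrier ?F \<and> \<pi> g = m"
      using free_module_lincomb_surj[OF xs(2) refl] gen msM unfolding \<pi>_def by auto
    from bchoice[OF this] obtain q where q: "\<forall>m\<in>set ms. q m \<in> carrier ?F \<and> \<pi> (q m) = m" by (elim exE)
    define fs where "fs = map q ms"
    have fs: "set fs \<subseteq> carrier ?F" "length fs = length ms" "map \<pi> fs = ms"
      unfolding fs_def using q by (auto simp: map_idI)
    define g where "g = (\<lambda>x. lincomb ?F (coord x) fs)"
    have "g \<in> mod_hom R M ?F"
      unfolding mod_hom_def
    proof (intro CollectI conjI ballI)
      show "g \<in> carrier M \<rightarrow> carrier ?F"
      proof
        fix x assume "x \<in> carrier M"
        then show "g x \<in> carrier ?F" unfolding g_def by (rule F.lincomb_closed[OF coord(2) fs(1)])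
      qed
      show "g (x \<oplus>\<^bsub>M\<^esub> y) = g x \<oplus>\<^bsub>?F\<^esub> g y" if x: "x \<in> carrier M" and y: "y \<in> carrier M" for x y
        unfolding g_def coord(4)[OF x y]
        by (rule F.lincomb_add) (use coord(1,2) x y fs in auto)
      show "g (r \<odot>\<^bsub>M\<^esub> x) = r \<odot>\<^bsub>?F\<^esub> g x" if r: "r \<in> carrier R" and x: "x \<in> carrier M" for r x
        unfolding g_def coord(5)[OF r x] by (rule F.lincomb_smult[OF r coord(2)[OF x] fs(1)])
    qed
    moreover have "\<pi> (g x) = u \<odot>\<^bsub>M\<^esub> x" if x: "x \<in> carrier M" for x
      unfolding g_def mod_hom_lincomb[OF F.module_axioms module_axioms \<pi> coord(2)[OF x] fs(1)] fs(3)
      by (rule coord(3)[OF x])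
    ultimately have "u \<in> L" unfolding L_def using uR by auto
    then show ?thesis using ms(3) by auto
  qed
  have "L = carrier R"
  proof (rule ccontr)
    assume ne: "L \<noteq> carrier R"
    have "\<zero> \<in> L"
    proof (cases "\<exists>I. maximalideal I R")
      case True
      then obtain s where "s \<in> L" using local_section by auto
      then show ?thesis using Lmult[of \<zero> s] LR by simp
    next
      case False
      \<comment> \<open>A ring without maximal ideals is zero, and so is then the module.\<close>
      have "carrier R = {\<zero>}"
        using exists_maximal_ideal_above[OF zeroideal] False by metis
      then have "\<one> = \<zero>" using R.one_closed by (simp only: singleton_iff)
      then have "x = \<zero>\<^bsub>M\<^esub>" if "x \<in> carrier M" for x
        using smult_one[OF that] smult_l_null[OF that] by simp
      then show ?thesis
        unfolding L_def mod_hom_def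
        by (intro CollectI conjI R.zero_closed bexI[of _ "\<lambda>_. \<zero>\<^bsub>?F\<^esub>"])
           (use mod_hom_zero[OF F.module_axioms module_axioms \<pi>] F.zero_closed in \<open>auto simp del: free_module_simps\<close>)
    qed
    have "ideal L R"
    proof (rule idealI[OF R.ring_axioms])
      show "subgroup L (add_monoid R)"
      proof (rule R.add.subgroupI)
        show "L \<subseteq> carrier R" using LR by auto
        show "L \<noteq> {}" using \<open>\<zero> \<in> L\<close> by auto
        show "\<ominus> s \<in> L" if "s \<in> L" for s using Lmult[of "\<ominus> \<one>" s] that LR by (simp add: R.l_minus)
        show "s \<oplus> t \<in> L" if "s \<in> L" "t \<in> L" for s t using Ladd that .
      qed
      show "a \<otimes> s \<in> L" if "s \<in> L" "a \<in> carrier R" for s a using Lmult that by simp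
      show "s \<otimes> a \<in> L" if "s \<in> L" "a \<in> carrier R" for s a
        using Lmult[of a s] that LR R.m_comm by simp
    qed
    then obtain I where "maximalideal I R" "L \<subseteq> I" using exists_maximal_ideal_above ne by metis
    then show False using local_section by auto
  qed
  then have "\<one> \<in> L" by simp
  then obtain \<sigma> where "\<sigma> \<in> mod_hom R M ?F" "\<forall>x\<in>carrier M. \<pi> (\<sigma> x) = \<one> \<odot>\<^bsub>M\<^esub> x"
    unfolding L_def by auto
  then show ?thesis
    using projective_if_section[OF xsM xs(2), of \<sigma>] unfolding \<pi>_def by simp
qed


section \<open>Invariants of the finite quotients\<close>

text \<open>All that is used about the completions. The surjections onto different quotients are unrelated; in
  particular they need not come from a homomorphism between \<open>M\<close> and \<open>N\<close>.\<close>

definition covers_finite_quotients :: "('a, 'r) ring_scheme \<Rightarrow> ('a, 'm, 'k) module_scheme \<Rightarrow>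
    ('a, 'n, 'l) module_scheme \<Rightarrow> bool" where
  "covers_finite_quotients R M N \<longleftrightarrow> (\<forall>H\<in>cofinite_submodules R N.
     \<exists>g\<in>mod_hom R M (quotient_module N H). g ` carrier M = carrier (quotient_module N H))"

lemma (in module) covers_finite_quotientsE:
  assumes "covers_finite_quotients R L M" "submodule H R M" "finite_index M H"
  obtains g where "g \<in> mod_hom R L (quotient_module M H)"
    "g ` carrier L = carrier (quotient_module M H)"
proof -
  have "H \<in> cofinite_submodules R M" using assms cofinite_iff by simp
  from bspec[OF assms(1)[unfolded covers_finite_quotients_def] this] that show thesis by (elim bexE)
qed

text \<open>What kills \<open>M\<close> kills every finite quotient of \<open>N\<close>, and \<open>N\<close> is residually finite.\<close>

lemma annihilator_subset:
  assumes R: "noetherian_ring R" "finitely_generated_ring R" and M: "module R M" and N: "module R N"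
    and fg: "finitely_generated_module R N" and cov: "covers_finite_quotients R M N"
  shows "annihilator R M \<subseteq> annihilator R N"
proof
  interpret M: module R M by fact
  interpret N: module R N by fact
  fix r assume r: "r \<in> annihilator R M"
  then have rR: "r \<in> carrier R" and rM: "\<And>x. x \<in> carrier M \<Longrightarrow> r \<odot>\<^bsub>M\<^esub> x = \<zero>\<^bsub>M\<^esub>"
    unfolding annihilator_def by auto
  have "r \<odot>\<^bsub>N\<^esub> y = \<zero>\<^bsub>N\<^esub>" if y: "y \<in> carrier N" for y
  proof (rule ccontr)
    assume nz: "r \<odot>\<^bsub>N\<^esub> y \<noteq> \<zero>\<^bsub>N\<^esub>"
    have ry: "r \<odot>\<^bsub>N\<^esub> y \<in> carrier N" using rR y by simp
    obtain H where H: "submodule H R N" "finite_index N H" "r \<odot>\<^bsub>N\<^esub> y \<notin> H"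
      using N.residually_finite[OF R fg ry nz] by metis
    let ?Q = "quotient_module N H"
    obtain g where g: "g \<in> mod_hom R M ?Q" "g ` carrier M = carrier ?Q"
      by (rule N.covers_finite_quotientsE[OF cov H(1,2)])
    have "H +>\<^bsub>N\<^esub> y \<in> g ` carrier M" unfolding g(2) N.quotient_carrier using y by simp
    then obtain x where x: "x \<in> carrier M" "g x = H +>\<^bsub>N\<^esub> y" by auto
    have smult: "g (s \<odot>\<^bsub>M\<^esub> x) = H +>\<^bsub>N\<^esub> (s \<odot>\<^bsub>N\<^esub> y)" if "s \<in> carrier R" for s
    proof -
      have "g (s \<odot>\<^bsub>M\<^esub> x) = s \<odot>\<^bsub>?Q\<^esub> g x" using g(1) that x(1) unfolding mod_hom_def by blast
      then show ?thesis unfolding x(2) N.quotient_smult[OF H(1) that y] .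
    qed
    have "r \<odot>\<^bsub>M\<^esub> x = \<zero>\<^bsub>R\<^esub> \<odot>\<^bsub>M\<^esub> x" using rM[OF x(1)] x(1) by simp
    then have "H +>\<^bsub>N\<^esub> (r \<odot>\<^bsub>N\<^esub> y) = H +>\<^bsub>N\<^esub> (\<zero>\<^bsub>R\<^esub> \<odot>\<^bsub>N\<^esub> y)"
      using smult[OF rR] smult[OF M.R.zero_closed] by (simp only:)
    also have "\<dots> = H" using y N.quotient_zero_iff[OF H(1) N.M.zero_closed] N.zero_in_submodule[OF H(1)] by simp
    finally have "r \<odot>\<^bsub>N\<^esub> y \<in> H" using N.quotient_zero_iff[OF H(1) ry] by simp
    with H(3) show False by simp
  qed
  then show "r \<in> annihilator R N" unfolding annihilator_def using rR by auto
qed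

lemma mod_hom_quotient_lincomb:
  assumes "module R M" "module R N" and H: "submodule H R N" and g: "g \<in> mod_hom R M (quotient_module N H)"
  shows "length ms = length cs \<Longrightarrow> length ns = length cs \<Longrightarrow> set cs \<subseteq> carrier R \<Longrightarrow>
    set ms \<subseteq> carrier M \<Longrightarrow> set ns \<subseteq> carrier N \<Longrightarrow>
    (\<And>i. i < length cs \<Longrightarrow> g (ms ! i) = H +>\<^bsub>N\<^esub> (ns ! i)) \<Longrightarrow>
    g (lincomb M cs ms) = H +>\<^bsub>N\<^esub> (lincomb N cs ns)"
proof (induction cs arbitrary: ms ns)
  interpret M: module R M by fact
  interpret N: module R N by fact
  case Nil
  have "g (\<zero>\<^bsub>R\<^esub> \<odot>\<^bsub>M\<^esub> \<zero>\<^bsub>M\<^esub>) = \<zero>\<^bsub>R\<^esub> \<odot>\<^bsub>quotient_module N H\<^esub> g \<zero>\<^bsub>M\<^esub>"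
    using g M.R.zero_closed M.M.zero_closed unfolding mod_hom_def by blast
  moreover have "g \<zero>\<^bsub>M\<^esub> \<in> carrier (quotient_module N H)" using g unfolding mod_hom_def by auto
  then obtain y where y: "y \<in> carrier N" "g \<zero>\<^bsub>M\<^esub> = H +>\<^bsub>N\<^esub> y" unfolding N.quotient_carrier by auto
  ultimately have "g \<zero>\<^bsub>M\<^esub> = H +>\<^bsub>N\<^esub> \<zero>\<^bsub>N\<^esub>"
    using N.quotient_smult[OF H M.R.zero_closed y(1)] by simp
  then show ?case by simp
next
  interpret M: module R M by fact
  interpret N: module R N by fact
  case (Cons c cs)
  then obtain m ms' n ns' where eqs: "ms = m # ms'" "ns = n # ns'" by (metis length_Suc_conv)
  have IH: "g (lincomb M cs ms') = H +>\<^bsub>N\<^esub> (lincomb N cs ns')"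
  proof (rule Cons.IH)
    show "g (ms' ! i) = H +>\<^bsub>N\<^esub> ns' ! i" if "i < length cs" for i
      using Cons.prems(6)[of "Suc i"] that eqs by simp
  qed (use Cons.prems eqs in auto)
  have c: "c \<in> carrier R" "m \<in> carrier M" "n \<in> carrier N"
    "lincomb M cs ms' \<in> carrier M" "lincomb N cs ns' \<in> carrier N" "g m = H +>\<^bsub>N\<^esub> n"
    using Cons.prems eqs Cons.prems(6)[of 0] by auto
  have "g (c \<odot>\<^bsub>M\<^esub> m) = c \<odot>\<^bsub>quotient_module N H\<^esub> g m" using g c unfolding mod_hom_def by blast
  also have "\<dots> = H +>\<^bsub>N\<^esub> (c \<odot>\<^bsub>N\<^esub> n)" using c N.quotient_smult[OF H] by simp
  finally have cm: "g (c \<odot>\<^bsub>M\<^esub> m) = H +>\<^bsub>N\<^esub> (c \<odot>\<^bsub>N\<^esub> n)" .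
  have "g (c \<odot>\<^bsub>M\<^esub> m \<oplus>\<^bsub>M\<^esub> lincomb M cs ms') =
      g (c \<odot>\<^bsub>M\<^esub> m) \<oplus>\<^bsub>quotient_module N H\<^esub> g (lincomb M cs ms')"
    using g M.smult_closed[OF c(1,2)] c(4) unfolding mod_hom_def by blast
  also have "\<dots> = H +>\<^bsub>N\<^esub> (c \<odot>\<^bsub>N\<^esub> n \<oplus>\<^bsub>N\<^esub> lincomb N cs ns')"
    unfolding cm IH by (rule N.quotient_add[OF H N.smult_closed[OF c(1,3)] c(5)])
  finally show ?case unfolding eqs by simp
qed

text \<open>Modulo \<open>I\<close>, generators lift along the surjection onto \<open>N / I N\<close>, which is finite because \<open>R / I\<close>
  is; Nakayama's lemma does the rest.\<close>

lemma locally_generated_transfer: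
  assumes R: "finitely_generated_ring R" and M: "module R M" and N: "module R N"
    and fg: "finitely_generated_module R N" and cov: "covers_finite_quotients R M N"
    and I: "maximalideal I R" and gen: "locally_generated R I M n"
  shows "locally_generated R I N n"
proof -
  interpret M: module R M by fact
  interpret N: module R N by fact
  interpret I: maximalideal I R by fact
  obtain ms u where ms: "length ms = n" "set ms \<subseteq> carrier M" "u \<in> carrier R - I"
      "\<forall>x\<in>carrier M. u \<odot>\<^bsub>M\<^esub> x \<in> combinations M (carrier R) ms"
    using gen unfolding locally_generated_def by auto
  have uR: "u \<in> carrier R" using ms(3) by simp
  obtain ps where ps: "set ps \<subseteq> carrier N" "carrier N = combinations N (carrier R) ps"
    using fg N.finitely_generated_iff by auto
  define H where "H = combinations N I ps"
  have H: "submodule H R N" unfolding H_def by (rule N.combinations_submodule[OF I.is_ideal ps(1)])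
  have Hfin: "finite_index N H"
  proof (rule N.finite_index_by_generators[OF H ps])
    fix p assume p: "p \<in> set ps"
    then have pN: "p \<in> carrier N" using ps(1) by auto
    then have "p \<in> combinations N (carrier R) ps" using ps(2) by simp
    then have "I \<subseteq> {a \<in> carrier R. a \<odot>\<^bsub>N\<^esub> p \<in> H}"
      unfolding H_def using N.smult_in_combinations[OF I.is_ideal _ _ ps(1)] I.a_subset by auto
    then show "finite_index R {a \<in> carrier R. a \<odot>\<^bsub>N\<^esub> p \<in> H}"
      by (rule finite_index_mono[OF cring.maximal_ideal_finite_index[OF module.axioms(1)[OF N] R I]])
  qed
  obtain g where g: "g \<in> mod_hom R M (quotient_module N H)"
      "g ` carrier M = carrier (quotient_module N H)"
    by (rule N.covers_finite_quotientsE[OF cov H Hfin])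
  have "\<forall>m\<in>set ms. \<exists>y. y \<in> carrier N \<and> g m = H +>\<^bsub>N\<^esub> y"
  proof
    fix m assume "m \<in> set ms"
    then have "m \<in> carrier M" using ms(2) by (rule rev_subsetD)
    then have "g m \<in> (\<lambda>y. H +>\<^bsub>N\<^esub> y) ` carrier N"
      unfolding N.quotient_carrier[symmetric] g(2)[symmetric] by (rule imageI)
    then show "\<exists>y. y \<in> carrier N \<and> g m = H +>\<^bsub>N\<^esub> y" by (elim imageE) (intro exI conjI)
  qed
  from bchoice[OF this] obtain q where q: "\<forall>m\<in>set ms. q m \<in> carrier N \<and> g m = H +>\<^bsub>N\<^esub> q m" by (elim exE)
  define ns where "ns = map q ms"
  have ns: "length ns = n" "set ns \<subseteq> carrier N" unfolding ns_def using ms(1) q by auto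
  have "\<exists>h\<in>combinations N (carrier R) ns. \<exists>z\<in>combinations N I ps. u \<odot>\<^bsub>N\<^esub> y = h \<oplus>\<^bsub>N\<^esub> z"
    if y: "y \<in> carrier N" for y
  proof -
    have "H +>\<^bsub>N\<^esub> y \<in> g ` carrier M" unfolding g(2) N.quotient_carrier using y by simp
    then obtain x where x: "x \<in> carrier M" "g x = H +>\<^bsub>N\<^esub> y" by auto
    obtain cs where cs: "u \<odot>\<^bsub>M\<^esub> x = lincomb M cs ms" "length cs = length ms" "set cs \<subseteq> carrier R"
      using bspec[OF ms(4) x(1)] unfolding combinations_def by auto
    have "g (u \<odot>\<^bsub>M\<^esub> x) = u \<odot>\<^bsub>quotient_module N H\<^esub> g x" using g(1) uR x(1) unfolding mod_hom_def by blast
    then have 1: "g (u \<odot>\<^bsub>M\<^esub> x) = H +>\<^bsub>N\<^esub> (u \<odot>\<^bsub>N\<^esub> y)" using x(2) N.quotient_smult[OF H uR y] by simp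
    have 2: "g (u \<odot>\<^bsub>M\<^esub> x) = H +>\<^bsub>N\<^esub> (lincomb N cs ns)"
      unfolding cs(1)
      by (rule mod_hom_quotient_lincomb[OF M N H g(1) cs(2)[symmetric] _ cs(3) ms(2) ns(2)])
         (use cs(2) q ms(1) ns(1) in \<open>auto simp: ns_def\<close>)
    define w where "w = lincomb N cs ns"
    have w: "w \<in> carrier N" "w \<in> combinations N (carrier R) ns"
      unfolding w_def combinations_def using cs(2,3) ns ms(1) by auto
    have uy: "u \<odot>\<^bsub>N\<^esub> y \<in> carrier N" using uR y by simp
    have "u \<odot>\<^bsub>N\<^esub> y \<ominus>\<^bsub>N\<^esub> w \<in> H" using 1 2 N.quotient_eq_iff[OF H uy w(1)] unfolding w_def by simp
    moreover have "u \<odot>\<^bsub>N\<^esub> y = w \<oplus>\<^bsub>N\<^esub> (u \<odot>\<^bsub>N\<^esub> y \<ominus>\<^bsub>N\<^esub> w)"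
      using uy w(1) by (simp only: N.M.minus_eq N.M.a_lcomm[OF w(1) uy N.M.a_inv_closed[OF w(1)]] N.M.r_neg N.M.r_zero)
    ultimately show ?thesis using w(2) unfolding H_def by (intro bexI)
  qed
  then have "\<exists>v\<in>carrier R - I. \<forall>x\<in>carrier N. v \<odot>\<^bsub>N\<^esub> x \<in> combinations N (carrier R) ns"
    by (rule N.nakayama_at_prime_span[OF cring.maximalideal_prime[OF module.axioms(1)[OF N] I] ps(1) ns(2) ms(3)])
  then show ?thesis unfolding locally_generated_def using ns by auto
qed

text \<open>Over the field of fractions of \<open>R\<close>, a module with a local basis of length \<open>\<nu>\<close> has dimension \<open>\<nu>\<close>,
  whichever ideals the basis and the generators belong to.\<close>

lemma locally_free_generators_ge:
  assumes "domain R" "module R M" "locally_free R I M \<nu>" "locally_generated R J M n"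
    and J: "ideal J R"
  shows "\<nu> \<le> n"
proof (rule ccontr)
  interpret M: module R M by fact
  interpret domain R by fact
  assume "\<not> \<nu> \<le> n"
  obtain ms where ms: "length ms = \<nu>" "lin_independent R M ms"
    using assms(3) unfolding locally_free_def by auto
  have msM: "set ms \<subseteq> carrier M" using ms(2) unfolding lin_independent_def by simp
  obtain ps v where ps: "length ps = n" "set ps \<subseteq> carrier M" "v \<in> carrier R - J"
      "\<forall>x\<in>carrier M. v \<odot>\<^bsub>M\<^esub> x \<in> combinations M (carrier R) ps"
    using assms(4) unfolding locally_generated_def by auto
  have v: "v \<in> carrier R" "v \<noteq> \<zero>\<^bsub>R\<^esub>"
    using ps(3) additive_subgroup.zero_closed[OF ideal.axioms(1)[OF J]] by auto
  let ?ys = "map ((\<odot>\<^bsub>M\<^esub>) v) ms"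
  have "set ?ys \<subseteq> combinations M (carrier R) ps" using ps(4) msM by auto
  moreover have "length ps < length ?ys" using ps(1) ms(1) \<open>\<not> \<nu> \<le> n\<close> by simp
  ultimately obtain cs where cs: "length cs = length ?ys" "set cs \<subseteq> carrier R" "\<not> set cs \<subseteq> {\<zero>\<^bsub>R\<^esub>}"
      "lincomb M cs ?ys = \<zero>\<^bsub>M\<^esub>"
    using M.linearly_dependent[OF assms(1) ps(2)] by metis
  let ?vcs = "map ((\<otimes>\<^bsub>R\<^esub>) v) cs"
  have "lincomb M ?vcs ms = \<zero>\<^bsub>M\<^esub>"
    using M.lincomb_smult[OF v(1) cs(2) msM] M.lincomb_map_smult[OF v(1) cs(2) msM] cs(4) by simp
  moreover have "set ?vcs \<subseteq> carrier R" using cs(2) v(1) by auto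
  moreover have "length ?vcs = length ms" using cs(1) by simp
  ultimately have "set ?vcs \<subseteq> {\<zero>\<^bsub>R\<^esub>}"
    using spec[OF conjunct2[OF ms(2)[unfolded lin_independent_def]], of ?vcs] by (simp only: simp_thms)
  then have "\<forall>c\<in>set cs. v \<otimes>\<^bsub>R\<^esub> c = \<zero>\<^bsub>R\<^esub>" by auto
  then have "c = \<zero>\<^bsub>R\<^esub>" if "c \<in> set cs" for c
    using that integral[of v c] v cs(2) by auto
  then show False using cs(3) by auto
qed

text \<open>A relation with coefficient \<open>r \<noteq> 0\<close> among the \<open>\<nu>\<close> local generators of \<open>N\<close> at \<open>I\<close> makes one of them
  superfluous at every maximal ideal that avoids \<open>r\<close> and the denominator \<open>u\<close>. Such an ideal exists,
  so \<open>M\<close> would have fewer than \<open>\<nu>\<close> generators there.\<close>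

lemma locally_free_transfer:
  assumes R: "noetherian_domain R" "finitely_generated_ring R" and M: "module R M" and N: "module R N"
    and fg: "finitely_generated_module R M" "finitely_generated_module R N"
    and cov: "covers_finite_quotients R M N" "covers_finite_quotients R N M"
    and I: "maximalideal I R" and free: "locally_free R I M \<nu>"
  shows "locally_free R I N \<nu>"
proof -
  interpret noetherian_domain R by fact
  interpret M: module R M by fact
  interpret N: module R N by fact
  interpret I: maximalideal I R by fact
  have "locally_generated R I N \<nu>"
    by (rule locally_generated_transfer[OF R(2) M N fg(2) cov(1) I locally_free_imp_generated[OF free]])
  then obtain ns u where ns: "length ns = \<nu>" "set ns \<subseteq> carrier N" "u \<in> carrier R - I"
      "\<forall>x\<in>carrier N. u \<odot>\<^bsub>N\<^esub> x \<in> combinations N (carrier R) ns"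
    unfolding locally_generated_def by auto
  have u: "u \<in> carrier R" "u \<noteq> \<zero>\<^bsub>R\<^esub>" using ns(3) I.zero_closed by auto
  have "lin_independent R N ns"
    unfolding lin_independent_def
  proof (intro conjI allI impI ns(2))
    fix cs assume cs: "length cs = length ns \<and> set cs \<subseteq> carrier R \<and> lincomb N cs ns = \<zero>\<^bsub>N\<^esub>"
    show "set cs \<subseteq> {\<zero>\<^bsub>R\<^esub>}"
    proof (rule ccontr)
      assume "\<not> set cs \<subseteq> {\<zero>\<^bsub>R\<^esub>}"
      then obtain r where r: "r \<in> set cs" "r \<noteq> \<zero>\<^bsub>R\<^esub>" by auto
      obtain c1 c2 where c: "cs = c1 @ r # c2" using split_list[OF r(1)] by auto
      define us where "us = take (length c1) ns"
      define y where "y = ns ! length c1"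
      define vs where "vs = drop (Suc (length c1)) ns"
      have len: "length c1 < length ns" using cs c by simp
      have ns_eq: "ns = us @ y # vs" unfolding us_def y_def vs_def using len by (rule id_take_nth_drop)
      have lens: "length c1 = length us" "length c2 = length vs" unfolding us_def vs_def using cs c by auto
      have rR: "r \<in> carrier R" and cR: "set c1 \<subseteq> carrier R" "set c2 \<subseteq> carrier R" using cs c by auto
      have yN: "y \<in> carrier N" and uv: "set us \<subseteq> carrier N" "set vs \<subseteq> carrier N" using ns(2) ns_eq by auto
      define C where "C = combinations N (carrier R) (us @ vs)"
      have uvN: "set (us @ vs) \<subseteq> carrier N" using uv by simp
      have C: "submodule C R N" unfolding C_def by (rule N.combinations_submodule[OF oneideal uvN])
      note Cc = N.submoduleE[OF C]
      have inC: "x \<in> C" if "x \<in> set (us @ vs)" for x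
        using N.generators_in_combinations[OF uvN] that unfolding C_def by auto
      define a where "a = lincomb N c1 us"
      define b where "b = lincomb N c2 vs"
      have ab: "a \<in> carrier N" "b \<in> carrier N" unfolding a_def b_def using cR uv by auto
      have abC: "a \<in> C" "b \<in> C"
        unfolding a_def b_def
        by (rule N.submodule_lincomb[OF C cR(1)], use inC in auto)
           (rule N.submodule_lincomb[OF C cR(2)], use inC in auto)
      have "a \<oplus>\<^bsub>N\<^esub> (r \<odot>\<^bsub>N\<^esub> y \<oplus>\<^bsub>N\<^esub> b) = \<zero>\<^bsub>N\<^esub>"
        using N.lincomb_append[OF lens(1) cR(1) _ uv(1), of "r # c2" "y # vs"] cs rR cR(2) yN uv(2)
        unfolding c ns_eq a_def b_def by simp
      then have "r \<odot>\<^bsub>N\<^esub> y \<oplus>\<^bsub>N\<^esub> (a \<oplus>\<^bsub>N\<^esub> b) = \<zero>\<^bsub>N\<^esub>" using ab rR yN by (simp add: N.M.a_lcomm)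
      then have "r \<odot>\<^bsub>N\<^esub> y = \<ominus>\<^bsub>N\<^esub> (a \<oplus>\<^bsub>N\<^esub> b)" using ab rR yN by (metis N.M.a_closed N.M.minus_equality N.smult_closed)
      then have ryC: "r \<odot>\<^bsub>N\<^esub> y \<in> C" using Cc(3)[OF Cc(5)[OF abC]] by simp
      define D where "D = {x \<in> carrier N. r \<odot>\<^bsub>N\<^esub> x \<in> C}"
      have D: "submodule D R N"
      proof (rule N.submoduleI)
        show "\<ominus>\<^bsub>N\<^esub> x \<in> D" if "x \<in> D" for x
          using that Cc(3) rR unfolding D_def by (auto simp: N.smult_r_minus)
        show "x \<oplus>\<^bsub>N\<^esub> z \<in> D" if "x \<in> D" "z \<in> D" for x z
          using that Cc(5) rR unfolding D_def by (auto simp: N.smult_r_distr)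
        show "s \<odot>\<^bsub>N\<^esub> x \<in> D" if s: "s \<in> carrier R" and x: "x \<in> D" for s x
        proof -
          have "r \<odot>\<^bsub>N\<^esub> (s \<odot>\<^bsub>N\<^esub> x) = s \<odot>\<^bsub>N\<^esub> (r \<odot>\<^bsub>N\<^esub> x)"
            using s x rR unfolding D_def by (simp add: N.smult_assoc1[symmetric] m_comm)
          then show ?thesis using Cc(4)[OF s] s x unfolding D_def by simp
        qed
      qed (use N.zero_in_submodule[OF C] rR in \<open>auto simp: D_def\<close>)
      have "set ns \<subseteq> D"
        unfolding ns_eq D_def using ryC yN uv inC Cc(4)[OF rR] by auto
      then have spanD: "combinations N (carrier R) ns \<subseteq> D"
        using N.submodule_lincomb[OF D] unfolding combinations_def by auto
      have ru: "r \<otimes>\<^bsub>R\<^esub> u \<in> carrier R" "r \<otimes>\<^bsub>R\<^esub> u \<noteq> \<zero>\<^bsub>R\<^esub>" using rR u r(2) integral[of r u] by auto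
      obtain J where J: "maximalideal J R" "r \<otimes>\<^bsub>R\<^esub> u \<notin> J"
        using exists_maximal_ideal_avoiding[OF R(2) ru] by metis
      have "(r \<otimes>\<^bsub>R\<^esub> u) \<odot>\<^bsub>N\<^esub> x \<in> C" if x: "x \<in> carrier N" for x
        using bspec[OF ns(4) x] spanD rR u(1) x unfolding D_def by (auto simp: N.smult_assoc1)
      then have "locally_generated R J N (\<nu> - 1)"
        unfolding locally_generated_def using ns(1) uvN ru(1) J(2)
        by (intro exI[of _ "us @ vs"] exI[of _ "r \<otimes>\<^bsub>R\<^esub> u"]) (simp add: C_def ns_eq)
      then have "locally_generated R J M (\<nu> - 1)"
        by (rule locally_generated_transfer[OF R(2) N M fg(1) cov(2) J(1)])
      moreover have "ideal J R" by (rule maximalideal.axioms(1)[OF J(1)])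
      ultimately have "\<nu> \<le> \<nu> - 1"
        by (rule locally_free_generators_ge[OF domain_axioms M free])
      moreover have "\<nu> > 0" using len ns(1) by simp
      ultimately show False by simp
    qed
  qed
  then show ?thesis unfolding locally_free_def using ns by auto
qed

lemma localised_atI:
  "noetherian_domain R \<Longrightarrow> module R M \<Longrightarrow> maximalideal I R \<Longrightarrow> localised_at I R M"
  by (intro localised_at.intro) (auto dest: noetherian_domain.axioms(2))

lemma projective_of_rank_transfer:
  assumes R: "noetherian_domain R" "finitely_generated_ring R" and M: "module R M" and N: "module R N"
    and fg: "finitely_generated_module R M" "finitely_generated_module R N"
    and cov: "covers_finite_quotients R M N" "covers_finite_quotients R N M"
    and proj: "projective_of_rank R M \<nu>"
  shows "projective_of_rank R N \<nu>"
proof -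
  have free: "locally_free R I N \<nu>" if I: "maximalideal I R" for I
  proof -
    have "free_of_rank (local_ring_at R I) (localised_module R I M) \<nu>"
      using proj I unfolding projective_of_rank_def by simp
    then have "locally_free R I M \<nu>"
      by (rule iffD1[OF localised_at.free_of_rank_iff[OF localised_atI[OF R(1) M I] fg(1)]])
    then show ?thesis by (rule locally_free_transfer[OF R M N fg cov I])
  qed
  have "projective_module R N"
    by (rule module.locally_free_imp_projective[OF N noetherian_domain.axioms(1)[OF R(1)] fg(2)])
       (use free in blast)
  moreover have "free_of_rank (local_ring_at R I) (localised_module R I N) \<nu>" if I: "maximalideal I R" for I
    by (rule iffD2[OF localised_at.free_of_rank_iff[OF localised_atI[OF R(1) N I] fg(2)] free[OF I]])
  ultimately show ?thesis
    unfolding projective_of_rank_def using fg(2) by simp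
qed

theorem propositionB:
  fixes R :: "('a, 'r) ring_scheme"
    and M :: "('a, 'm, 'k) module_scheme"
    and N :: "('a, 'n, 'l) module_scheme"
  assumes "noetherian_domain R"
    and "finitely_generated_ring R"
    and "Module.module R M" and "finitely_generated_module R M"
    and "Module.module R N" and "finitely_generated_module R N"
    and "profinite_completions_isomorphic R M N"
  shows "annihilator R M = annihilator R N \<and>
    (\<forall>I. maximalideal I R \<longrightarrow> local_min_generators R I M = local_min_generators R I N) \<and>
    (\<forall>\<nu>. projective_of_rank R M \<nu> \<longleftrightarrow> projective_of_rank R N \<nu>)"
proof (intro conjI allI impI)
  have noeth: "noetherian_ring R" by (rule noetherian_domain.axioms(1)[OF assms(1)])
  have cov: "covers_finite_quotients R M N" "covers_finite_quotients R N M"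
    using isomorphic_completions_finite_quotients[OF assms(3,5,7)]
    unfolding covers_finite_quotients_def by auto
  show "annihilator R M = annihilator R N"
    using annihilator_subset[OF noeth assms(2,3,5,6) cov(1)]
      annihilator_subset[OF noeth assms(2,5,3,4) cov(2)] by (rule equalityI)
  show "projective_of_rank R M \<nu> \<longleftrightarrow> projective_of_rank R N \<nu>" for \<nu>
    using projective_of_rank_transfer[OF assms(1-3,5,4,6) cov]
      projective_of_rank_transfer[OF assms(1,2,5,3,6,4) cov(2,1)] by (rule iffI)
  fix I assume I: "maximalideal I R"
  have "locally_generated R I M n \<longleftrightarrow> locally_generated R I N n" for n
    using locally_generated_transfer[OF assms(2,3,5,6) cov(1) I]
      locally_generated_transfer[OF assms(2,5,3,4) cov(2) I] by (rule iffI)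
  then show "local_min_generators R I M = local_min_generators R I N"
    using localised_at.local_min_generators_eq[OF localised_atI[OF assms(1,3) I] assms(4)]
      localised_at.local_min_generators_eq[OF localised_atI[OF assms(1,5) I] assms(6)] by simp
qed

end
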